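(* Let $G$ be a finite group. There are functors $$k\colon\mathrm{Mack}_{ps}(\mathrm{PermCat}_2)\to\mathrm{Mack}_{ps}(\mathrm{SymMonCat}_2)\quad\text{(the inclusion)},\qquad \ell\colon\mathrm{Mack}_{ps}(\mathrm{SymMonCat}_2)\to\mathrm{Mack}_{ps}(\mathrm{PermCat}_2)$$ such that 1. there is a natural transformation $\mu\colon k\circ\ell\Rightarrow1$ whose components are pseudo-natural transformations, each of whose component functors is a categorical equivalence; 2. there is a natural transformation $\epsilon\colon\ell\circ k\Rightarrow1$ whose components are strict 2-natural transformations, each of whose component functors is a categorical equivalence.
   Context: A permutative category is a symmetric monoidal small category whose sum is strictly associative and strictly unital. $\mathrm{PermCat}_2$ (resp. $\mathrm{SymMonCat}_2$) is the $(2,1)$-category of permutative (resp. symmetric monoidal) categories, strictly unital strong monoidal functors and monoidal natural isomorphisms. $\mathcal A^G_2$ is the $(2,1)$-category of finite $G$-sets, spans $S\leftarrow U\to T$ of finite $G$-sets, and isomorphisms of spans; composition is by pullback. $\mathrm{Mack}_{ps}(\mathscr D)$ is the 1-category of strictly unital additive (preserving finite products up to equivalence) pseudo-functors $\mathcal A^G_2\to\mathscr D$ and pseudo-natural transformations. *)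

theory Defs
  imports "HOL-Algebra.Group_Action" "HOL-Library.FuncSet" "HOL-Library.Infinite_Typeclass"
begin

section \<open>Categories, functors, natural transformations\<close>

record ('o, 'a) cat =
  Obj :: "'o set"
  Arr :: "'a set"
  Dom :: "'a \<Rightarrow> 'o"
  Cod :: "'a \<Rightarrow> 'o"
  Idt :: "'o \<Rightarrow> 'a"
  Cmp :: "'a \<Rightarrow> 'a \<Rightarrow> 'a"  (infixr "\<cdot>\<index>" 70)

definition Hom :: "('o, 'a, 'z) cat_scheme \<Rightarrow> 'o \<Rightarrow> 'o \<Rightarrow> 'a set" where
  "Hom C x y = {f \<in> Arr C. Dom C f = x \<and> Cod C f = y}"

locale category =
  fixes C :: "('o, 'a, 'z) cat_scheme" (structure)
  assumes Dom_in: "f \<in> Arr C \<Longrightarrow> Dom C f \<in> Obj C"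
    and Cod_in: "f \<in> Arr C \<Longrightarrow> Cod C f \<in> Obj C"
    and Idt_in: "x \<in> Obj C \<Longrightarrow> Idt C x \<in> Hom C x x"
    and Cmp_in: "f \<in> Hom C x y \<Longrightarrow> g \<in> Hom C y z \<Longrightarrow> g \<cdot> f \<in> Hom C x z"
    and Idt_left: "f \<in> Hom C x y \<Longrightarrow> Idt C y \<cdot> f = f"
    and Idt_right: "f \<in> Hom C x y \<Longrightarrow> f \<cdot> Idt C x = f"
    and Cmp_assoc: "f \<in> Hom C w x \<Longrightarrow> g \<in> Hom C x y \<Longrightarrow> h \<in> Hom C y z \<Longrightarrow>
      (h \<cdot> g) \<cdot> f = h \<cdot> (g \<cdot> f)"

definition Iso :: "('o, 'a, 'z) cat_scheme \<Rightarrow> 'o \<Rightarrow> 'o \<Rightarrow> 'a set" where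
  "Iso C x y = {f \<in> Hom C x y. \<exists>g \<in> Hom C y x. g \<cdot>\<^bsub>C\<^esub> f = Idt C x \<and> f \<cdot>\<^bsub>C\<^esub> g = Idt C y}"

record ('o, 'a, 'p, 'b) functr =
  OMap :: "'o \<Rightarrow> 'p"
  AMap :: "'a \<Rightarrow> 'b"

locale cat_functor = C: category C + D: category D
  for C :: "('o, 'a, 'z) cat_scheme" and D :: "('p, 'b, 'y) cat_scheme" +
  fixes F :: "('o, 'a, 'p, 'b, 'x) functr_scheme"
  assumes OMap_in: "x \<in> Obj C \<Longrightarrow> OMap F x \<in> Obj D"
    and AMap_in: "f \<in> Hom C x y \<Longrightarrow> AMap F f \<in> Hom D (OMap F x) (OMap F y)"
    and AMap_Idt: "x \<in> Obj C \<Longrightarrow> AMap F (Idt C x) = Idt D (OMap F x)"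
    and AMap_Cmp: "f \<in> Hom C x y \<Longrightarrow> g \<in> Hom C y z \<Longrightarrow>
      AMap F (g \<cdot>\<^bsub>C\<^esub> f) = AMap F g \<cdot>\<^bsub>D\<^esub> AMap F f"

definition identity_functor :: "('o, 'a, 'o, 'a) functr" where
  "identity_functor = \<lparr>OMap = id, AMap = id\<rparr>"

definition comp_functor ::
  "('p, 'b, 'q, 'c, 'x) functr_scheme \<Rightarrow> ('o, 'a, 'p, 'b, 'y) functr_scheme \<Rightarrow> ('o, 'a, 'q, 'c) functr" where
  "comp_functor H F = \<lparr>OMap = OMap H \<circ> OMap F, AMap = AMap H \<circ> AMap F\<rparr>"

locale natural_transformation = F: cat_functor C D F + G: cat_functor C D G
  for C :: "('o, 'a, 'z) cat_scheme" and D :: "('p, 'b, 'y) cat_scheme"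
    and F :: "('o, 'a, 'p, 'b, 'x) functr_scheme" and G :: "('o, 'a, 'p, 'b, 'w) functr_scheme" +
  fixes \<eta> :: "'o \<Rightarrow> 'b"
  assumes component_in: "x \<in> Obj C \<Longrightarrow> \<eta> x \<in> Hom D (OMap F x) (OMap G x)"
    and natural: "f \<in> Hom C x y \<Longrightarrow> AMap G f \<cdot>\<^bsub>D\<^esub> \<eta> x = \<eta> y \<cdot>\<^bsub>D\<^esub> AMap F f"

locale natural_isomorphism = natural_transformation +
  assumes component_iso: "x \<in> Obj C \<Longrightarrow> \<eta> x \<in> Iso D (OMap F x) (OMap G x)"

definition categorical_equivalence ::
  "('o, 'a, 'z) cat_scheme \<Rightarrow> ('p, 'b, 'y) cat_scheme \<Rightarrow> ('o, 'a, 'p, 'b, 'x) functr_scheme \<Rightarrow> bool" where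
  "categorical_equivalence C D F \<longleftrightarrow> cat_functor C D F \<and>
    (\<exists>H :: ('p, 'b, 'o, 'a) functr. cat_functor D C H \<and>
      (\<exists>\<eta>. natural_isomorphism C C (comp_functor H F) identity_functor \<eta>) \<and>
      (\<exists>\<epsilon>. natural_isomorphism D D (comp_functor F H) identity_functor \<epsilon>))"


section \<open>Symmetric monoidal and permutative categories\<close>

record ('o, 'a) smc = "('o, 'a) cat" +
  Sum :: "'o \<Rightarrow> 'o \<Rightarrow> 'o"  (infixr "\<boxplus>\<index>" 75)
  SumA :: "'a \<Rightarrow> 'a \<Rightarrow> 'a"  (infixr "\<boxtimes>\<index>" 75)
  Unt :: "'o"
  Asc :: "'o \<Rightarrow> 'o \<Rightarrow> 'o \<Rightarrow> 'a"
  Lun :: "'o \<Rightarrow> 'a"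
  Run :: "'o \<Rightarrow> 'a"
  Brd :: "'o \<Rightarrow> 'o \<Rightarrow> 'a"

text \<open>\<open>Sum\<close> and \<open>SumA\<close> are the object and arrow parts of the monoidal product.\<close>

locale symmetric_monoidal_category = category C
  for C :: "('o, 'a, 'z) smc_scheme" (structure) +
  assumes Sum_in: "x \<in> Obj C \<Longrightarrow> y \<in> Obj C \<Longrightarrow> x \<boxplus> y \<in> Obj C"
    and SumA_in: "f \<in> Hom C x x' \<Longrightarrow> g \<in> Hom C y y' \<Longrightarrow> f \<boxtimes> g \<in> Hom C (x \<boxplus> y) (x' \<boxplus> y')"
    and SumA_Idt: "x \<in> Obj C \<Longrightarrow> y \<in> Obj C \<Longrightarrow> Idt C x \<boxtimes> Idt C y = Idt C (x \<boxplus> y)"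
    and SumA_Cmp: "f \<in> Hom C x x' \<Longrightarrow> f' \<in> Hom C x' x'' \<Longrightarrow> g \<in> Hom C y y' \<Longrightarrow> g' \<in> Hom C y' y'' \<Longrightarrow>
      (f' \<cdot> f) \<boxtimes> (g' \<cdot> g) = (f' \<boxtimes> g') \<cdot> (f \<boxtimes> g)"
    and Unt_in: "Unt C \<in> Obj C"
    and Asc_iso: "x \<in> Obj C \<Longrightarrow> y \<in> Obj C \<Longrightarrow> z \<in> Obj C \<Longrightarrow>
      Asc C x y z \<in> Iso C ((x \<boxplus> y) \<boxplus> z) (x \<boxplus> (y \<boxplus> z))"
    and Lun_iso: "x \<in> Obj C \<Longrightarrow> Lun C x \<in> Iso C (Unt C \<boxplus> x) x"
    and Run_iso: "x \<in> Obj C \<Longrightarrow> Run C x \<in> Iso C (x \<boxplus> Unt C) x"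
    and Brd_iso: "x \<in> Obj C \<Longrightarrow> y \<in> Obj C \<Longrightarrow> Brd C x y \<in> Iso C (x \<boxplus> y) (y \<boxplus> x)"
    and Asc_natural: "f \<in> Hom C x x' \<Longrightarrow> g \<in> Hom C y y' \<Longrightarrow> h \<in> Hom C z z' \<Longrightarrow>
      Asc C x' y' z' \<cdot> ((f \<boxtimes> g) \<boxtimes> h) = (f \<boxtimes> (g \<boxtimes> h)) \<cdot> Asc C x y z"
    and Lun_natural: "f \<in> Hom C x x' \<Longrightarrow> Lun C x' \<cdot> (Idt C (Unt C) \<boxtimes> f) = f \<cdot> Lun C x"
    and Run_natural: "f \<in> Hom C x x' \<Longrightarrow> Run C x' \<cdot> (f \<boxtimes> Idt C (Unt C)) = f \<cdot> Run C x"
    and Brd_natural: "f \<in> Hom C x x' \<Longrightarrow> g \<in> Hom C y y' \<Longrightarrow>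
      Brd C x' y' \<cdot> (f \<boxtimes> g) = (g \<boxtimes> f) \<cdot> Brd C x y"
    and pentagon: "w \<in> Obj C \<Longrightarrow> x \<in> Obj C \<Longrightarrow> y \<in> Obj C \<Longrightarrow> z \<in> Obj C \<Longrightarrow>
      Asc C w x (y \<boxplus> z) \<cdot> Asc C (w \<boxplus> x) y z =
      (Idt C w \<boxtimes> Asc C x y z) \<cdot> Asc C w (x \<boxplus> y) z \<cdot> (Asc C w x y \<boxtimes> Idt C z)"
    and triangle: "x \<in> Obj C \<Longrightarrow> y \<in> Obj C \<Longrightarrow>
      (Idt C x \<boxtimes> Lun C y) \<cdot> Asc C x (Unt C) y = Run C x \<boxtimes> Idt C y"
    and hexagon: "x \<in> Obj C \<Longrightarrow> y \<in> Obj C \<Longrightarrow> z \<in> Obj C \<Longrightarrow>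
      Asc C y z x \<cdot> Brd C x (y \<boxplus> z) \<cdot> Asc C x y z =
      (Idt C y \<boxtimes> Brd C x z) \<cdot> Asc C y x z \<cdot> (Brd C x y \<boxtimes> Idt C z)"
    and symmetry: "x \<in> Obj C \<Longrightarrow> y \<in> Obj C \<Longrightarrow> Brd C y x \<cdot> Brd C x y = Idt C (x \<boxplus> y)"

text \<open>Strictness on arrows follows from naturality of the identity constraints.\<close>

locale permutative_category = symmetric_monoidal_category +
  assumes Sum_assoc: "x \<in> Obj C \<Longrightarrow> y \<in> Obj C \<Longrightarrow> z \<in> Obj C \<Longrightarrow> (x \<boxplus> y) \<boxplus> z = x \<boxplus> (y \<boxplus> z)"
    and Sum_Unt_left: "x \<in> Obj C \<Longrightarrow> Unt C \<boxplus> x = x"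
    and Sum_Unt_right: "x \<in> Obj C \<Longrightarrow> x \<boxplus> Unt C = x"
    and Asc_strict: "x \<in> Obj C \<Longrightarrow> y \<in> Obj C \<Longrightarrow> z \<in> Obj C \<Longrightarrow>
      Asc C x y z = Idt C (x \<boxplus> (y \<boxplus> z))"
    and Lun_strict: "x \<in> Obj C \<Longrightarrow> Lun C x = Idt C x"
    and Run_strict: "x \<in> Obj C \<Longrightarrow> Run C x = Idt C x"

text \<open>
  The structure map \<open>Mul (x, y)\<close> goes from \<open>F x \<boxplus> F y\<close> to \<open>F (x \<boxplus> y)\<close>. Strict unitality says that the
  unit is preserved on the nose and that the unit constraint is an identity, so the latter is not
  recorded. As usual, functors between symmetric monoidal categories respect the symmetry.
  Maps are required to be extensional so that equality of cells is equality on the carriers.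
\<close>

record ('o, 'a) smfun = "('o, 'a, 'o, 'a) functr" +
  Src :: "('o, 'a) smc"
  Tgt :: "('o, 'a) smc"
  Mul :: "'o \<times> 'o \<Rightarrow> 'a"

locale strong_monoidal_functor =
  C: symmetric_monoidal_category "Src F" + D: symmetric_monoidal_category "Tgt F" +
  cat_functor "Src F" "Tgt F" F
  for F :: "('o, 'a) smfun" +
  assumes Mul_iso: "x \<in> Obj (Src F) \<Longrightarrow> y \<in> Obj (Src F) \<Longrightarrow>
      Mul F (x, y) \<in> Iso (Tgt F) (OMap F x \<boxplus>\<^bsub>Tgt F\<^esub> OMap F y) (OMap F (x \<boxplus>\<^bsub>Src F\<^esub> y))"
    and Mul_natural: "f \<in> Hom (Src F) x x' \<Longrightarrow> g \<in> Hom (Src F) y y' \<Longrightarrow>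
      Mul F (x', y') \<cdot>\<^bsub>Tgt F\<^esub> (AMap F f \<boxtimes>\<^bsub>Tgt F\<^esub> AMap F g) = AMap F (f \<boxtimes>\<^bsub>Src F\<^esub> g) \<cdot>\<^bsub>Tgt F\<^esub> Mul F (x, y)"
    and Mul_Asc: "x \<in> Obj (Src F) \<Longrightarrow> y \<in> Obj (Src F) \<Longrightarrow> z \<in> Obj (Src F) \<Longrightarrow>
      AMap F (Asc (Src F) x y z) \<cdot>\<^bsub>Tgt F\<^esub> Mul F (x \<boxplus>\<^bsub>Src F\<^esub> y, z) \<cdot>\<^bsub>Tgt F\<^esub>
        (Mul F (x, y) \<boxtimes>\<^bsub>Tgt F\<^esub> Idt (Tgt F) (OMap F z)) =
      Mul F (x, y \<boxplus>\<^bsub>Src F\<^esub> z) \<cdot>\<^bsub>Tgt F\<^esub> (Idt (Tgt F) (OMap F x) \<boxtimes>\<^bsub>Tgt F\<^esub> Mul F (y, z)) \<cdot>\<^bsub>Tgt F\<^esub>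
        Asc (Tgt F) (OMap F x) (OMap F y) (OMap F z)"
    and Mul_Brd: "x \<in> Obj (Src F) \<Longrightarrow> y \<in> Obj (Src F) \<Longrightarrow>
      AMap F (Brd (Src F) x y) \<cdot>\<^bsub>Tgt F\<^esub> Mul F (x, y) =
      Mul F (y, x) \<cdot>\<^bsub>Tgt F\<^esub> Brd (Tgt F) (OMap F x) (OMap F y)"
    and Unt_strict: "OMap F (Unt (Src F)) = Unt (Tgt F)"
    and Mul_Lun: "x \<in> Obj (Src F) \<Longrightarrow>
      AMap F (Lun (Src F) x) \<cdot>\<^bsub>Tgt F\<^esub> Mul F (Unt (Src F), x) = Lun (Tgt F) (OMap F x)"
    and Mul_Run: "x \<in> Obj (Src F) \<Longrightarrow>
      AMap F (Run (Src F) x) \<cdot>\<^bsub>Tgt F\<^esub> Mul F (x, Unt (Src F)) = Run (Tgt F) (OMap F x)"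
    and OMap_ext: "OMap F \<in> extensional (Obj (Src F))"
    and AMap_ext: "AMap F \<in> extensional (Arr (Src F))"
    and Mul_ext: "Mul F \<in> extensional (Obj (Src F) \<times> Obj (Src F))"

record ('o, 'a) smnat =
  NSrc :: "('o, 'a) smfun"
  NTgt :: "('o, 'a) smfun"
  NMap :: "'o \<Rightarrow> 'a"

locale monoidal_natural_isomorphism =
  F: strong_monoidal_functor "NSrc \<alpha>" + G: strong_monoidal_functor "NTgt \<alpha>" +
  natural_isomorphism "Src (NSrc \<alpha>)" "Tgt (NSrc \<alpha>)" "NSrc \<alpha>" "NTgt \<alpha>" "NMap \<alpha>"
  for \<alpha> :: "('o, 'a) smnat" +
  assumes Src_eq: "Src (NTgt \<alpha>) = Src (NSrc \<alpha>)"
    and Tgt_eq: "Tgt (NTgt \<alpha>) = Tgt (NSrc \<alpha>)"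
    and NMap_Sum: "x \<in> Obj (Src (NSrc \<alpha>)) \<Longrightarrow> y \<in> Obj (Src (NSrc \<alpha>)) \<Longrightarrow>
      NMap \<alpha> (x \<boxplus>\<^bsub>Src (NSrc \<alpha>)\<^esub> y) \<cdot>\<^bsub>Tgt (NSrc \<alpha>)\<^esub> Mul (NSrc \<alpha>) (x, y) =
      Mul (NTgt \<alpha>) (x, y) \<cdot>\<^bsub>Tgt (NSrc \<alpha>)\<^esub> (NMap \<alpha> x \<boxtimes>\<^bsub>Tgt (NSrc \<alpha>)\<^esub> NMap \<alpha> y)"
    and NMap_Unt: "NMap \<alpha> (Unt (Src (NSrc \<alpha>))) = Idt (Tgt (NSrc \<alpha>)) (Unt (Tgt (NSrc \<alpha>)))"
    and NMap_ext: "NMap \<alpha> \<in> extensional (Obj (Src (NSrc \<alpha>)))"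


section \<open>Two-dimensional categories\<close>

text \<open>
  The data of a strict 2-category, and of a bicategory. Every cell determines its boundary;
  \<open>g \<star> f\<close> composes 1-cells, \<open>\<beta> \<bullet> \<alpha>\<close> is vertical and \<open>\<beta> \<diamondop> \<alpha>\<close> horizontal composition of 2-cells, all in
  the order of composition of maps. \<open>Assoc2 h g f\<close> goes from \<open>(h \<star> g) \<star> f\<close> to \<open>h \<star> (g \<star> f)\<close>.
\<close>

record ('o, 'f, 'a) twocat =
  Cell0 :: "'o set"
  Cell1 :: "'f set"
  Cell2 :: "'a set"
  Src1 :: "'f \<Rightarrow> 'o"
  Tgt1 :: "'f \<Rightarrow> 'o"
  Src2 :: "'a \<Rightarrow> 'f"
  Tgt2 :: "'a \<Rightarrow> 'f"
  Id1 :: "'o \<Rightarrow> 'f"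
  Id2 :: "'f \<Rightarrow> 'a"
  Comp1 :: "'f \<Rightarrow> 'f \<Rightarrow> 'f"  (infixr "\<star>\<index>" 75)
  VComp :: "'a \<Rightarrow> 'a \<Rightarrow> 'a"  (infixr "\<bullet>\<index>" 70)
  HComp :: "'a \<Rightarrow> 'a \<Rightarrow> 'a"  (infixr "\<diamondop>\<index>" 75)

record ('o, 'f, 'a) bicat = "('o, 'f, 'a) twocat" +
  Assoc2 :: "'f \<Rightarrow> 'f \<Rightarrow> 'f \<Rightarrow> 'a"
  LUnit2 :: "'f \<Rightarrow> 'a"
  RUnit2 :: "'f \<Rightarrow> 'a"

definition Hom1 :: "('o, 'f, 'a, 'z) twocat_scheme \<Rightarrow> 'o \<Rightarrow> 'o \<Rightarrow> 'f set" where
  "Hom1 B x y = {f \<in> Cell1 B. Src1 B f = x \<and> Tgt1 B f = y}"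

definition Hom2 :: "('o, 'f, 'a, 'z) twocat_scheme \<Rightarrow> 'f \<Rightarrow> 'f \<Rightarrow> 'a set" where
  "Hom2 B f g = {\<alpha> \<in> Cell2 B. Src2 B \<alpha> = f \<and> Tgt2 B \<alpha> = g}"

definition Iso2 :: "('o, 'f, 'a, 'z) twocat_scheme \<Rightarrow> 'f \<Rightarrow> 'f \<Rightarrow> 'a set" where
  "Iso2 B f g = {\<alpha> \<in> Hom2 B f g. \<exists>\<beta> \<in> Hom2 B g f. \<beta> \<bullet>\<^bsub>B\<^esub> \<alpha> = Id2 B f \<and> \<alpha> \<bullet>\<^bsub>B\<^esub> \<beta> = Id2 B g}"

text \<open>Bicategorical product: each functor \<open>Hom(W, P) \<rightarrow> \<Prod>i\<in>I. Hom(W, X\<^sub>i)\<close> induced by the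
  projections \<open>p i : P \<rightarrow> X\<^sub>i\<close> is an equivalence (essentially surjective and fully faithful).
  For empty \<open>I\<close> this says that \<open>P\<close> is terminal.\<close>

definition product_cone ::
  "('o, 'f, 'a, 'z) twocat_scheme \<Rightarrow> 'i set \<Rightarrow> 'o \<Rightarrow> ('i \<Rightarrow> 'f) \<Rightarrow> bool" where
  "product_cone B I P p \<longleftrightarrow> P \<in> Cell0 B \<and> (\<forall>i \<in> I. p i \<in> Cell1 B \<and> Src1 B (p i) = P) \<and>
    (\<forall>W \<in> Cell0 B.
      (\<forall>f. (\<forall>i \<in> I. f i \<in> Hom1 B W (Tgt1 B (p i))) \<longrightarrow>
        (\<exists>h \<in> Hom1 B W P. \<forall>i \<in> I. \<exists>\<alpha>. \<alpha> \<in> Iso2 B (p i \<star>\<^bsub>B\<^esub> h) (f i))) \<and>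
      (\<forall>h \<in> Hom1 B W P. \<forall>h' \<in> Hom1 B W P. \<forall>\<alpha>.
        (\<forall>i \<in> I. \<alpha> i \<in> Hom2 B (p i \<star>\<^bsub>B\<^esub> h) (p i \<star>\<^bsub>B\<^esub> h')) \<longrightarrow>
        (\<exists>!\<beta>. \<beta> \<in> Hom2 B h h' \<and> (\<forall>i \<in> I. Id2 B (p i) \<diamondop>\<^bsub>B\<^esub> \<beta> = \<alpha> i))))"

definition full_sub_twocat :: "('o, 'f, 'a) twocat \<Rightarrow> 'o set \<Rightarrow> ('o, 'f, 'a) twocat" where
  "full_sub_twocat B S = B\<lparr>
    Cell0 := Cell0 B \<inter> S,
    Cell1 := {f \<in> Cell1 B. Src1 B f \<in> S \<and> Tgt1 B f \<in> S},
    Cell2 := {\<alpha> \<in> Cell2 B. Src1 B (Src2 B \<alpha>) \<in> S \<and> Tgt1 B (Src2 B \<alpha>) \<in> S}\<rparr>"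


subsection \<open>The 2-categories of symmetric monoidal and of permutative categories\<close>

definition id_smfun :: "('o, 'a) smc \<Rightarrow> ('o, 'a) smfun" where
  "id_smfun C = \<lparr>OMap = (\<lambda>x \<in> Obj C. x), AMap = (\<lambda>f \<in> Arr C. f), Src = C, Tgt = C,
    Mul = (\<lambda>(x, y) \<in> Obj C \<times> Obj C. Idt C (x \<boxplus>\<^bsub>C\<^esub> y))\<rparr>"

definition comp_smfun :: "('o, 'a) smfun \<Rightarrow> ('o, 'a) smfun \<Rightarrow> ('o, 'a) smfun" where
  "comp_smfun G F = \<lparr>OMap = compose (Obj (Src F)) (OMap G) (OMap F),
    AMap = compose (Arr (Src F)) (AMap G) (AMap F), Src = Src F, Tgt = Tgt G,
    Mul = (\<lambda>(x, y) \<in> Obj (Src F) \<times> Obj (Src F).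
      AMap G (Mul F (x, y)) \<cdot>\<^bsub>Tgt G\<^esub> Mul G (OMap F x, OMap F y))\<rparr>"

definition id_smnat :: "('o, 'a) smfun \<Rightarrow> ('o, 'a) smnat" where
  "id_smnat F = \<lparr>NSrc = F, NTgt = F, NMap = (\<lambda>x \<in> Obj (Src F). Idt (Tgt F) (OMap F x))\<rparr>"

definition vcomp_smnat :: "('o, 'a) smnat \<Rightarrow> ('o, 'a) smnat \<Rightarrow> ('o, 'a) smnat" where
  "vcomp_smnat \<beta> \<alpha> = \<lparr>NSrc = NSrc \<alpha>, NTgt = NTgt \<beta>,
    NMap = (\<lambda>x \<in> Obj (Src (NSrc \<alpha>)). NMap \<beta> x \<cdot>\<^bsub>Tgt (NSrc \<alpha>)\<^esub> NMap \<alpha> x)\<rparr>"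

definition hcomp_smnat :: "('o, 'a) smnat \<Rightarrow> ('o, 'a) smnat \<Rightarrow> ('o, 'a) smnat" where
  "hcomp_smnat \<beta> \<alpha> = \<lparr>NSrc = comp_smfun (NSrc \<beta>) (NSrc \<alpha>), NTgt = comp_smfun (NTgt \<beta>) (NTgt \<alpha>),
    NMap = (\<lambda>x \<in> Obj (Src (NSrc \<alpha>)).
      NMap \<beta> (OMap (NTgt \<alpha>) x) \<cdot>\<^bsub>Tgt (NSrc \<beta>)\<^esub> AMap (NSrc \<beta>) (NMap \<alpha> x))\<rparr>"

text \<open>
  Smallness is relative to a type \<open>'u\<close>: a small category has its objects and its arrows in \<open>'u\<close>.
  Passing to words of objects stays within this universe as soon as \<open>'u\<close> is infinite.
\<close>

type_synonym 'u smc_twocat = "(('u, 'u) smc, ('u, 'u) smfun, ('u, 'u) smnat) twocat"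

definition SymMonCat :: "'u smc_twocat" where
  "SymMonCat = \<lparr>
    Cell0 = {C. symmetric_monoidal_category C},
    Cell1 = {F. strong_monoidal_functor F},
    Cell2 = {\<alpha>. monoidal_natural_isomorphism \<alpha>},
    Src1 = Src, Tgt1 = Tgt, Src2 = NSrc, Tgt2 = NTgt,
    Id1 = id_smfun, Id2 = id_smnat, Comp1 = comp_smfun, VComp = vcomp_smnat, HComp = hcomp_smnat\<rparr>"

definition PermCat :: "'u smc_twocat" where
  "PermCat = full_sub_twocat SymMonCat {C. permutative_category C}"


subsection \<open>Spans of finite G-sets\<close>

text \<open>
  Finite \<open>G\<close>-sets are taken with elements in a type closed under ordered pairs, so that the usual
  pullbacks \<open>{(u, v). r u = l v}\<close> are available; the type is infinite, so it contains a copy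
  of every finite \<open>G\<close>-set.
\<close>

datatype 'x elt = Elt 'x | Tup "'x elt" "'x elt"

record ('g, 'x) gset =
  Car :: "'x elt set"
  Act :: "'g \<Rightarrow> 'x elt \<Rightarrow> 'x elt"

definition finite_gset :: "('g, 'm) monoid_scheme \<Rightarrow> ('g, 'x) gset \<Rightarrow> bool" where
  "finite_gset G S \<longleftrightarrow> finite (Car S) \<and> group_action G (Car S) (Act S) \<and> Act S \<in> extensional (carrier G)"

definition equivariant_maps ::
  "('g, 'm) monoid_scheme \<Rightarrow> ('g, 'x) gset \<Rightarrow> ('g, 'x) gset \<Rightarrow> ('x elt \<Rightarrow> 'x elt) set" where
  "equivariant_maps G S T = {f \<in> Car S \<rightarrow>\<^sub>E Car T.
    \<forall>g \<in> carrier G. \<forall>x \<in> Car S. f (Act S g x) = Act T g (f x)}"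

record ('g, 'x) span =
  SSrc :: "('g, 'x) gset"
  STgt :: "('g, 'x) gset"
  Apex :: "('g, 'x) gset"
  LegL :: "'x elt \<Rightarrow> 'x elt"
  LegR :: "'x elt \<Rightarrow> 'x elt"

definition is_span :: "('g, 'm) monoid_scheme \<Rightarrow> ('g, 'x) span \<Rightarrow> bool" where
  "is_span G f \<longleftrightarrow> finite_gset G (SSrc f) \<and> finite_gset G (STgt f) \<and> finite_gset G (Apex f) \<and>
    LegL f \<in> equivariant_maps G (Apex f) (SSrc f) \<and> LegR f \<in> equivariant_maps G (Apex f) (STgt f)"

record ('g, 'x) span_map =
  MSrc :: "('g, 'x) span"
  MTgt :: "('g, 'x) span"
  MMap :: "'x elt \<Rightarrow> 'x elt"

definition is_span_iso :: "('g, 'm) monoid_scheme \<Rightarrow> ('g, 'x) span_map \<Rightarrow> bool" where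
  "is_span_iso G \<alpha> \<longleftrightarrow> is_span G (MSrc \<alpha>) \<and> is_span G (MTgt \<alpha>) \<and>
    SSrc (MTgt \<alpha>) = SSrc (MSrc \<alpha>) \<and> STgt (MTgt \<alpha>) = STgt (MSrc \<alpha>) \<and>
    MMap \<alpha> \<in> equivariant_maps G (Apex (MSrc \<alpha>)) (Apex (MTgt \<alpha>)) \<and>
    bij_betw (MMap \<alpha>) (Car (Apex (MSrc \<alpha>))) (Car (Apex (MTgt \<alpha>))) \<and>
    (\<forall>u \<in> Car (Apex (MSrc \<alpha>)). LegL (MTgt \<alpha>) (MMap \<alpha> u) = LegL (MSrc \<alpha>) u \<and>
      LegR (MTgt \<alpha>) (MMap \<alpha> u) = LegR (MSrc \<alpha>) u)"

definition pullback_gset ::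
  "('g, 'm) monoid_scheme \<Rightarrow> ('g, 'x) gset \<Rightarrow> ('g, 'x) gset \<Rightarrow> ('x elt \<Rightarrow> 'x elt) \<Rightarrow> ('x elt \<Rightarrow> 'x elt) \<Rightarrow>
    ('g, 'x) gset" where
  "pullback_gset G U V r l =
    (let P = {Tup u v | u v. u \<in> Car U \<and> v \<in> Car V \<and> r u = l v}
     in \<lparr>Car = P, Act = (\<lambda>g \<in> carrier G. \<lambda>z \<in> P. case z of Tup u v \<Rightarrow> Tup (Act U g u) (Act V g v))\<rparr>)"

text \<open>Below, \<open>f\<close> is a span from \<open>S\<close> to \<open>T\<close> and \<open>h\<close> one from \<open>T\<close> to \<open>R\<close>; elements of the apex
  of the composite are pairs whose first entry lies in the apex of \<open>f\<close>.\<close>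

definition comp_span :: "('g, 'm) monoid_scheme \<Rightarrow> ('g, 'x) span \<Rightarrow> ('g, 'x) span \<Rightarrow> ('g, 'x) span" where
  "comp_span G h f =
    (let P = pullback_gset G (Apex f) (Apex h) (LegR f) (LegL h)
     in \<lparr>SSrc = SSrc f, STgt = STgt h, Apex = P,
         LegL = (\<lambda>z \<in> Car P. case z of Tup u v \<Rightarrow> LegL f u),
         LegR = (\<lambda>z \<in> Car P. case z of Tup u v \<Rightarrow> LegR h v)\<rparr>)"

definition id_span :: "('g, 'x) gset \<Rightarrow> ('g, 'x) span" where
  "id_span S = \<lparr>SSrc = S, STgt = S, Apex = S, LegL = (\<lambda>x \<in> Car S. x), LegR = (\<lambda>x \<in> Car S. x)\<rparr>"

definition id_span_map :: "('g, 'x) span \<Rightarrow> ('g, 'x) span_map" where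
  "id_span_map f = \<lparr>MSrc = f, MTgt = f, MMap = (\<lambda>u \<in> Car (Apex f). u)\<rparr>"

definition vcomp_span_map :: "('g, 'x) span_map \<Rightarrow> ('g, 'x) span_map \<Rightarrow> ('g, 'x) span_map" where
  "vcomp_span_map \<beta> \<alpha> = \<lparr>MSrc = MSrc \<alpha>, MTgt = MTgt \<beta>,
    MMap = compose (Car (Apex (MSrc \<alpha>))) (MMap \<beta>) (MMap \<alpha>)\<rparr>"

definition hcomp_span_map ::
  "('g, 'm) monoid_scheme \<Rightarrow> ('g, 'x) span_map \<Rightarrow> ('g, 'x) span_map \<Rightarrow> ('g, 'x) span_map" where
  "hcomp_span_map G \<beta> \<alpha> =
    \<lparr>MSrc = comp_span G (MSrc \<beta>) (MSrc \<alpha>), MTgt = comp_span G (MTgt \<beta>) (MTgt \<alpha>),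
     MMap = (\<lambda>z \<in> Car (Apex (comp_span G (MSrc \<beta>) (MSrc \<alpha>))).
       case z of Tup u v \<Rightarrow> Tup (MMap \<alpha> u) (MMap \<beta> v))\<rparr>"

definition assoc_span ::
  "('g, 'm) monoid_scheme \<Rightarrow> ('g, 'x) span \<Rightarrow> ('g, 'x) span \<Rightarrow> ('g, 'x) span \<Rightarrow> ('g, 'x) span_map" where
  "assoc_span G k h f =
    \<lparr>MSrc = comp_span G (comp_span G k h) f, MTgt = comp_span G k (comp_span G h f),
     MMap = (\<lambda>z \<in> Car (Apex (comp_span G (comp_span G k h) f)).
       case z of Tup u (Tup v w) \<Rightarrow> Tup (Tup u v) w)\<rparr>"

definition lunit_span :: "('g, 'm) monoid_scheme \<Rightarrow> ('g, 'x) span \<Rightarrow> ('g, 'x) span_map" where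
  "lunit_span G f = \<lparr>MSrc = comp_span G (id_span (STgt f)) f, MTgt = f,
     MMap = (\<lambda>z \<in> Car (Apex (comp_span G (id_span (STgt f)) f)). case z of Tup u t \<Rightarrow> u)\<rparr>"

definition runit_span :: "('g, 'm) monoid_scheme \<Rightarrow> ('g, 'x) span \<Rightarrow> ('g, 'x) span_map" where
  "runit_span G f = \<lparr>MSrc = comp_span G f (id_span (SSrc f)), MTgt = f,
     MMap = (\<lambda>z \<in> Car (Apex (comp_span G f (id_span (SSrc f)))). case z of Tup s u \<Rightarrow> u)\<rparr>"

type_synonym ('g, 'x) span_bicat = "(('g, 'x) gset, ('g, 'x) span, ('g, 'x) span_map) bicat"

definition GSpan :: "('g, 'm) monoid_scheme \<Rightarrow> ('g, 'x) span_bicat" where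
  "GSpan G = \<lparr>
    Cell0 = {S. finite_gset G S},
    Cell1 = {f. is_span G f},
    Cell2 = {\<alpha>. is_span_iso G \<alpha>},
    Src1 = SSrc, Tgt1 = STgt, Src2 = MSrc, Tgt2 = MTgt,
    Id1 = id_span, Id2 = id_span_map,
    Comp1 = comp_span G, VComp = vcomp_span_map, HComp = hcomp_span_map G,
    Assoc2 = assoc_span G, LUnit2 = lunit_span G, RUnit2 = runit_span G\<rparr>"


section \<open>Pseudo-functors and pseudo-natural transformations\<close>

text \<open>
  Pseudo-functors go from a bicategory \<open>A\<close> to a strict 2-category \<open>D\<close>; hence no constraint cells
  of \<open>D\<close> appear. \<open>PC (g, f)\<close> is the composition constraint from \<open>X g \<star> X f\<close> to \<open>X (g \<star> f)\<close>. Strict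
  unitality means that identity 1-cells are preserved with identity unit constraints.
\<close>

record ('o, 'f, 'a, 'p, 'g, 'b) psfun =
  P0 :: "'o \<Rightarrow> 'p"
  P1 :: "'f \<Rightarrow> 'g"
  P2 :: "'a \<Rightarrow> 'b"
  PC :: "'f \<times> 'f \<Rightarrow> 'b"

definition composable :: "('o, 'f, 'a, 'z) twocat_scheme \<Rightarrow> ('f \<times> 'f) set" where
  "composable B = {(g, f). g \<in> Cell1 B \<and> f \<in> Cell1 B \<and> Src1 B g = Tgt1 B f}"

locale strictly_unital_pseudofunctor =
  fixes A :: "('o, 'f, 'a, 'z) bicat_scheme"
    and D :: "('p, 'g, 'b, 'y) twocat_scheme"
    and X :: "('o, 'f, 'a, 'p, 'g, 'b) psfun"
  assumes P0_in: "s \<in> Cell0 A \<Longrightarrow> P0 X s \<in> Cell0 D"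
    and P1_in: "f \<in> Hom1 A s t \<Longrightarrow> P1 X f \<in> Hom1 D (P0 X s) (P0 X t)"
    and P2_in: "\<alpha> \<in> Hom2 A f g \<Longrightarrow> P2 X \<alpha> \<in> Hom2 D (P1 X f) (P1 X g)"
    and P2_Id2: "f \<in> Cell1 A \<Longrightarrow> P2 X (Id2 A f) = Id2 D (P1 X f)"
    and P2_VComp: "\<alpha> \<in> Hom2 A f g \<Longrightarrow> \<beta> \<in> Hom2 A g h \<Longrightarrow>
      P2 X (\<beta> \<bullet>\<^bsub>A\<^esub> \<alpha>) = P2 X \<beta> \<bullet>\<^bsub>D\<^esub> P2 X \<alpha>"
    and P1_Id1: "s \<in> Cell0 A \<Longrightarrow> P1 X (Id1 A s) = Id1 D (P0 X s)"
    and PC_iso: "(g, f) \<in> composable A \<Longrightarrow>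
      PC X (g, f) \<in> Iso2 D (P1 X g \<star>\<^bsub>D\<^esub> P1 X f) (P1 X (g \<star>\<^bsub>A\<^esub> f))"
    and PC_natural: "(g, f) \<in> composable A \<Longrightarrow> \<alpha> \<in> Hom2 A f f' \<Longrightarrow> \<beta> \<in> Hom2 A g g' \<Longrightarrow>
      PC X (g', f') \<bullet>\<^bsub>D\<^esub> (P2 X \<beta> \<diamondop>\<^bsub>D\<^esub> P2 X \<alpha>) = P2 X (\<beta> \<diamondop>\<^bsub>A\<^esub> \<alpha>) \<bullet>\<^bsub>D\<^esub> PC X (g, f)"
    and PC_assoc: "(g, f) \<in> composable A \<Longrightarrow> (h, g) \<in> composable A \<Longrightarrow>
      P2 X (Assoc2 A h g f) \<bullet>\<^bsub>D\<^esub> PC X (h \<star>\<^bsub>A\<^esub> g, f) \<bullet>\<^bsub>D\<^esub> (PC X (h, g) \<diamondop>\<^bsub>D\<^esub> Id2 D (P1 X f)) =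
      PC X (h, g \<star>\<^bsub>A\<^esub> f) \<bullet>\<^bsub>D\<^esub> (Id2 D (P1 X h) \<diamondop>\<^bsub>D\<^esub> PC X (g, f))"
    and PC_lunit: "f \<in> Hom1 A s t \<Longrightarrow> P2 X (LUnit2 A f) \<bullet>\<^bsub>D\<^esub> PC X (Id1 A t, f) = Id2 D (P1 X f)"
    and PC_runit: "f \<in> Hom1 A s t \<Longrightarrow> P2 X (RUnit2 A f) \<bullet>\<^bsub>D\<^esub> PC X (f, Id1 A s) = Id2 D (P1 X f)"
    and P0_ext: "P0 X \<in> extensional (Cell0 A)"
    and P1_ext: "P1 X \<in> extensional (Cell1 A)"
    and P2_ext: "P2 X \<in> extensional (Cell2 A)"
    and PC_ext: "PC X \<in> extensional (composable A)"

text \<open>Preservation of finite products up to equivalence: finite product cones in the bicategorical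
  sense are sent to product cones in the bicategorical sense.\<close>

definition additive ::
  "('o, 'f, 'a, 'z) bicat_scheme \<Rightarrow> ('p, 'g, 'b, 'y) twocat_scheme \<Rightarrow> ('o, 'f, 'a, 'p, 'g, 'b) psfun \<Rightarrow> bool" where
  "additive A D X \<longleftrightarrow> (\<forall>(I :: nat set) P p. finite I \<longrightarrow> product_cone A I P p \<longrightarrow>
    product_cone D I (P0 X P) (\<lambda>i. P1 X (p i)))"

text \<open>The component \<open>T1 \<theta> f\<close> goes from \<open>Y f \<star> \<theta>\<^sub>s\<close> to \<open>\<theta>\<^sub>t \<star> X f\<close>, for \<open>\<theta>\<close> from \<open>X\<close> to \<open>Y\<close>
  and \<open>f\<close> from \<open>s\<close> to \<open>t\<close>.\<close>

record ('o, 'f, 'a, 'p, 'g, 'b) pstrans =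
  TSrc :: "('o, 'f, 'a, 'p, 'g, 'b) psfun"
  TTgt :: "('o, 'f, 'a, 'p, 'g, 'b) psfun"
  T0 :: "'o \<Rightarrow> 'g"
  T1 :: "'f \<Rightarrow> 'b"

locale pseudonatural_transformation =
  X: strictly_unital_pseudofunctor A D "TSrc \<theta>" + Y: strictly_unital_pseudofunctor A D "TTgt \<theta>"
  for A :: "('o, 'f, 'a, 'z) bicat_scheme"
    and D :: "('p, 'g, 'b, 'y) twocat_scheme"
    and \<theta> :: "('o, 'f, 'a, 'p, 'g, 'b) pstrans" +
  assumes T0_in: "s \<in> Cell0 A \<Longrightarrow> T0 \<theta> s \<in> Hom1 D (P0 (TSrc \<theta>) s) (P0 (TTgt \<theta>) s)"
    and T1_iso: "f \<in> Hom1 A s t \<Longrightarrow>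
      T1 \<theta> f \<in> Iso2 D (P1 (TTgt \<theta>) f \<star>\<^bsub>D\<^esub> T0 \<theta> s) (T0 \<theta> t \<star>\<^bsub>D\<^esub> P1 (TSrc \<theta>) f)"
    and T1_natural: "f \<in> Hom1 A s t \<Longrightarrow> f' \<in> Hom1 A s t \<Longrightarrow> \<alpha> \<in> Hom2 A f f' \<Longrightarrow>
      T1 \<theta> f' \<bullet>\<^bsub>D\<^esub> (P2 (TTgt \<theta>) \<alpha> \<diamondop>\<^bsub>D\<^esub> Id2 D (T0 \<theta> s)) =
      (Id2 D (T0 \<theta> t) \<diamondop>\<^bsub>D\<^esub> P2 (TSrc \<theta>) \<alpha>) \<bullet>\<^bsub>D\<^esub> T1 \<theta> f"
    and T1_Id1: "s \<in> Cell0 A \<Longrightarrow> T1 \<theta> (Id1 A s) = Id2 D (T0 \<theta> s)"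
    and T1_Comp1: "f \<in> Hom1 A s t \<Longrightarrow> g \<in> Hom1 A t r \<Longrightarrow>
      T1 \<theta> (g \<star>\<^bsub>A\<^esub> f) \<bullet>\<^bsub>D\<^esub> (PC (TTgt \<theta>) (g, f) \<diamondop>\<^bsub>D\<^esub> Id2 D (T0 \<theta> s)) =
      (Id2 D (T0 \<theta> r) \<diamondop>\<^bsub>D\<^esub> PC (TSrc \<theta>) (g, f)) \<bullet>\<^bsub>D\<^esub>
        (T1 \<theta> g \<diamondop>\<^bsub>D\<^esub> Id2 D (P1 (TSrc \<theta>) f)) \<bullet>\<^bsub>D\<^esub> (Id2 D (P1 (TTgt \<theta>) g) \<diamondop>\<^bsub>D\<^esub> T1 \<theta> f)"
    and T0_ext: "T0 \<theta> \<in> extensional (Cell0 A)"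
    and T1_ext: "T1 \<theta> \<in> extensional (Cell1 A)"

locale strict_natural_transformation = pseudonatural_transformation +
  assumes T1_strict: "f \<in> Hom1 A s t \<Longrightarrow>
      P1 (TTgt \<theta>) f \<star>\<^bsub>D\<^esub> T0 \<theta> s = T0 \<theta> t \<star>\<^bsub>D\<^esub> P1 (TSrc \<theta>) f \<and>
      T1 \<theta> f = Id2 D (T0 \<theta> t \<star>\<^bsub>D\<^esub> P1 (TSrc \<theta>) f)"

definition id_pstrans ::
  "('o, 'f, 'a, 'z) bicat_scheme \<Rightarrow> ('p, 'g, 'b, 'y) twocat_scheme \<Rightarrow>
    ('o, 'f, 'a, 'p, 'g, 'b) psfun \<Rightarrow> ('o, 'f, 'a, 'p, 'g, 'b) pstrans" where
  "id_pstrans A D X = \<lparr>TSrc = X, TTgt = X,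
    T0 = (\<lambda>s \<in> Cell0 A. Id1 D (P0 X s)), T1 = (\<lambda>f \<in> Cell1 A. Id2 D (P1 X f))\<rparr>"

definition comp_pstrans ::
  "('o, 'f, 'a, 'z) bicat_scheme \<Rightarrow> ('p, 'g, 'b, 'y) twocat_scheme \<Rightarrow>
    ('o, 'f, 'a, 'p, 'g, 'b) pstrans \<Rightarrow> ('o, 'f, 'a, 'p, 'g, 'b) pstrans \<Rightarrow>
    ('o, 'f, 'a, 'p, 'g, 'b) pstrans" where
  "comp_pstrans A D \<phi> \<theta> = \<lparr>TSrc = TSrc \<theta>, TTgt = TTgt \<phi>,
    T0 = (\<lambda>s \<in> Cell0 A. T0 \<phi> s \<star>\<^bsub>D\<^esub> T0 \<theta> s),
    T1 = (\<lambda>f \<in> Cell1 A. (Id2 D (T0 \<phi> (Tgt1 A f)) \<diamondop>\<^bsub>D\<^esub> T1 \<theta> f) \<bullet>\<^bsub>D\<^esub>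
      (T1 \<phi> f \<diamondop>\<^bsub>D\<^esub> Id2 D (T0 \<theta> (Src1 A f))))\<rparr>"

definition Mack ::
  "('o, 'f, 'a, 'z) bicat_scheme \<Rightarrow> ('p, 'g, 'b, 'y) twocat_scheme \<Rightarrow>
    (('o, 'f, 'a, 'p, 'g, 'b) psfun, ('o, 'f, 'a, 'p, 'g, 'b) pstrans) cat" where
  "Mack A D = (let M = {X. strictly_unital_pseudofunctor A D X \<and> additive A D X} in \<lparr>
    Obj = M,
    Arr = {\<theta>. TSrc \<theta> \<in> M \<and> TTgt \<theta> \<in> M \<and> pseudonatural_transformation A D \<theta>},
    Dom = TSrc, Cod = TTgt, Idt = id_pstrans A D, Cmp = comp_pstrans A D\<rparr>)"

end

theory Submission
  imports Defs
begin


text \<open>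
  The obstacle is the strictness of \<open>\<epsilon>\<close>. In the usual strictification by words of objects, the evaluation
  of words is natural only up to isomorphism, because a strong monoidal functor \<open>F\<close> carries a sum of
  letters to an object that is merely isomorphic to the sum of their images. The strictification used
  here keeps the value of a word as part of the object. Apart from a new unit, its objects are pairs
  \<open>(c, k)\<close> of an object \<open>c\<close> of the given category \<open>C\<close> and an arbitrary label \<open>k\<close>, with value \<open>c\<close>, and \<open>F\<close>
  sends \<open>(c, k)\<close> to \<open>(F c, k)\<close>. A label is a nonempty list. If it consists of objects of \<open>C\<close> whose
  right-nested sum is \<open>c\<close>, then the pair stands for this word, and otherwise for the one-letter word \<open>c\<close>.
  Sums concatenate words, so they are strictly associative, and iterated associators compare the value
  of a sum with the sum of the values (\<open>collect\<close>). These comparisons are coherent by the pentagon and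
  by the unit coherence of Kelly (\<open>collect_assoc\<close>), so the symmetric monoidal structure of \<open>C\<close> can be
  transported along them (\<open>permutative_strictify\<close>).

  Arrows of the strictification are arrows of \<open>C\<close> between values. Therefore a strong monoidal functor
  into it is the same as one into \<open>C\<close> together with a unital lift of its object map (\<open>smf_lift\<close>,
  \<open>lift_unique\<close>), even a lift that ignores sums of words, and monoidal transformations lift uniquely
  (\<open>lift_smn\<close>). Applied to \<open>F\<close> after evaluation, this makes strictification a strict 2-functor
  \<open>Q\<close> for which the evaluation \<open>ev\<close> is strictly 2-natural; applied to the identity, it gives a section
  \<open>sec\<close> of \<open>ev\<close>.

  The rest is formal in any strict (2,1)-category (\<open>mackey_strictification\<close>). The functor \<open>\<ell>\<close> composes
  with \<open>Q\<close>, and the transformations whose components are \<open>ev\<close> and identity 2-cells serve as both \<open>\<mu>\<close>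
  and \<open>\<epsilon>\<close>. Additivity is preserved because \<open>Q\<close> sends product cones to product cones
  (\<open>product_cone_Q\<close>), and because a product cone among permutative categories is one among all
  symmetric monoidal categories: a test category \<open>W\<close> may be replaced by \<open>Q W\<close>
  (\<open>product_cone_from_P\<close>).
\<close>

section \<open>Calculation in categories\<close>

text \<open>
  Composability is checked by computing domains and codomains, so the rules below are stated with
  \<open>Dom\<close> and \<open>Cod\<close> instead of \<open>Hom\<close>; composites are normalised to be nested to the right.
\<close>

definition inv_arr :: "('o, 'a, 'z) cat_scheme \<Rightarrow> 'a \<Rightarrow> 'a" where
  "inv_arr C f = (THE g. g \<in> Hom C (Cod C f) (Dom C f) \<and>
     g \<cdot>\<^bsub>C\<^esub> f = Idt C (Dom C f) \<and> f \<cdot>\<^bsub>C\<^esub> g = Idt C (Cod C f))"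

definition invertible :: "('o, 'a, 'z) cat_scheme \<Rightarrow> 'a \<Rightarrow> bool" where
  "invertible C f \<longleftrightarrow> f \<in> Iso C (Dom C f) (Cod C f)"

lemma Hom_iff: "f \<in> Hom C x y \<longleftrightarrow> f \<in> Arr C \<and> Dom C f = x \<and> Cod C f = y"
  by (simp add: Hom_def)

lemma Iso_iff: "f \<in> Iso C x y \<longleftrightarrow> f \<in> Arr C \<and> Dom C f = x \<and> Cod C f = y \<and> invertible C f"
  by (auto simp: invertible_def Iso_def Hom_def)

context category
begin

lemmas [simp] = Dom_in Cod_in Idt_in[unfolded Hom_iff]

lemma Cmp_arrow [simp]: "f \<in> Arr C \<Longrightarrow> g \<in> Arr C \<Longrightarrow> Dom C g = Cod C f \<Longrightarrow>
    g \<cdot> f \<in> Arr C \<and> Dom C (g \<cdot> f) = Dom C f \<and> Cod C (g \<cdot> f) = Cod C g"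
  using Cmp_in by (auto simp: Hom_iff)

lemma Cmp_Idt_left [simp]: "f \<in> Arr C \<Longrightarrow> Cod C f = y \<Longrightarrow> Idt C y \<cdot> f = f"
  using Idt_left by (auto simp: Hom_iff)

lemma Cmp_Idt_right [simp]: "f \<in> Arr C \<Longrightarrow> Dom C f = x \<Longrightarrow> f \<cdot> Idt C x = f"
  using Idt_right by (auto simp: Hom_iff)

lemma Cmp_reassoc [simp]:
  "f \<in> Arr C \<Longrightarrow> g \<in> Arr C \<Longrightarrow> h \<in> Arr C \<Longrightarrow> Dom C g = Cod C f \<Longrightarrow> Dom C h = Cod C g \<Longrightarrow>
    (h \<cdot> g) \<cdot> f = h \<cdot> (g \<cdot> f)"
  using Cmp_assoc by (auto simp: Hom_iff)

lemma inverse_unique: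
  assumes "f \<in> Arr C" "g \<in> Arr C" "h \<in> Arr C" "Dom C f = Cod C g" "Dom C h = Cod C f"
    and "f \<cdot> g = Idt C (Cod C f)" "h \<cdot> f = Idt C (Dom C f)"
  shows "g = h"
proof -
  have "h = h \<cdot> (f \<cdot> g)" using assms(1-3,5,6) by simp
  also have "\<dots> = (h \<cdot> f) \<cdot> g" using assms(1-5) by simp
  also have "\<dots> = g" using assms(2,4,7) by simp
  finally show ?thesis ..
qed

lemma invertible_inverse:
  assumes "f \<in> Arr C" "invertible C f"
  shows "inv_arr C f \<in> Hom C (Cod C f) (Dom C f) \<and>
     inv_arr C f \<cdot> f = Idt C (Dom C f) \<and> f \<cdot> inv_arr C f = Idt C (Cod C f)"
  unfolding inv_arr_def
proof (rule theI')
  let ?P = "\<lambda>g. g \<in> Hom C (Cod C f) (Dom C f) \<and>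
     g \<cdot> f = Idt C (Dom C f) \<and> f \<cdot> g = Idt C (Cod C f)"
  obtain g where g: "?P g" using assms by (auto simp: invertible_def Iso_def)
  then show "\<exists>!g. ?P g"
  proof (rule ex1I)
    fix h assume h: "?P h"
    show "h = g"
      using g h assms(1) by (simp add: Hom_iff inverse_unique[of f])
  qed
qed

lemma inv_arrow [simp]: "f \<in> Arr C \<Longrightarrow> invertible C f \<Longrightarrow>
    inv_arr C f \<in> Arr C \<and> Dom C (inv_arr C f) = Cod C f \<and> Cod C (inv_arr C f) = Dom C f"
  and inv_Cmp [simp]: "f \<in> Arr C \<Longrightarrow> invertible C f \<Longrightarrow> inv_arr C f \<cdot> f = Idt C (Dom C f)"
  and Cmp_inv [simp]: "f \<in> Arr C \<Longrightarrow> invertible C f \<Longrightarrow> f \<cdot> inv_arr C f = Idt C (Cod C f)"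
  using invertible_inverse[of f] unfolding Hom_iff by blast+

lemma invertibleI:
  assumes "f \<in> Arr C" "g \<in> Arr C" "Dom C g = Cod C f" "Cod C g = Dom C f"
    and "g \<cdot> f = Idt C (Dom C f)" "f \<cdot> g = Idt C (Cod C f)"
  shows "invertible C f"
  using assms by (auto simp: invertible_def Iso_def Hom_iff)

lemma inv_eqI:
  assumes "f \<in> Arr C" "g \<in> Arr C" "Dom C g = Cod C f" "Cod C g = Dom C f"
    and "g \<cdot> f = Idt C (Dom C f)" "f \<cdot> g = Idt C (Cod C f)"
  shows "inv_arr C f = g"
proof -
  have "invertible C f" using assms by (rule invertibleI)
  then show ?thesis using assms by (simp add: inverse_unique[of f])
qed

lemma invertible_Idt [simp]: "x \<in> Obj C \<Longrightarrow> invertible C (Idt C x)"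
  by (rule invertibleI[of _ "Idt C x"]) auto

lemma inv_Idt [simp]: "x \<in> Obj C \<Longrightarrow> inv_arr C (Idt C x) = Idt C x"
  by (rule inv_eqI) auto

lemma invertible_inv [simp]: "f \<in> Arr C \<Longrightarrow> invertible C f \<Longrightarrow> invertible C (inv_arr C f)"
  by (rule invertibleI[of _ f]) auto

lemma inv_cancel [simp]:
  assumes "f \<in> Arr C" "invertible C f" "h \<in> Arr C" "Cod C h = Dom C f"
  shows "inv_arr C f \<cdot> f \<cdot> h = h"
  using assms Cmp_reassoc[of h f "inv_arr C f"] by simp

lemma inv_cancel' [simp]:
  assumes "f \<in> Arr C" "invertible C f" "h \<in> Arr C" "Cod C h = Cod C f"
  shows "f \<cdot> inv_arr C f \<cdot> h = h"
  using assms Cmp_reassoc[of h "inv_arr C f" f] by simp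

lemma invertible_Cmp [simp]:
  assumes "f \<in> Arr C" "invertible C f" "g \<in> Arr C" "invertible C g" "Dom C g = Cod C f"
  shows "invertible C (g \<cdot> f)"
  using assms by (intro invertibleI[of _ "inv_arr C f \<cdot> inv_arr C g"]) auto

lemma cancel_left:
  assumes "e \<cdot> f = e \<cdot> g" "e \<in> Arr C" "invertible C e" "f \<in> Arr C" "g \<in> Arr C"
    "Cod C f = Dom C e" "Cod C g = Dom C e"
  shows "f = g"
proof -
  have "inv_arr C e \<cdot> e \<cdot> f = inv_arr C e \<cdot> e \<cdot> g" using assms(1) by simp
  then show ?thesis using assms(2-) by simp
qed

lemma cancel_right:
  assumes "f \<cdot> e = g \<cdot> e" "e \<in> Arr C" "invertible C e" "f \<in> Arr C" "g \<in> Arr C"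
    "Dom C f = Cod C e" "Dom C g = Cod C e"
  shows "f = g"
proof -
  have "(f \<cdot> e) \<cdot> inv_arr C e = (g \<cdot> e) \<cdot> inv_arr C e" using assms(1) by simp
  then show ?thesis using assms(2-) by simp
qed

end

lemma categoryI:
  fixes C (structure)
  assumes "\<And>f. f \<in> Arr C \<Longrightarrow> Dom C f \<in> Obj C \<and> Cod C f \<in> Obj C"
    and "\<And>x. x \<in> Obj C \<Longrightarrow> Idt C x \<in> Arr C \<and> Dom C (Idt C x) = x \<and> Cod C (Idt C x) = x"
    and "\<And>f g. f \<in> Arr C \<Longrightarrow> g \<in> Arr C \<Longrightarrow> Dom C g = Cod C f \<Longrightarrow>
      g \<cdot> f \<in> Arr C \<and> Dom C (g \<cdot> f) = Dom C f \<and> Cod C (g \<cdot> f) = Cod C g"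
    and "\<And>f. f \<in> Arr C \<Longrightarrow> Idt C (Cod C f) \<cdot> f = f \<and> f \<cdot> Idt C (Dom C f) = f"
    and "\<And>f g h. f \<in> Arr C \<Longrightarrow> g \<in> Arr C \<Longrightarrow> h \<in> Arr C \<Longrightarrow> Dom C g = Cod C f \<Longrightarrow>
      Dom C h = Cod C g \<Longrightarrow> (h \<cdot> g) \<cdot> f = h \<cdot> (g \<cdot> f)"
  shows "category C"
  by unfold_locales (use assms in \<open>auto simp: Hom_iff\<close>)

context cat_functor
begin

lemmas [simp] = OMap_in AMap_Idt

lemma AMap_arrow [simp]: "f \<in> Arr C \<Longrightarrow>
    AMap F f \<in> Arr D \<and> Dom D (AMap F f) = OMap F (Dom C f) \<and> Cod D (AMap F f) = OMap F (Cod C f)"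
  using AMap_in by (auto simp: Hom_iff)

lemma map_Cmp [simp]: "f \<in> Arr C \<Longrightarrow> g \<in> Arr C \<Longrightarrow> Dom C g = Cod C f \<Longrightarrow>
    AMap F (g \<cdot>\<^bsub>C\<^esub> f) = AMap F g \<cdot>\<^bsub>D\<^esub> AMap F f"
  using AMap_Cmp by (auto simp: Hom_iff)

lemma map_invertible [simp]: "f \<in> Arr C \<Longrightarrow> invertible C f \<Longrightarrow> invertible D (AMap F f)"
  by (rule D.invertibleI[of _ "AMap F (inv_arr C f)"]) (auto simp flip: map_Cmp)

end

lemma cat_functor_identity: "category C \<Longrightarrow> cat_functor C C identity_functor"
  by (simp add: cat_functor_def cat_functor_axioms_def identity_functor_def)

lemma cat_functor_comp:
  assumes "cat_functor C D F" "cat_functor D E H"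
  shows "cat_functor C E (comp_functor H F)"
proof -
  interpret F: cat_functor C D F by fact
  interpret H: cat_functor D E H by fact
  show ?thesis
    by unfold_locales (auto simp: comp_functor_def Hom_iff)
qed

lemma natural_transformationI:
  assumes F: "cat_functor C D F" and G: "cat_functor C D G"
    and "\<And>x. x \<in> Obj C \<Longrightarrow> \<eta> x \<in> Hom D (OMap F x) (OMap G x)"
    and "\<And>f. f \<in> Arr C \<Longrightarrow> AMap G f \<cdot>\<^bsub>D\<^esub> \<eta> (Dom C f) = \<eta> (Cod C f) \<cdot>\<^bsub>D\<^esub> AMap F f"
  shows "natural_transformation C D F G \<eta>"
  using assms by (auto simp: natural_transformation_def natural_transformation_axioms_def Hom_iff)

section \<open>Calculation in symmetric monoidal categories\<close>

context symmetric_monoidal_category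
begin

lemmas [simp] = Sum_in Unt_in SumA_Idt Asc_iso[unfolded Iso_iff] Lun_iso[unfolded Iso_iff]
  Run_iso[unfolded Iso_iff] Brd_iso[unfolded Iso_iff]

lemma SumA_arrow [simp]: "f \<in> Arr C \<Longrightarrow> g \<in> Arr C \<Longrightarrow>
    f \<boxtimes> g \<in> Arr C \<and> Dom C (f \<boxtimes> g) = Dom C f \<boxplus> Dom C g \<and> Cod C (f \<boxtimes> g) = Cod C f \<boxplus> Cod C g"
  using SumA_in by (auto simp: Hom_iff)

lemma interchange:
  "f \<in> Arr C \<Longrightarrow> f' \<in> Arr C \<Longrightarrow> g \<in> Arr C \<Longrightarrow> g' \<in> Arr C \<Longrightarrow> Dom C f' = Cod C f \<Longrightarrow> Dom C g' = Cod C g \<Longrightarrow>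
    (f' \<boxtimes> g') \<cdot> (f \<boxtimes> g) = (f' \<cdot> f) \<boxtimes> (g' \<cdot> g)"
  using SumA_Cmp by (auto simp: Hom_iff)

lemma interchange_left:
  "f \<in> Arr C \<Longrightarrow> f' \<in> Arr C \<Longrightarrow> g \<in> Arr C \<Longrightarrow> g' \<in> Arr C \<Longrightarrow> Dom C f' = Cod C f \<Longrightarrow> Dom C g' = Cod C g \<Longrightarrow>
    h \<in> Arr C \<Longrightarrow> Cod C h = Dom C f \<boxplus> Dom C g \<Longrightarrow>
    (f' \<boxtimes> g') \<cdot> (f \<boxtimes> g) \<cdot> h = ((f' \<cdot> f) \<boxtimes> (g' \<cdot> g)) \<cdot> h"
  using interchange[of f f' g g'] Cmp_reassoc[of h "f \<boxtimes> g" "f' \<boxtimes> g'"] by simp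

lemma invertible_SumA [simp]:
  "f \<in> Arr C \<Longrightarrow> g \<in> Arr C \<Longrightarrow> invertible C f \<Longrightarrow> invertible C g \<Longrightarrow> invertible C (f \<boxtimes> g)"
  by (rule invertibleI[of _ "inv_arr C f \<boxtimes> inv_arr C g"]) (auto simp: interchange)

lemma inv_SumA:
  "f \<in> Arr C \<Longrightarrow> g \<in> Arr C \<Longrightarrow> invertible C f \<Longrightarrow> invertible C g \<Longrightarrow>
    inv_arr C (f \<boxtimes> g) = inv_arr C f \<boxtimes> inv_arr C g"
  by (rule inv_eqI) (auto simp: interchange)

lemma Asc_nat: "f \<in> Arr C \<Longrightarrow> g \<in> Arr C \<Longrightarrow> h \<in> Arr C \<Longrightarrow>
    Asc C (Cod C f) (Cod C g) (Cod C h) \<cdot> ((f \<boxtimes> g) \<boxtimes> h) =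
    (f \<boxtimes> (g \<boxtimes> h)) \<cdot> Asc C (Dom C f) (Dom C g) (Dom C h)"
  using Asc_natural by (auto simp: Hom_iff)

lemma Lun_nat: "f \<in> Arr C \<Longrightarrow> Lun C (Cod C f) \<cdot> (Idt C (Unt C) \<boxtimes> f) = f \<cdot> Lun C (Dom C f)"
  and Run_nat: "f \<in> Arr C \<Longrightarrow> Run C (Cod C f) \<cdot> (f \<boxtimes> Idt C (Unt C)) = f \<cdot> Run C (Dom C f)"
  using Lun_natural Run_natural by (auto simp: Hom_iff)

lemma Lun_conj: "f \<in> Arr C \<Longrightarrow> Lun C (Cod C f) \<cdot> (Idt C (Unt C) \<boxtimes> f) \<cdot> inv_arr C (Lun C (Dom C f)) = f"
  and Run_conj: "f \<in> Arr C \<Longrightarrow> Run C (Cod C f) \<cdot> (f \<boxtimes> Idt C (Unt C)) \<cdot> inv_arr C (Run C (Dom C f)) = f"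
  using Lun_nat[of f] Run_nat[of f]
    Cmp_reassoc[of "inv_arr C (Lun C (Dom C f))" "Idt C (Unt C) \<boxtimes> f" "Lun C (Cod C f)"]
    Cmp_reassoc[of "inv_arr C (Run C (Dom C f))" "f \<boxtimes> Idt C (Unt C)" "Run C (Cod C f)"]
  by simp_all

lemma Brd_nat: "f \<in> Arr C \<Longrightarrow> g \<in> Arr C \<Longrightarrow>
    Brd C (Cod C f) (Cod C g) \<cdot> (f \<boxtimes> g) = (g \<boxtimes> f) \<cdot> Brd C (Dom C f) (Dom C g)"
  using Brd_natural by (auto simp: Hom_iff)

lemma Brd_nat_Cmp: "f \<in> Arr C \<Longrightarrow> g \<in> Arr C \<Longrightarrow> h \<in> Arr C \<Longrightarrow> Cod C h = Dom C f \<boxplus> Dom C g \<Longrightarrow>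
    Brd C (Cod C f) (Cod C g) \<cdot> (f \<boxtimes> g) \<cdot> h = (g \<boxtimes> f) \<cdot> Brd C (Dom C f) (Dom C g) \<cdot> h"
  using Brd_nat[of f g] Cmp_reassoc[of h "f \<boxtimes> g" "Brd C (Cod C f) (Cod C g)"] by simp

lemma symmetry_Cmp: "x \<in> Obj C \<Longrightarrow> y \<in> Obj C \<Longrightarrow> h \<in> Arr C \<Longrightarrow> Cod C h = x \<boxplus> y \<Longrightarrow>
    Brd C y x \<cdot> Brd C x y \<cdot> h = h"
  using symmetry[of x y] Cmp_reassoc[of h "Brd C x y" "Brd C y x"] by simp

text \<open>
  Naturality of the unitor exhibits \<open>f\<close> as a conjugate of its sum with the identity of the unit.
\<close>

lemma Unt_SumA_faithful:
  assumes "Idt C (Unt C) \<boxtimes> f = Idt C (Unt C) \<boxtimes> g" "f \<in> Arr C" "g \<in> Arr C"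
    "Dom C f = Dom C g" "Cod C f = Cod C g"
  shows "f = g"
proof -
  have "f \<cdot> Lun C (Dom C f) = g \<cdot> Lun C (Dom C f)"
    using Lun_nat[of f] Lun_nat[of g] assms by simp
  then show ?thesis using assms by (elim cancel_right) auto
qed

lemma SumA_Unt_faithful:
  assumes "f \<boxtimes> Idt C (Unt C) = g \<boxtimes> Idt C (Unt C)" "f \<in> Arr C" "g \<in> Arr C"
    "Dom C f = Dom C g" "Cod C f = Cod C g"
  shows "f = g"
proof -
  have "f \<cdot> Run C (Dom C f) = g \<cdot> Run C (Dom C f)"
    using Run_nat[of f] Run_nat[of g] assms by simp
  then show ?thesis using assms by (elim cancel_right) auto
qed

text \<open>
  Kelly's argument. Adding the unit on the left is faithful, so the equation may be checked there.
  After precomposition with the isomorphism \<open>?E\<close>, the pentagon at \<open>I, I, x, y\<close> and the triangles at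
  \<open>I, x\<close> and \<open>I, x \<boxplus> y\<close> give the same arrow on both sides.
\<close>

lemma Lun_Sum:
  assumes x: "x \<in> Obj C" and y: "y \<in> Obj C"
  shows "Lun C (x \<boxplus> y) \<cdot> Asc C (Unt C) x y = Lun C x \<boxtimes> Idt C y"
proof (rule Unt_SumA_faithful)
  let ?I = "Unt C"
  let ?E = "Asc C ?I (?I \<boxplus> x) y \<cdot> (Asc C ?I ?I x \<boxtimes> Idt C y)"
  have "(Idt C ?I \<boxtimes> (Lun C (x \<boxplus> y) \<cdot> Asc C ?I x y)) \<cdot> ?E =
    (Idt C ?I \<boxtimes> Lun C (x \<boxplus> y)) \<cdot> (Idt C ?I \<boxtimes> Asc C ?I x y) \<cdot> ?E"
    using x y by (subst interchange_left) auto
  also have "\<dots> = (Idt C ?I \<boxtimes> Lun C (x \<boxplus> y)) \<cdot> Asc C ?I ?I (x \<boxplus> y) \<cdot> Asc C (?I \<boxplus> ?I) x y"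
    using x y pentagon[of ?I ?I x y] by simp
  also have "\<dots> = ((Idt C ?I \<boxtimes> Lun C (x \<boxplus> y)) \<cdot> Asc C ?I ?I (x \<boxplus> y)) \<cdot> Asc C (?I \<boxplus> ?I) x y"
    using x y by simp
  also have "\<dots> = (Run C ?I \<boxtimes> Idt C (x \<boxplus> y)) \<cdot> Asc C (?I \<boxplus> ?I) x y"
    using x y triangle[of ?I "x \<boxplus> y"] by simp
  also have "\<dots> = Asc C ?I x y \<cdot> ((Run C ?I \<boxtimes> Idt C x) \<boxtimes> Idt C y)"
    using x y Asc_nat[of "Run C ?I" "Idt C x" "Idt C y"] by simp
  also have "\<dots> = Asc C ?I x y \<cdot> (((Idt C ?I \<boxtimes> Lun C x) \<cdot> Asc C ?I ?I x) \<boxtimes> (Idt C y \<cdot> Idt C y))"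
    using x y triangle[of ?I x] by simp
  also have "\<dots> = Asc C ?I x y \<cdot> ((Idt C ?I \<boxtimes> Lun C x) \<boxtimes> Idt C y) \<cdot> (Asc C ?I ?I x \<boxtimes> Idt C y)"
    using x y by (subst interchange) auto
  also have "\<dots> = (Asc C ?I x y \<cdot> ((Idt C ?I \<boxtimes> Lun C x) \<boxtimes> Idt C y)) \<cdot> (Asc C ?I ?I x \<boxtimes> Idt C y)"
    using x y by simp
  also have "\<dots> = (Idt C ?I \<boxtimes> (Lun C x \<boxtimes> Idt C y)) \<cdot> ?E"
    using x y Asc_nat[of "Idt C ?I" "Lun C x" "Idt C y"] by simp
  finally show "Idt C ?I \<boxtimes> (Lun C (x \<boxplus> y) \<cdot> Asc C ?I x y) = Idt C ?I \<boxtimes> (Lun C x \<boxtimes> Idt C y)"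
    using x y by (elim cancel_right) auto
qed (use x y in auto)

text \<open>
  The mirror image of the previous argument: add the unit on the right and use the pentagon at
  \<open>x, y, I, I\<close> with the triangles at \<open>y, I\<close> and \<open>x \<boxplus> y, I\<close>.
\<close>

lemma Run_Sum:
  assumes x: "x \<in> Obj C" and y: "y \<in> Obj C"
  shows "(Idt C x \<boxtimes> Run C y) \<cdot> Asc C x y (Unt C) = Run C (x \<boxplus> y)"
proof (rule SumA_Unt_faithful)
  let ?I = "Unt C"
  have "Asc C x y ?I \<cdot> (((Idt C x \<boxtimes> Run C y) \<cdot> Asc C x y ?I) \<boxtimes> (Idt C ?I \<cdot> Idt C ?I)) =
    (Asc C x y ?I \<cdot> ((Idt C x \<boxtimes> Run C y) \<boxtimes> Idt C ?I)) \<cdot> (Asc C x y ?I \<boxtimes> Idt C ?I)"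
    using x y by (subst interchange[symmetric]) auto
  also have "\<dots> = (Idt C x \<boxtimes> (Run C y \<boxtimes> Idt C ?I)) \<cdot> Asc C x (y \<boxplus> ?I) ?I \<cdot> (Asc C x y ?I \<boxtimes> Idt C ?I)"
    using x y Asc_nat[of "Idt C x" "Run C y" "Idt C ?I"] by simp
  also have "\<dots> = ((Idt C x \<cdot> Idt C x) \<boxtimes> ((Idt C y \<boxtimes> Lun C ?I) \<cdot> Asc C y ?I ?I)) \<cdot>
      Asc C x (y \<boxplus> ?I) ?I \<cdot> (Asc C x y ?I \<boxtimes> Idt C ?I)"
    using x y triangle[of y ?I] by simp
  also have "\<dots> = (Idt C x \<boxtimes> (Idt C y \<boxtimes> Lun C ?I)) \<cdot> (Idt C x \<boxtimes> Asc C y ?I ?I) \<cdot>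
      Asc C x (y \<boxplus> ?I) ?I \<cdot> (Asc C x y ?I \<boxtimes> Idt C ?I)"
    using x y by (subst interchange_left) auto
  also have "\<dots> = (Idt C x \<boxtimes> (Idt C y \<boxtimes> Lun C ?I)) \<cdot> Asc C x y (?I \<boxplus> ?I) \<cdot> Asc C (x \<boxplus> y) ?I ?I"
    using x y pentagon[of x y ?I ?I] by simp
  also have "\<dots> = ((Idt C x \<boxtimes> (Idt C y \<boxtimes> Lun C ?I)) \<cdot> Asc C x y (?I \<boxplus> ?I)) \<cdot> Asc C (x \<boxplus> y) ?I ?I"
    using x y by simp
  also have "\<dots> = (Asc C x y ?I \<cdot> (Idt C (x \<boxplus> y) \<boxtimes> Lun C ?I)) \<cdot> Asc C (x \<boxplus> y) ?I ?I"
    using x y Asc_nat[of "Idt C x" "Idt C y" "Lun C ?I"] by simp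
  also have "\<dots> = Asc C x y ?I \<cdot> (Run C (x \<boxplus> y) \<boxtimes> Idt C ?I)"
    using x y triangle[of "x \<boxplus> y" ?I] by simp
  finally have "Asc C x y ?I \<cdot> (((Idt C x \<boxtimes> Run C y) \<cdot> Asc C x y ?I) \<boxtimes> Idt C ?I) =
      Asc C x y ?I \<cdot> (Run C (x \<boxplus> y) \<boxtimes> Idt C ?I)"
    by simp
  then show "((Idt C x \<boxtimes> Run C y) \<cdot> Asc C x y ?I) \<boxtimes> Idt C ?I = Run C (x \<boxplus> y) \<boxtimes> Idt C ?I"
    using x y by (elim cancel_left) auto
qed (use x y in auto)

text \<open>
  Cancelling \<open>Lun I\<close> from its own naturality square shows that \<open>Lun (I \<boxplus> I)\<close> is \<open>Idt I \<boxtimes> Lun I\<close>, so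
  the coherence just proved and the triangle at \<open>I, I\<close> have equal left-hand sides.
\<close>

lemma Lun_Unt: "Lun C (Unt C) = Run C (Unt C)"
proof (rule SumA_Unt_faithful)
  let ?I = "Unt C"
  have "Lun C ?I \<cdot> Lun C (?I \<boxplus> ?I) = Lun C ?I \<cdot> (Idt C ?I \<boxtimes> Lun C ?I)"
    using Lun_nat[of "Lun C ?I"] by simp
  then have "Lun C (?I \<boxplus> ?I) = Idt C ?I \<boxtimes> Lun C ?I"
    by (elim cancel_left) auto
  then show "Lun C ?I \<boxtimes> Idt C ?I = Run C ?I \<boxtimes> Idt C ?I"
    using Lun_Sum[of ?I ?I] triangle[of ?I ?I] by simp
qed auto

end



section \<open>Encodings in an infinite type\<close>

text \<open>
  \<open>VObj c xs x\<close> is the object \<open>c\<close> with the list \<open>xs\<close> followed by \<open>x\<close> as its label; the last letter is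
  kept apart because labels are nonempty. Adding labels does not leave the universe, as an infinite
  type contains codes for all these data.
\<close>

datatype 'u vobj = VUnit | VObj 'u "'u list" 'u

lemma inj_pair: "\<exists>f :: 'u \<times> 'u \<Rightarrow> 'u::infinite. inj f"
  using card_of_Times_same_infinite[OF infinite_UNIV[where 'a='u]]
  unfolding card_of_ordIso[symmetric] bij_betw_def UNIV_Times_UNIV by blast

lemma inj_list: "\<exists>f :: 'u list \<Rightarrow> 'u::infinite. inj f"
proof -
  obtain p :: "'u \<times> 'u \<Rightarrow> 'u" where p: "inj p" using inj_pair by blast
  obtain n :: "nat \<Rightarrow> 'u" where n: "inj n"
    using infinite_countable_subset[OF infinite_UNIV[where 'a='u]] by blast
  define g where "g xs = foldr (\<lambda>x y. p (x, y)) xs (n 0)" for xs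
  have "xs = ys" if "length xs = length ys" "g xs = g ys" for xs ys
    using that by (induction xs ys rule: list_induct2) (auto simp: g_def dest: injD[OF p])
  \<comment> \<open>The fold alone does not determine where a list ends, so its length is stored with it.\<close>
  then have "inj (\<lambda>xs. p (n (length xs), g xs))"
    by (auto intro!: injI dest!: injD[OF p] injD[OF n])
  then show ?thesis by blast
qed

lemma inj_triple: "\<exists>f :: 'u \<times> 'u \<times> 'u \<Rightarrow> 'u::infinite. inj f"
proof -
  obtain p :: "'u \<times> 'u \<Rightarrow> 'u" where p: "inj p" using inj_pair by blast
  have "inj (\<lambda>(x, y, z). p (x, p (y, z)))" by (auto intro!: injI dest!: injD[OF p])
  then show ?thesis by blast
qed

lemma inj_vobj: "\<exists>f :: 'u vobj \<Rightarrow> 'u::infinite. inj f"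
proof -
  obtain p :: "'u \<times> 'u \<times> 'u \<Rightarrow> 'u" where p: "inj p" using inj_triple by blast
  obtain l :: "'u list \<Rightarrow> 'u" where l: "inj l" using inj_list by blast
  define c where "c v = (case v of VUnit \<Rightarrow> [] | VObj c xs x \<Rightarrow> [p (c, l xs, x)])" for v :: "'u vobj"
  have "inj (\<lambda>v. l (c v))"
    by (rule injI) (auto simp: c_def dest!: injD[OF p] injD[OF l] split: vobj.splits)
  then show ?thesis by blast
qed

definition code :: "'u vobj \<Rightarrow> 'u::infinite" where
  "code = (SOME f. inj f)"

definition decode :: "'u::infinite \<Rightarrow> 'u vobj" where
  "decode = inv_into UNIV code"

definition triple :: "'u \<times> 'u \<times> 'u \<Rightarrow> 'u::infinite" where
  "triple = (SOME f. inj f)"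

text \<open>
  An arrow carries its ends, since one arrow of \<open>C\<close> gives arrows between all pairs of objects with the right values.
\<close>

definition arr :: "'u \<Rightarrow> 'u \<Rightarrow> 'u \<Rightarrow> 'u::infinite" where
  "arr a f b = triple (a, f, b)"

definition asrc :: "'u::infinite \<Rightarrow> 'u" where "asrc t = fst (inv_into UNIV triple t)"
definition amap :: "'u::infinite \<Rightarrow> 'u" where "amap t = fst (snd (inv_into UNIV triple t))"
definition atgt :: "'u::infinite \<Rightarrow> 'u" where "atgt t = snd (snd (inv_into UNIV triple t))"

lemma decode_code [simp]: "decode (code v) = v"
  unfolding decode_def code_def by (rule inv_f_f[OF someI_ex[OF inj_vobj]])

lemma code_eq_iff [simp]: "code v = code w \<longleftrightarrow> v = w"
  by (metis decode_code)

lemma inv_triple [simp]: "inv_into UNIV triple (triple t) = t"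
  unfolding triple_def by (rule inv_f_f[OF someI_ex[OF inj_triple]])

lemma arr_sel [simp]: "asrc (arr a f b) = a" "amap (arr a f b) = f" "atgt (arr a f b) = b"
  by (simp_all add: arr_def asrc_def amap_def atgt_def)

lemma arr_eq_iff [simp]: "arr a f b = arr a' f' b' \<longleftrightarrow> a = a' \<and> f = f' \<and> b = b'"
  by (metis arr_sel)


section \<open>The strictification of a symmetric monoidal category\<close>

definition vunit :: "'u::infinite" where "vunit = code VUnit"

definition vobjs :: "('u::infinite, 'u) smc \<Rightarrow> 'u set" where
  "vobjs C = insert vunit {code (VObj c xs x) | c xs x. c \<in> Obj C}"

definition val :: "('u::infinite, 'u) smc \<Rightarrow> 'u \<Rightarrow> 'u" where
  "val C a = (case decode a of VUnit \<Rightarrow> Unt C | VObj c xs x \<Rightarrow> c)"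

abbreviation sum_word :: "('u, 'u) smc \<Rightarrow> 'u list \<Rightarrow> 'u \<Rightarrow> 'u" where
  "sum_word C xs x \<equiv> foldr (Sum C) xs x"

text \<open>
  The word for which an object stands. After the action of a functor a label is no longer valid in
  general, and the object falls back to a one-letter word. The value for the unit is a dummy.
\<close>

definition spelling :: "('u::infinite, 'u) smc \<Rightarrow> 'u \<Rightarrow> 'u list \<times> 'u" where
  "spelling C a = (case decode a of VUnit \<Rightarrow> ([], Unt C) | VObj c xs x \<Rightarrow>
     if set xs \<subseteq> Obj C \<and> x \<in> Obj C \<and> sum_word C xs x = c then (xs, x) else ([], c))"

definition vword :: "('u::infinite, 'u) smc \<Rightarrow> 'u list \<Rightarrow> 'u \<Rightarrow> 'u" where
  "vword C xs x = code (VObj (sum_word C xs x) xs x)"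

text \<open>
  The unit is singled out so that it is strict. Even if it were given the empty word, concatenation
  would replace the label of the other summand by its spelling.
\<close>

definition vsum :: "('u::infinite, 'u) smc \<Rightarrow> 'u \<Rightarrow> 'u \<Rightarrow> 'u" where
  "vsum C a b = (if a = vunit then b else if b = vunit then a else
     vword C (fst (spelling C a) @ snd (spelling C a) # fst (spelling C b)) (snd (spelling C b)))"

text \<open>
  The composite of associators from \<open>sum_word C xs x \<boxplus> d\<close> to \<open>sum_word C xs (x \<boxplus> d)\<close>.
\<close>

fun regroup :: "('u, 'u) smc \<Rightarrow> 'u list \<Rightarrow> 'u \<Rightarrow> 'u \<Rightarrow> 'u" where
  "regroup C [] x d = Idt C (x \<boxplus>\<^bsub>C\<^esub> d)"
| "regroup C (a # xs) x d = (Idt C a \<boxtimes>\<^bsub>C\<^esub> regroup C xs x d) \<cdot>\<^bsub>C\<^esub> Asc C a (sum_word C xs x) d"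

text \<open>
  The comparison from \<open>val C a \<boxplus> val C b\<close> to \<open>val C (vsum C a b)\<close>: the value of the first spelling
  absorbs the value of the second as its innermost summand.
\<close>

definition collect :: "('u::infinite, 'u) smc \<Rightarrow> 'u \<Rightarrow> 'u \<Rightarrow> 'u" where
  "collect C a b = (if a = vunit then Lun C (val C b) else if b = vunit then Run C (val C a) else
     regroup C (fst (spelling C a)) (snd (spelling C a)) (val C b))"

text \<open>
  The structure of \<open>C\<close> transported along \<open>collect\<close>: sums of arrows and the symmetry are conjugated with
  the comparisons, and the transported associator and unitors are identities by coherence.
\<close>

definition strictify :: "('u::infinite, 'u) smc \<Rightarrow> ('u, 'u) smc" where
  "strictify C = \<lparr>
     Obj = vobjs C,
     Arr = {arr a f b | a f b. a \<in> vobjs C \<and> b \<in> vobjs C \<and> f \<in> Hom C (val C a) (val C b)},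
     Dom = asrc, Cod = atgt, Idt = (\<lambda>a. arr a (Idt C (val C a)) a),
     Cmp = (\<lambda>g f. arr (asrc f) (amap g \<cdot>\<^bsub>C\<^esub> amap f) (atgt g)),
     Sum = vsum C,
     SumA = (\<lambda>f g. arr (vsum C (asrc f) (asrc g))
       (collect C (atgt f) (atgt g) \<cdot>\<^bsub>C\<^esub> (amap f \<boxtimes>\<^bsub>C\<^esub> amap g) \<cdot>\<^bsub>C\<^esub> inv_arr C (collect C (asrc f) (asrc g)))
       (vsum C (atgt f) (atgt g))),
     Unt = vunit,
     Asc = (\<lambda>a b c. arr (vsum C (vsum C a b) c) (Idt C (val C (vsum C (vsum C a b) c))) (vsum C a (vsum C b c))),
     Lun = (\<lambda>a. arr a (Idt C (val C a)) a), Run = (\<lambda>a. arr a (Idt C (val C a)) a),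
     Brd = (\<lambda>a b. arr (vsum C a b)
       (collect C b a \<cdot>\<^bsub>C\<^esub> Brd C (val C a) (val C b) \<cdot>\<^bsub>C\<^esub> inv_arr C (collect C a b)) (vsum C b a))\<rparr>"

lemma val_vunit [simp]: "val C vunit = Unt C"
  by (simp add: val_def vunit_def)

lemma val_code [simp]: "val C (code (VObj c xs x)) = c"
  by (simp add: val_def)

lemma code_VObj_neq_vunit [simp]: "code (VObj c xs x) \<noteq> vunit"
  by (simp add: vunit_def)

lemma vobjs_simps [simp]: "vunit \<in> vobjs C" "code (VObj c xs x) \<in> vobjs C \<longleftrightarrow> c \<in> Obj C"
  by (auto simp: vobjs_def)

lemma vobjs_cases [consumes 1, case_names vunit VObj]:
  assumes "a \<in> vobjs C"
  obtains "a = vunit" | c xs x where "a = code (VObj c xs x)" "c \<in> Obj C"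
  using assms by (auto simp: vobjs_def)

lemma vsum_vunit [simp]: "vsum C vunit b = b" "vsum C a vunit = a"
  by (simp_all add: vsum_def)

lemma collect_vunit_left [simp]: "collect C vunit b = Lun C (val C b)"
  by (simp add: collect_def)

locale small_symmetric_monoidal_category = symmetric_monoidal_category C
  for C :: "('u::infinite, 'u) smc" (structure)
begin

lemma val_Obj [simp]: "a \<in> vobjs C \<Longrightarrow> val C a \<in> Obj C"
  by (auto elim: vobjs_cases)

lemma collect_vunit_right [simp]: "collect C a vunit = Run C (val C a)"
  by (simp add: collect_def Lun_Unt)

lemma sum_word_Obj [simp]: "set xs \<subseteq> Obj C \<Longrightarrow> x \<in> Obj C \<Longrightarrow> sum_word C xs x \<in> Obj C"
  by (induction xs) auto

lemma spelling_vword [simp]: "set xs \<subseteq> Obj C \<Longrightarrow> x \<in> Obj C \<Longrightarrow> spelling C (vword C xs x) = (xs, x)"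
  by (simp add: spelling_def vword_def)

lemma val_vword [simp]: "val C (vword C xs x) = sum_word C xs x"
  by (simp add: vword_def)

lemma vword_neq_vunit [simp]: "vword C xs x \<noteq> vunit"
  by (simp add: vword_def)

lemma spelling_cases [consumes 1, case_names vunit word]:
  assumes "a \<in> vobjs C"
  obtains "a = vunit"
  | xs x where "a \<noteq> vunit" "spelling C a = (xs, x)" "set xs \<subseteq> Obj C" "x \<in> Obj C" "val C a = sum_word C xs x"
  using assms
proof (cases rule: vobjs_cases)
  case (VObj c xs x)
  then show ?thesis
    using that(2)[of "fst (spelling C a)" "snd (spelling C a)"] by (simp add: spelling_def)
qed (use that in simp)

lemma vsum_vobjs [simp]:
  assumes "a \<in> vobjs C" "b \<in> vobjs C"
  shows "vsum C a b \<in> vobjs C"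
proof (cases rule: spelling_cases[OF assms(1)])
  case (2 xs x)
  note a = 2
  show ?thesis
  proof (cases rule: spelling_cases[OF assms(2)])
    case 1 then show ?thesis using assms by simp
  next
    case (2 ys y)
    then show ?thesis using a by (simp add: vsum_def vword_def)
  qed
qed (use assms in simp)

text \<open>
  Words of non-units are nonempty and so are their concatenations; hence a sum of non-units is never
  the unit, and the case distinction in \<open>vsum\<close> does no harm.
\<close>

lemma vsum_assoc:
  assumes a: "a \<in> vobjs C" and b: "b \<in> vobjs C" and c: "c \<in> vobjs C"
  shows "vsum C (vsum C a b) c = vsum C a (vsum C b c)"
proof (cases "a = vunit \<or> b = vunit \<or> c = vunit")
  case True
  then show ?thesis by auto
next
  case False
  from a b c False show ?thesis
    by (elim spelling_cases) (auto simp: vsum_def)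
qed

lemma regroup_arrow [simp]: "set xs \<subseteq> Obj C \<Longrightarrow> x \<in> Obj C \<Longrightarrow> d \<in> Obj C \<Longrightarrow>
    regroup C xs x d \<in> Arr C \<and> Dom C (regroup C xs x d) = sum_word C xs x \<boxplus> d \<and>
    Cod C (regroup C xs x d) = sum_word C xs (x \<boxplus> d) \<and> invertible C (regroup C xs x d)"
  by (induction xs) auto

text \<open>
  Coherence for three words, by induction on the first one. The induction step moves the associator
  past \<open>regroup\<close> by naturality and applies the pentagon once.
\<close>

lemma regroup_append:
  assumes "set xs \<subseteq> Obj C" "x \<in> Obj C" "set ys \<subseteq> Obj C" "y \<in> Obj C" "d \<in> Obj C"
  shows "regroup C (xs @ x # ys) y d \<cdot> (regroup C xs x (sum_word C ys y) \<boxtimes> Idt C d) =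
    regroup C xs x (sum_word C ys (y \<boxplus> d)) \<cdot>
      (Idt C (sum_word C xs x) \<boxtimes> regroup C ys y d) \<cdot> Asc C (sum_word C xs x) (sum_word C ys y) d"
  using assms(1)
proof (induction xs)
  case Nil
  then show ?case using assms by simp
next
  case (Cons a xs)
  let ?X = "sum_word C xs x" and ?Y = "sum_word C ys y" and ?r = "regroup C xs x (sum_word C ys y)"
  let ?R = "regroup C (xs @ x # ys) y d" and ?s = "regroup C ys y d"
  let ?q = "regroup C xs x (sum_word C ys (y \<boxplus> d))"
  have objs [simp]: "a \<in> Obj C" "x \<in> Obj C" "y \<in> Obj C" "d \<in> Obj C" "set xs \<subseteq> Obj C" "set ys \<subseteq> Obj C"
    using Cons.prems assms by auto
  have [simp]: "sum_word C (xs @ x # ys) y = sum_word C xs (x \<boxplus> ?Y)" by simp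
  have "regroup C ((a # xs) @ x # ys) y d \<cdot> (regroup C (a # xs) x ?Y \<boxtimes> Idt C d) =
    (Idt C a \<boxtimes> ?R) \<cdot> Asc C a (sum_word C xs (x \<boxplus> ?Y)) d \<cdot>
      (((Idt C a \<boxtimes> ?r) \<cdot> Asc C a ?X ?Y) \<boxtimes> (Idt C d \<cdot> Idt C d))"
    by simp
  also have "\<dots> = (Idt C a \<boxtimes> ?R) \<cdot> (Asc C a (sum_word C xs (x \<boxplus> ?Y)) d \<cdot>
      ((Idt C a \<boxtimes> ?r) \<boxtimes> Idt C d)) \<cdot> (Asc C a ?X ?Y \<boxtimes> Idt C d)"
    by (subst interchange[symmetric]) auto
  also have "\<dots> = (Idt C a \<boxtimes> ?R) \<cdot> ((Idt C a \<boxtimes> (?r \<boxtimes> Idt C d)) \<cdot> Asc C a (?X \<boxplus> ?Y) d) \<cdot> (Asc C a ?X ?Y \<boxtimes> Idt C d)"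
    using Asc_nat[of "Idt C a" ?r "Idt C d"] by simp
  also have "\<dots> = ((Idt C a \<cdot> Idt C a) \<boxtimes> (?R \<cdot> (?r \<boxtimes> Idt C d))) \<cdot> Asc C a (?X \<boxplus> ?Y) d \<cdot> (Asc C a ?X ?Y \<boxtimes> Idt C d)"
    by (simp add: interchange_left)
  also have "\<dots> = ((Idt C a \<cdot> Idt C a) \<boxtimes> (?q \<cdot> (Idt C ?X \<boxtimes> ?s) \<cdot> Asc C ?X ?Y d)) \<cdot>
      Asc C a (?X \<boxplus> ?Y) d \<cdot> (Asc C a ?X ?Y \<boxtimes> Idt C d)"
    using Cons.IH by simp
  also have "\<dots> = (Idt C a \<boxtimes> ?q) \<cdot> (Idt C a \<boxtimes> (Idt C ?X \<boxtimes> ?s)) \<cdot> (Idt C a \<boxtimes> Asc C ?X ?Y d) \<cdot>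
      Asc C a (?X \<boxplus> ?Y) d \<cdot> (Asc C a ?X ?Y \<boxtimes> Idt C d)"
    by (simp add: interchange_left)
  also have "\<dots> = (Idt C a \<boxtimes> ?q) \<cdot> ((Idt C a \<boxtimes> (Idt C ?X \<boxtimes> ?s)) \<cdot> Asc C a ?X (?Y \<boxplus> d)) \<cdot> Asc C (a \<boxplus> ?X) ?Y d"
    using pentagon[of a ?X ?Y d] by simp
  also have "\<dots> = (Idt C a \<boxtimes> ?q) \<cdot> (Asc C a ?X (sum_word C ys (y \<boxplus> d)) \<cdot> (Idt C (a \<boxplus> ?X) \<boxtimes> ?s)) \<cdot> Asc C (a \<boxplus> ?X) ?Y d"
    using Asc_nat[of "Idt C a" "Idt C ?X" ?s] by simp
  also have "\<dots> = regroup C (a # xs) x (sum_word C ys (y \<boxplus> d)) \<cdot>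
      (Idt C (sum_word C (a # xs) x) \<boxtimes> ?s) \<cdot> Asc C (sum_word C (a # xs) x) ?Y d"
    by simp
  finally show ?case .
qed

lemma vsum_word:
  assumes "a \<noteq> vunit" "b \<noteq> vunit" "spelling C a = (xs, x)" "spelling C b = (ys, y)"
  shows "vsum C a b = vword C (xs @ x # ys) y"
  using assms by (simp add: vsum_def)

lemma collect_arrow [simp]:
  assumes "a \<in> vobjs C" "b \<in> vobjs C"
  shows "collect C a b \<in> Arr C \<and> Dom C (collect C a b) = val C a \<boxplus> val C b \<and>
    Cod C (collect C a b) = val C (vsum C a b) \<and> invertible C (collect C a b)"
proof (cases "a = vunit \<or> b = vunit")
  case True
  then show ?thesis using assms by auto
next
  case False
  from assms(1) show ?thesis
  proof (cases rule: spelling_cases)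
    case (word xs x)
    note a = this
    from assms(2) show ?thesis
    proof (cases rule: spelling_cases)
      case (word ys y)
      with a show ?thesis by (simp add: collect_def vsum_word)
    qed (use False in simp)
  qed (use False in simp)
qed

text \<open>
  If one of the objects is the unit, this is a coherence law for unitors: \<open>Lun_Sum\<close>, the triangle, or
  \<open>Run_Sum\<close>, according to its position.
\<close>

lemma collect_assoc:
  assumes a: "a \<in> vobjs C" and b: "b \<in> vobjs C" and c: "c \<in> vobjs C"
  shows "collect C (vsum C a b) c \<cdot> (collect C a b \<boxtimes> Idt C (val C c)) =
    collect C a (vsum C b c) \<cdot> (Idt C (val C a) \<boxtimes> collect C b c) \<cdot> Asc C (val C a) (val C b) (val C c)"
proof -
  consider "a = vunit" | "b = vunit" | "c = vunit" | "a \<noteq> vunit" "b \<noteq> vunit" "c \<noteq> vunit" by blast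
  then show ?thesis
  proof cases
    case 1
    have "collect C a (vsum C b c) \<cdot> (Idt C (val C a) \<boxtimes> collect C b c) \<cdot> Asc C (val C a) (val C b) (val C c) =
      (Lun C (val C (vsum C b c)) \<cdot> (Idt C (Unt C) \<boxtimes> collect C b c)) \<cdot> Asc C (Unt C) (val C b) (val C c)"
      using 1 b c by simp
    also have "\<dots> = collect C b c \<cdot> Lun C (val C b \<boxplus> val C c) \<cdot> Asc C (Unt C) (val C b) (val C c)"
      using b c Lun_nat[of "collect C b c"] by simp
    also have "\<dots> = collect C b c \<cdot> (Lun C (val C b) \<boxtimes> Idt C (val C c))"
      using b c Lun_Sum[of "val C b" "val C c"] by simp
    finally show ?thesis using 1 by simp
  next
    case 2
    then show ?thesis using a c triangle[of "val C a" "val C c"] by simp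
  next
    case 3
    then show ?thesis
      using a b Run_Sum[of "val C a" "val C b"] Run_nat[of "collect C a b"] by simp
  next
    case 4
    from a obtain xs x where A: "spelling C a = (xs, x)" "set xs \<subseteq> Obj C" "x \<in> Obj C" "val C a = sum_word C xs x"
      using 4 by (cases rule: spelling_cases) auto
    from b obtain ys y where B: "spelling C b = (ys, y)" "set ys \<subseteq> Obj C" "y \<in> Obj C" "val C b = sum_word C ys y"
      using 4 by (cases rule: spelling_cases) auto
    from c obtain zs z where C: "spelling C c = (zs, z)" "set zs \<subseteq> Obj C" "z \<in> Obj C" "val C c = sum_word C zs z"
      using 4 by (cases rule: spelling_cases) auto
    show ?thesis
      using 4 A B C regroup_append[of xs x ys y "val C c"] c
      by (simp add: vsum_word collect_def)
  qed
qed

lemma collect_assoc_inv: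
  assumes a: "a \<in> vobjs C" and b: "b \<in> vobjs C" and c: "c \<in> vobjs C"
  shows "Asc C (val C a) (val C b) (val C c) \<cdot> (inv_arr C (collect C a b) \<boxtimes> Idt C (val C c)) \<cdot>
      inv_arr C (collect C (vsum C a b) c) =
    (Idt C (val C a) \<boxtimes> inv_arr C (collect C b c)) \<cdot> inv_arr C (collect C a (vsum C b c))"
    (is "?A \<cdot> ?l' \<cdot> ?k' = ?m' \<cdot> ?n'")
proof -
  let ?l = "collect C a b \<boxtimes> Idt C (val C c)" and ?k = "collect C (vsum C a b) c"
  let ?m = "Idt C (val C a) \<boxtimes> collect C b c" and ?n = "collect C a (vsum C b c)"
  note [simp] = a b c vsum_assoc[OF a b c]
  have l: "?l' = inv_arr C ?l" and m: "?m' = inv_arr C ?m"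
    by (simp_all add: inv_SumA)
  have "?A \<cdot> ?l' \<cdot> ?k' = ?m' \<cdot> ?n' \<cdot> (?n \<cdot> ?m \<cdot> ?A) \<cdot> ?l' \<cdot> ?k'"
    unfolding l m by simp
  also have "\<dots> = ?m' \<cdot> ?n' \<cdot> (?k \<cdot> ?l) \<cdot> ?l' \<cdot> ?k'"
    using collect_assoc[OF a b c] by simp
  also have "\<dots> = ?m' \<cdot> ?n'"
    unfolding l m by simp
  finally show ?thesis .
qed

text \<open>
  Both sides are the conjugate of \<open>(f \<boxtimes> g) \<boxtimes> h\<close> by the two composites of comparisons that agree by
  \<open>collect_assoc\<close>.
\<close>

lemma transport_assoc:
  assumes obj: "a \<in> vobjs C" "b \<in> vobjs C" "c \<in> vobjs C" "a' \<in> vobjs C" "b' \<in> vobjs C" "c' \<in> vobjs C"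
    and f: "f \<in> Arr C" "Dom C f = val C a" "Cod C f = val C a'"
    and g: "g \<in> Arr C" "Dom C g = val C b" "Cod C g = val C b'"
    and h: "h \<in> Arr C" "Dom C h = val C c" "Cod C h = val C c'"
  shows "collect C (vsum C a' b') c' \<cdot>
      ((collect C a' b' \<cdot> (f \<boxtimes> g) \<cdot> inv_arr C (collect C a b)) \<boxtimes> h) \<cdot>
      inv_arr C (collect C (vsum C a b) c) =
    collect C a' (vsum C b' c') \<cdot>
      (f \<boxtimes> (collect C b' c' \<cdot> (g \<boxtimes> h) \<cdot> inv_arr C (collect C b c))) \<cdot>
      inv_arr C (collect C a (vsum C b c))"
proof -
  note [simp] = obj f g h vsum_assoc
  let ?k' = "collect C (vsum C a' b') c'" and ?n' = "collect C a' (vsum C b' c')"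
  let ?ik = "inv_arr C (collect C (vsum C a b) c)" and ?in = "inv_arr C (collect C a (vsum C b c))"
  let ?l' = "collect C a' b' \<boxtimes> Idt C (val C c')" and ?il = "inv_arr C (collect C a b) \<boxtimes> Idt C (val C c)"
  let ?m' = "Idt C (val C a') \<boxtimes> collect C b' c'" and ?im = "Idt C (val C a) \<boxtimes> inv_arr C (collect C b c)"
  have "(collect C a' b' \<cdot> (f \<boxtimes> g) \<cdot> inv_arr C (collect C a b)) \<boxtimes> (Idt C (val C c') \<cdot> h \<cdot> Idt C (val C c)) =
      ?l' \<cdot> ((f \<boxtimes> g) \<boxtimes> h) \<cdot> ?il"
    by (simp add: interchange)
  then have "?k' \<cdot> ((collect C a' b' \<cdot> (f \<boxtimes> g) \<cdot> inv_arr C (collect C a b)) \<boxtimes> h) \<cdot> ?ik =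
      (?k' \<cdot> ?l') \<cdot> ((f \<boxtimes> g) \<boxtimes> h) \<cdot> ?il \<cdot> ?ik"
    by simp
  also have "\<dots> = (?n' \<cdot> ?m') \<cdot> (Asc C (val C a') (val C b') (val C c') \<cdot> ((f \<boxtimes> g) \<boxtimes> h)) \<cdot> ?il \<cdot> ?ik"
    using collect_assoc[of a' b' c'] by simp
  also have "\<dots> = (?n' \<cdot> ?m') \<cdot> (f \<boxtimes> (g \<boxtimes> h)) \<cdot> (Asc C (val C a) (val C b) (val C c) \<cdot> ?il \<cdot> ?ik)"
    using Asc_nat[of f g h] by simp
  also have "\<dots> = (?n' \<cdot> ?m') \<cdot> (f \<boxtimes> (g \<boxtimes> h)) \<cdot> ?im \<cdot> ?in"
    using collect_assoc_inv[of a b c] by simp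
  also have "\<dots> = ?n' \<cdot> (?m' \<cdot> (f \<boxtimes> (g \<boxtimes> h)) \<cdot> ?im) \<cdot> ?in"
    by simp
  also have "?m' \<cdot> (f \<boxtimes> (g \<boxtimes> h)) \<cdot> ?im =
      (Idt C (val C a') \<cdot> f \<cdot> Idt C (val C a)) \<boxtimes> (collect C b' c' \<cdot> (g \<boxtimes> h) \<cdot> inv_arr C (collect C b c))"
    by (simp add: interchange)
  finally show ?thesis by simp
qed

text \<open>
  In the middle of the right-hand side the comparisons cancel up to an associator, which leaves
  exactly one side of the hexagon of \<open>C\<close>; naturality of the symmetry then removes \<open>collect C y z\<close>.
\<close>

lemma transport_hexagon:
  assumes [simp]: "x \<in> vobjs C" "y \<in> vobjs C" "z \<in> vobjs C"
  defines "T \<equiv> \<lambda>a b. collect C b a \<cdot> Brd C (val C a) (val C b) \<cdot> inv_arr C (collect C a b)"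
  shows "T x (vsum C y z) =
    (collect C y (vsum C z x) \<cdot> (Idt C (val C y) \<boxtimes> T x z) \<cdot> inv_arr C (collect C y (vsum C x z))) \<cdot>
    collect C (vsum C y x) z \<cdot> (T x y \<boxtimes> Idt C (val C z)) \<cdot> inv_arr C (collect C (vsum C x y) z)"
proof -
  note [simp] = vsum_assoc
  let ?x = "val C x" and ?y = "val C y" and ?z = "val C z"
  let ?c = "collect C" and ?i = "\<lambda>a b. inv_arr C (collect C a b)"
  have Txz: "Idt C ?y \<boxtimes> T x z = (Idt C ?y \<boxtimes> ?c z x) \<cdot> (Idt C ?y \<boxtimes> Brd C ?x ?z) \<cdot> (Idt C ?y \<boxtimes> ?i x z)"
    by (simp add: interchange T_def)
  have Txy: "T x y \<boxtimes> Idt C ?z = (?c y x \<boxtimes> Idt C ?z) \<cdot> (Brd C ?x ?y \<boxtimes> Idt C ?z) \<cdot> (?i x y \<boxtimes> Idt C ?z)"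
    by (simp add: interchange T_def)
  have iy: "Idt C ?y \<boxtimes> ?i x z = inv_arr C (Idt C ?y \<boxtimes> ?c x z)"
    by (simp add: inv_SumA)
  have "(?c y (vsum C z x) \<cdot> (Idt C ?y \<boxtimes> T x z) \<cdot> ?i y (vsum C x z)) \<cdot>
      ?c (vsum C y x) z \<cdot> (T x y \<boxtimes> Idt C ?z) \<cdot> ?i (vsum C x y) z =
    ?c y (vsum C z x) \<cdot> (Idt C ?y \<boxtimes> ?c z x) \<cdot> (Idt C ?y \<boxtimes> Brd C ?x ?z) \<cdot> (Idt C ?y \<boxtimes> ?i x z) \<cdot> ?i y (vsum C x z) \<cdot>
      (?c (vsum C y x) z \<cdot> (?c y x \<boxtimes> Idt C ?z)) \<cdot> (Brd C ?x ?y \<boxtimes> Idt C ?z) \<cdot> (?i x y \<boxtimes> Idt C ?z) \<cdot> ?i (vsum C x y) z"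
    unfolding Txz Txy by simp
  also have "\<dots> = ?c y (vsum C z x) \<cdot> (Idt C ?y \<boxtimes> ?c z x) \<cdot>
      ((Idt C ?y \<boxtimes> Brd C ?x ?z) \<cdot> Asc C ?y ?x ?z \<cdot> (Brd C ?x ?y \<boxtimes> Idt C ?z)) \<cdot>
      (?i x y \<boxtimes> Idt C ?z) \<cdot> ?i (vsum C x y) z"
    unfolding collect_assoc[OF assms(2,1,3)] iy by simp
  also have "\<dots> = ?c y (vsum C z x) \<cdot> (Idt C ?y \<boxtimes> ?c z x) \<cdot>
      (Asc C ?y ?z ?x \<cdot> Brd C ?x (?y \<boxplus> ?z) \<cdot> Asc C ?x ?y ?z) \<cdot>
      (?i x y \<boxtimes> Idt C ?z) \<cdot> ?i (vsum C x y) z"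
    using hexagon[of ?x ?y ?z] by simp
  also have "\<dots> = (?c y (vsum C z x) \<cdot> (Idt C ?y \<boxtimes> ?c z x) \<cdot> Asc C ?y ?z ?x) \<cdot> Brd C ?x (?y \<boxplus> ?z) \<cdot>
      (Asc C ?x ?y ?z \<cdot> (?i x y \<boxtimes> Idt C ?z) \<cdot> ?i (vsum C x y) z)"
    by simp
  also have "\<dots> = (?c (vsum C y z) x \<cdot> (?c y z \<boxtimes> Idt C ?x)) \<cdot> Brd C ?x (?y \<boxplus> ?z) \<cdot>
      ((Idt C ?x \<boxtimes> ?i y z) \<cdot> ?i x (vsum C y z))"
    using collect_assoc[OF assms(2,3,1)] collect_assoc_inv[OF assms(1-3)] by simp
  also have "\<dots> = ?c (vsum C y z) x \<cdot> ((?c y z \<boxtimes> Idt C ?x) \<cdot> Brd C ?x (?y \<boxplus> ?z)) \<cdot>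
      (Idt C ?x \<boxtimes> ?i y z) \<cdot> ?i x (vsum C y z)"
    by simp
  also have "\<dots> = ?c (vsum C y z) x \<cdot> (Brd C ?x (val C (vsum C y z)) \<cdot> (Idt C ?x \<boxtimes> ?c y z)) \<cdot>
      (Idt C ?x \<boxtimes> ?i y z) \<cdot> ?i x (vsum C y z)"
    using Brd_nat[of "Idt C ?x" "?c y z"] by simp
  also have "\<dots> = T x (vsum C y z)"
    by (simp add: interchange_left T_def)
  finally show ?thesis ..
qed

lemma strictify_simps [simp]:
  "Obj (strictify C) = vobjs C" "Dom (strictify C) = asrc" "Cod (strictify C) = atgt"
  "Idt (strictify C) a = arr a (Idt C (val C a)) a"
  "t \<cdot>\<^bsub>strictify C\<^esub> s = arr (asrc s) (amap t \<cdot> amap s) (atgt t)"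
  "Sum (strictify C) = vsum C"
  "s \<boxtimes>\<^bsub>strictify C\<^esub> t = arr (vsum C (asrc s) (asrc t))
       (collect C (atgt s) (atgt t) \<cdot> (amap s \<boxtimes> amap t) \<cdot> inv_arr C (collect C (asrc s) (asrc t)))
       (vsum C (atgt s) (atgt t))"
  "Unt (strictify C) = vunit"
  "Asc (strictify C) a b c =
     arr (vsum C (vsum C a b) c) (Idt C (val C (vsum C (vsum C a b) c))) (vsum C a (vsum C b c))"
  "Lun (strictify C) a = arr a (Idt C (val C a)) a" "Run (strictify C) a = arr a (Idt C (val C a)) a"
  "Brd (strictify C) a b = arr (vsum C a b)
       (collect C b a \<cdot> Brd C (val C a) (val C b) \<cdot> inv_arr C (collect C a b)) (vsum C b a)"
  by (simp_all add: strictify_def)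

lemma arr_in_strictify [simp]:
  "arr a f b \<in> Arr (strictify C) \<longleftrightarrow>
    a \<in> vobjs C \<and> b \<in> vobjs C \<and> f \<in> Arr C \<and> Dom C f = val C a \<and> Cod C f = val C b"
  by (auto simp: strictify_def Hom_iff)

lemma strictify_ArrE:
  assumes "t \<in> Arr (strictify C)"
  obtains a f b where "t = arr a f b" "a \<in> vobjs C" "b \<in> vobjs C" "f \<in> Arr C" "Dom C f = val C a" "Cod C f = val C b"
  using assms by (auto simp: strictify_def Hom_iff)

lemma strictify_HomE:
  assumes "t \<in> Hom (strictify C) a b"
  obtains f where "t = arr a f b" "a \<in> vobjs C" "b \<in> vobjs C" "f \<in> Arr C" "Dom C f = val C a" "Cod C f = val C b"
  using assms by (auto simp: strictify_def Hom_iff)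

lemma category_strictify: "category (strictify C)"
  by (rule categoryI) (auto elim!: strictify_ArrE)

lemma arr_in_Iso_strictify:
  assumes "a \<in> vobjs C" "b \<in> vobjs C" "f \<in> Arr C" "Dom C f = val C a" "Cod C f = val C b" "invertible C f"
  shows "arr a f b \<in> Iso (strictify C) a b"
proof -
  interpret S: category "strictify C" by (rule category_strictify)
  show ?thesis
    unfolding Iso_iff using assms by (auto intro!: S.invertibleI[of _ "arr b (inv_arr C f) a"])
qed

lemma permutative_strictify: "permutative_category (strictify C)"
proof -
  interpret S: category "strictify C" by (rule category_strictify)
  show ?thesis
  proof (unfold_locales, goal_cases)
    case (2 f x x' g y y')
    then show ?case by (elim strictify_HomE) (simp add: Hom_iff)
  next
    case (10 f x x' g y y' h z z')
    then show ?case by (auto elim!: strictify_HomE simp: vsum_assoc transport_assoc[unfolded vsum_assoc])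
  next
    case (11 f x x')
    then show ?case using Lun_conj[of "amap f"] by (auto elim!: strictify_HomE)
  next
    case (12 f x x')
    then show ?case using Run_conj[of "amap f"] by (auto elim!: strictify_HomE)
  next
    case (13 f x x' g y y')
    then show ?case
      using Brd_nat_Cmp[of "amap f" "amap g" "inv_arr C (collect C x y)"]
      by (auto elim!: strictify_HomE)
  next
    case (16 x y z)
    then show ?case using transport_hexagon[of x y z] by (simp add: vsum_assoc)
  next
    case (17 x y)
    then show ?case using symmetry_Cmp[of "val C x" "val C y"] by simp
  qed (auto elim!: strictify_HomE intro!: arr_in_Iso_strictify simp: vsum_assoc interchange_left)
qed

end



section \<open>The 2-category of symmetric monoidal categories\<close>

text \<open>
  Strong monoidal functors with source and target as parameters: facts about several composable
  functors then mention the same categories \<open>B\<close> and \<open>C\<close> instead of \<open>Src F\<close> and \<open>Tgt F\<close>. The locale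
  \<open>smn\<close> does the same for monoidal natural isomorphisms.
\<close>

locale smf =
  fixes B :: "('o, 'a) smc" and C :: "('o, 'a) smc" (structure) and F :: "('o, 'a) smfun"
  assumes strong: "strong_monoidal_functor F"
    and Src_eq [simp]: "Src F = B" and Tgt_eq [simp]: "Tgt F = C"
begin

sublocale B: symmetric_monoidal_category B
  using strong_monoidal_functor.axioms(1)[OF strong] by simp

sublocale C: symmetric_monoidal_category C
  using strong_monoidal_functor.axioms(2)[OF strong] by simp

sublocale cat_functor B C F
  using strong_monoidal_functor.axioms(3)[OF strong] by simp

lemmas Mul_arrow [simp] = strong_monoidal_functor.Mul_iso[OF strong, unfolded Src_eq Tgt_eq Iso_iff]

lemma Mul_nat:
  "f \<in> Arr B \<Longrightarrow> g \<in> Arr B \<Longrightarrow> Mul F (Cod B f, Cod B g) \<cdot> (AMap F f \<boxtimes> AMap F g) =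
    AMap F (f \<boxtimes>\<^bsub>B\<^esub> g) \<cdot> Mul F (Dom B f, Dom B g)"
  using strong_monoidal_functor.Mul_natural[OF strong] by (auto simp: Hom_iff)

lemma Mul_nat_Cmp:
  "f \<in> Arr B \<Longrightarrow> g \<in> Arr B \<Longrightarrow> h \<in> Arr C \<Longrightarrow> Cod C h = OMap F (Dom B f) \<boxplus> OMap F (Dom B g) \<Longrightarrow>
    Mul F (Cod B f, Cod B g) \<cdot> (AMap F f \<boxtimes> AMap F g) \<cdot> h =
    AMap F (f \<boxtimes>\<^bsub>B\<^esub> g) \<cdot> Mul F (Dom B f, Dom B g) \<cdot> h"
  using Mul_nat[of f g] C.Cmp_reassoc[of h "AMap F f \<boxtimes> AMap F g" "Mul F (Cod B f, Cod B g)"] by simp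

lemmas Mul_Asc = strong_monoidal_functor.Mul_Asc[OF strong, unfolded Src_eq Tgt_eq]
  and Mul_Brd = strong_monoidal_functor.Mul_Brd[OF strong, unfolded Src_eq Tgt_eq]
  and Mul_Lun = strong_monoidal_functor.Mul_Lun[OF strong, unfolded Src_eq Tgt_eq]
  and Mul_Run = strong_monoidal_functor.Mul_Run[OF strong, unfolded Src_eq Tgt_eq]
  and Unt_strict [simp] = strong_monoidal_functor.Unt_strict[OF strong, unfolded Src_eq Tgt_eq]
  and OMap_ext = strong_monoidal_functor.OMap_ext[OF strong, unfolded Src_eq Tgt_eq]
  and AMap_ext = strong_monoidal_functor.AMap_ext[OF strong, unfolded Src_eq Tgt_eq]
  and Mul_ext = strong_monoidal_functor.Mul_ext[OF strong, unfolded Src_eq Tgt_eq]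

end

lemma smfI:
  fixes B :: "('o, 'a) smc" and C :: "('o, 'a) smc" (structure) and F :: "('o, 'a) smfun"
  assumes "symmetric_monoidal_category B" "symmetric_monoidal_category C" "Src F = B" "Tgt F = C"
    and O: "\<And>x. x \<in> Obj B \<Longrightarrow> OMap F x \<in> Obj C"
    and A: "\<And>f. f \<in> Arr B \<Longrightarrow> AMap F f \<in> Arr C \<and> Dom C (AMap F f) = OMap F (Dom B f) \<and> Cod C (AMap F f) = OMap F (Cod B f)"
    and "\<And>x. x \<in> Obj B \<Longrightarrow> AMap F (Idt B x) = Idt C (OMap F x)"
    and "\<And>f g. f \<in> Arr B \<Longrightarrow> g \<in> Arr B \<Longrightarrow> Dom B g = Cod B f \<Longrightarrow> AMap F (g \<cdot>\<^bsub>B\<^esub> f) = AMap F g \<cdot> AMap F f"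
    and M: "\<And>x y. x \<in> Obj B \<Longrightarrow> y \<in> Obj B \<Longrightarrow> Mul F (x, y) \<in> Arr C \<and> Dom C (Mul F (x, y)) = OMap F x \<boxplus> OMap F y
      \<and> Cod C (Mul F (x, y)) = OMap F (x \<boxplus>\<^bsub>B\<^esub> y) \<and> invertible C (Mul F (x, y))"
    and N: "\<And>f g. f \<in> Arr B \<Longrightarrow> g \<in> Arr B \<Longrightarrow> Mul F (Cod B f, Cod B g) \<cdot> (AMap F f \<boxtimes> AMap F g) =
      AMap F (f \<boxtimes>\<^bsub>B\<^esub> g) \<cdot> Mul F (Dom B f, Dom B g)"
    and "\<And>x y z. x \<in> Obj B \<Longrightarrow> y \<in> Obj B \<Longrightarrow> z \<in> Obj B \<Longrightarrow>
      AMap F (Asc B x y z) \<cdot> Mul F (x \<boxplus>\<^bsub>B\<^esub> y, z) \<cdot> (Mul F (x, y) \<boxtimes> Idt C (OMap F z)) =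
      Mul F (x, y \<boxplus>\<^bsub>B\<^esub> z) \<cdot> (Idt C (OMap F x) \<boxtimes> Mul F (y, z)) \<cdot> Asc C (OMap F x) (OMap F y) (OMap F z)"
    and "\<And>x y. x \<in> Obj B \<Longrightarrow> y \<in> Obj B \<Longrightarrow>
      AMap F (Brd B x y) \<cdot> Mul F (x, y) = Mul F (y, x) \<cdot> Brd C (OMap F x) (OMap F y)"
    and "OMap F (Unt B) = Unt C"
    and "\<And>x. x \<in> Obj B \<Longrightarrow> AMap F (Lun B x) \<cdot> Mul F (Unt B, x) = Lun C (OMap F x)"
    and "\<And>x. x \<in> Obj B \<Longrightarrow> AMap F (Run B x) \<cdot> Mul F (x, Unt B) = Run C (OMap F x)"
    and "OMap F \<in> extensional (Obj B)" "AMap F \<in> extensional (Arr B)" "Mul F \<in> extensional (Obj B \<times> Obj B)"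
  shows "smf B C F"
proof -
  interpret B: symmetric_monoidal_category B by fact
  interpret C: symmetric_monoidal_category C by fact
  have "cat_functor B C F"
    by unfold_locales (use assms in \<open>auto simp: Hom_iff\<close>)
  then have "strong_monoidal_functor F"
    unfolding strong_monoidal_functor_def strong_monoidal_functor_axioms_def \<open>Src F = B\<close> \<open>Tgt F = C\<close>
    using assms B.symmetric_monoidal_category_axioms C.symmetric_monoidal_category_axioms
    by (simp add: Iso_iff) (auto simp: Hom_iff)
  then show ?thesis using assms by (simp add: smf_def)
qed

lemma smfun_eqI:
  assumes "smf B C F" "smf B C G"
    and "\<And>x. x \<in> Obj B \<Longrightarrow> OMap F x = OMap G x" "\<And>f. f \<in> Arr B \<Longrightarrow> AMap F f = AMap G f"
    and "\<And>x y. x \<in> Obj B \<Longrightarrow> y \<in> Obj B \<Longrightarrow> Mul F (x, y) = Mul G (x, y)"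
  shows "F = G"
proof -
  interpret F: smf B C F by fact
  interpret G: smf B C G by fact
  have "OMap F = OMap G"
    using assms(3) F.OMap_ext G.OMap_ext by (metis extensionalityI)
  moreover have "AMap F = AMap G"
    using assms(4) F.AMap_ext G.AMap_ext by (metis extensionalityI)
  moreover have "Mul F = Mul G"
    using assms(5) F.Mul_ext G.Mul_ext by (intro extensionalityI) auto
  ultimately show ?thesis using F.Src_eq F.Tgt_eq G.Src_eq G.Tgt_eq by simp
qed

locale smn =
  fixes B :: "('o, 'a) smc" and C :: "('o, 'a) smc" (structure) and F G :: "('o, 'a) smfun" and \<alpha> :: "('o, 'a) smnat"
  assumes smf_src: "smf B C F" and smf_tgt: "smf B C G"
    and mni: "monoidal_natural_isomorphism \<alpha>"
    and NSrc_eq [simp]: "NSrc \<alpha> = F" and NTgt_eq [simp]: "NTgt \<alpha> = G"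
begin

sublocale F: smf B C F by (rule smf_src)
sublocale G: smf B C G by (rule smf_tgt)

lemma NMap_arrow [simp]: "x \<in> Obj B \<Longrightarrow> NMap \<alpha> x \<in> Arr C \<and> Dom C (NMap \<alpha> x) = OMap F x \<and>
    Cod C (NMap \<alpha> x) = OMap G x \<and> invertible C (NMap \<alpha> x)"
  using natural_isomorphism.component_iso[OF monoidal_natural_isomorphism.axioms(3)[OF mni], of x]
  by (simp add: Iso_iff)

lemma NMap_nat: "f \<in> Arr B \<Longrightarrow> AMap G f \<cdot> NMap \<alpha> (Dom B f) = NMap \<alpha> (Cod B f) \<cdot> AMap F f"
  and NMap_Sum: "x \<in> Obj B \<Longrightarrow> y \<in> Obj B \<Longrightarrow>
      NMap \<alpha> (x \<boxplus>\<^bsub>B\<^esub> y) \<cdot> Mul F (x, y) = Mul G (x, y) \<cdot> (NMap \<alpha> x \<boxtimes> NMap \<alpha> y)"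
  and NMap_Unt [simp]: "NMap \<alpha> (Unt B) = Idt C (Unt C)"
  and NMap_ext: "NMap \<alpha> \<in> extensional (Obj B)"
proof -
  interpret N: monoidal_natural_isomorphism \<alpha> by (rule mni)
  show "f \<in> Arr B \<Longrightarrow> AMap G f \<cdot> NMap \<alpha> (Dom B f) = NMap \<alpha> (Cod B f) \<cdot> AMap F f"
    using N.natural[of f "Dom B f" "Cod B f"] by (simp add: Hom_iff)
  show "x \<in> Obj B \<Longrightarrow> y \<in> Obj B \<Longrightarrow>
      NMap \<alpha> (x \<boxplus>\<^bsub>B\<^esub> y) \<cdot> Mul F (x, y) = Mul G (x, y) \<cdot> (NMap \<alpha> x \<boxtimes> NMap \<alpha> y)"
    using N.NMap_Sum[of x y] by simp
  show "NMap \<alpha> (Unt B) = Idt C (Unt C)" "NMap \<alpha> \<in> extensional (Obj B)"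
    using N.NMap_Unt N.NMap_ext by simp_all
qed

end

lemma smnI:
  fixes C (structure) and \<alpha> :: "('o, 'a) smnat"
  assumes F: "smf B C F" and G: "smf B C G" and eq: "NSrc \<alpha> = F" "NTgt \<alpha> = G"
    and "\<And>x. x \<in> Obj B \<Longrightarrow> NMap \<alpha> x \<in> Arr C \<and> Dom C (NMap \<alpha> x) = OMap F x \<and> Cod C (NMap \<alpha> x) = OMap G x
      \<and> invertible C (NMap \<alpha> x)"
    and "\<And>f. f \<in> Arr B \<Longrightarrow> AMap G f \<cdot> NMap \<alpha> (Dom B f) = NMap \<alpha> (Cod B f) \<cdot> AMap F f"
    and "\<And>x y. x \<in> Obj B \<Longrightarrow> y \<in> Obj B \<Longrightarrow>
      NMap \<alpha> (x \<boxplus>\<^bsub>B\<^esub> y) \<cdot> Mul F (x, y) = Mul G (x, y) \<cdot> (NMap \<alpha> x \<boxtimes> NMap \<alpha> y)"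
    and "NMap \<alpha> (Unt B) = Idt C (Unt C)"
    and "NMap \<alpha> \<in> extensional (Obj B)"
  shows "smn B C F G \<alpha>"
proof -
  interpret F: smf B C F by fact
  interpret G: smf B C G by fact
  have "natural_isomorphism B C F G (NMap \<alpha>)"
    by unfold_locales (use assms(5,6) in \<open>auto simp: Hom_iff Iso_iff\<close>)
  then have "monoidal_natural_isomorphism \<alpha>"
    unfolding monoidal_natural_isomorphism_def monoidal_natural_isomorphism_axioms_def eq
    using assms F.strong G.strong by simp
  then show ?thesis using assms by (simp add: smn_def)
qed

lemma smnat_eqI:
  assumes "smn B C F G \<alpha>" "smn B C F G \<beta>" "\<And>x. x \<in> Obj B \<Longrightarrow> NMap \<alpha> x = NMap \<beta> x"
  shows "\<alpha> = \<beta>"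
proof -
  interpret \<alpha>: smn B C F G \<alpha> by fact
  interpret \<beta>: smn B C F G \<beta> by fact
  have "NMap \<alpha> = NMap \<beta>"
    using assms(3) \<alpha>.NMap_ext \<beta>.NMap_ext by (metis extensionalityI)
  then show ?thesis using \<alpha>.NSrc_eq \<alpha>.NTgt_eq \<beta>.NSrc_eq \<beta>.NTgt_eq by simp
qed

lemma comp_smfun_simps [simp]:
  "Src (comp_smfun G F) = Src F" "Tgt (comp_smfun G F) = Tgt G"
  "x \<in> Obj (Src F) \<Longrightarrow> OMap (comp_smfun G F) x = OMap G (OMap F x)"
  "f \<in> Arr (Src F) \<Longrightarrow> AMap (comp_smfun G F) f = AMap G (AMap F f)"
  "x \<in> Obj (Src F) \<Longrightarrow> y \<in> Obj (Src F) \<Longrightarrow>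
    Mul (comp_smfun G F) (x, y) = AMap G (Mul F (x, y)) \<cdot>\<^bsub>Tgt G\<^esub> Mul G (OMap F x, OMap F y)"
  by (simp_all add: comp_smfun_def compose_def)

lemma id_smfun_simps [simp]:
  "Src (id_smfun C) = C" "Tgt (id_smfun C) = C"
  "x \<in> Obj C \<Longrightarrow> OMap (id_smfun C) x = x"
  "f \<in> Arr C \<Longrightarrow> AMap (id_smfun C) f = f"
  "x \<in> Obj C \<Longrightarrow> y \<in> Obj C \<Longrightarrow> Mul (id_smfun C) (x, y) = Idt C (x \<boxplus>\<^bsub>C\<^esub> y)"
  by (simp_all add: id_smfun_def)

lemma smnat_simps [simp]:
  "NSrc (id_smnat F) = F" "NTgt (id_smnat F) = F"
  "NSrc (vcomp_smnat \<beta> \<alpha>) = NSrc \<alpha>" "NTgt (vcomp_smnat \<beta> \<alpha>) = NTgt \<beta>"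
  "NSrc (hcomp_smnat \<beta> \<alpha>) = comp_smfun (NSrc \<beta>) (NSrc \<alpha>)"
  "NTgt (hcomp_smnat \<beta> \<alpha>) = comp_smfun (NTgt \<beta>) (NTgt \<alpha>)"
  "x \<in> Obj (Src F) \<Longrightarrow> NMap (id_smnat F) x = Idt (Tgt F) (OMap F x)"
  "x \<in> Obj (Src (NSrc \<alpha>)) \<Longrightarrow> NMap (vcomp_smnat \<beta> \<alpha>) x = NMap \<beta> x \<cdot>\<^bsub>Tgt (NSrc \<alpha>)\<^esub> NMap \<alpha> x"
  "x \<in> Obj (Src (NSrc \<alpha>)) \<Longrightarrow> NMap (hcomp_smnat \<beta> \<alpha>) x =
    NMap \<beta> (OMap (NTgt \<alpha>) x) \<cdot>\<^bsub>Tgt (NSrc \<beta>)\<^esub> AMap (NSrc \<beta>) (NMap \<alpha> x)"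
  by (simp_all add: id_smnat_def vcomp_smnat_def hcomp_smnat_def)

lemma id_smf:
  assumes "symmetric_monoidal_category C"
  shows "smf C C (id_smfun C)"
proof -
  interpret C: symmetric_monoidal_category C by fact
  show ?thesis
    by (rule smfI) (use assms in \<open>simp_all\<close>, simp_all add: id_smfun_def)
qed

text \<open>
  For the associator, naturality of the structure maps of \<open>G\<close> moves those of \<open>F\<close> inside \<open>G\<close>, where the
  axiom of \<open>F\<close> applies; what remains is the axiom of \<open>G\<close>.
\<close>

lemma comp_smf:
  fixes C (structure)
  assumes "smf A B F" "smf B C G"
  shows "smf A C (comp_smfun G F)"
proof -
  interpret F: smf A B F by fact
  interpret G: smf B C G by fact
  show ?thesis
  proof (rule smfI, goal_cases)
    case (10 f g)
    let ?x = "Dom A f" and ?y = "Dom A g" and ?x' = "Cod A f" and ?y' = "Cod A g"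
    have "(AMap G (Mul F (?x', ?y')) \<cdot> Mul G (OMap F ?x', OMap F ?y')) \<cdot>
        (AMap G (AMap F f) \<boxtimes> AMap G (AMap F g)) =
      AMap G (Mul F (?x', ?y') \<cdot>\<^bsub>B\<^esub> (AMap F f \<boxtimes>\<^bsub>B\<^esub> AMap F g)) \<cdot> Mul G (OMap F ?x, OMap F ?y)"
      using 10 G.Mul_nat[of "AMap F f" "AMap F g"] by simp
    then show ?case using 10 F.Mul_nat[of f g] by simp
  next
    case (11 x y z)
    let ?X = "OMap F x" and ?Y = "OMap F y" and ?Z = "OMap F z"
    note [simp] = 11
    have "AMap G (AMap F (Asc A x y z)) \<cdot>
        (AMap G (Mul F (x \<boxplus>\<^bsub>A\<^esub> y, z)) \<cdot> Mul G (OMap F (x \<boxplus>\<^bsub>A\<^esub> y), ?Z)) \<cdot>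
        ((AMap G (Mul F (x, y)) \<cdot> Mul G (?X, ?Y)) \<boxtimes> (AMap G (Idt B ?Z) \<cdot> Idt C (OMap G ?Z))) =
      AMap G (AMap F (Asc A x y z)) \<cdot> AMap G (Mul F (x \<boxplus>\<^bsub>A\<^esub> y, z)) \<cdot>
        (Mul G (OMap F (x \<boxplus>\<^bsub>A\<^esub> y), ?Z) \<cdot> (AMap G (Mul F (x, y)) \<boxtimes> AMap G (Idt B ?Z))) \<cdot>
        (Mul G (?X, ?Y) \<boxtimes> Idt C (OMap G ?Z))"
      by (subst G.C.interchange[symmetric]) auto
    also have "\<dots> = AMap G (AMap F (Asc A x y z) \<cdot>\<^bsub>B\<^esub> Mul F (x \<boxplus>\<^bsub>A\<^esub> y, z) \<cdot>\<^bsub>B\<^esub> (Mul F (x, y) \<boxtimes>\<^bsub>B\<^esub> Idt B ?Z)) \<cdot>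
        Mul G (?X \<boxplus>\<^bsub>B\<^esub> ?Y, ?Z) \<cdot> (Mul G (?X, ?Y) \<boxtimes> Idt C (OMap G ?Z))"
      using G.Mul_nat[of "Mul F (x, y)" "Idt B ?Z"] by simp
    also have "\<dots> = AMap G (Mul F (x, y \<boxplus>\<^bsub>A\<^esub> z) \<cdot>\<^bsub>B\<^esub> (Idt B ?X \<boxtimes>\<^bsub>B\<^esub> Mul F (y, z))) \<cdot>
        AMap G (Asc B ?X ?Y ?Z) \<cdot>
        Mul G (?X \<boxplus>\<^bsub>B\<^esub> ?Y, ?Z) \<cdot> (Mul G (?X, ?Y) \<boxtimes> Idt C (OMap G ?Z))"
      unfolding F.Mul_Asc[OF 11] by simp
    also have "\<dots> = AMap G (Mul F (x, y \<boxplus>\<^bsub>A\<^esub> z)) \<cdot>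
        (AMap G (Idt B ?X \<boxtimes>\<^bsub>B\<^esub> Mul F (y, z)) \<cdot> Mul G (?X, ?Y \<boxplus>\<^bsub>B\<^esub> ?Z)) \<cdot>
        (Idt C (OMap G ?X) \<boxtimes> Mul G (?Y, ?Z)) \<cdot> Asc C (OMap G ?X) (OMap G ?Y) (OMap G ?Z)"
      using G.Mul_Asc[of ?X ?Y ?Z] by simp
    also have "\<dots> = AMap G (Mul F (x, y \<boxplus>\<^bsub>A\<^esub> z)) \<cdot>
        (Mul G (?X, OMap F (y \<boxplus>\<^bsub>A\<^esub> z)) \<cdot> (AMap G (Idt B ?X) \<boxtimes> AMap G (Mul F (y, z)))) \<cdot>
        (Idt C (OMap G ?X) \<boxtimes> Mul G (?Y, ?Z)) \<cdot> Asc C (OMap G ?X) (OMap G ?Y) (OMap G ?Z)"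
      using G.Mul_nat[of "Idt B ?X" "Mul F (y, z)"] by simp
    finally show ?case by (simp add: G.C.interchange_left)
  next
    case (12 x y)
    let ?X = "OMap F x" and ?Y = "OMap F y"
    note [simp] = 12
    have "AMap G (AMap F (Brd A x y)) \<cdot> AMap G (Mul F (x, y)) \<cdot> Mul G (?X, ?Y) =
      AMap G (AMap F (Brd A x y) \<cdot>\<^bsub>B\<^esub> Mul F (x, y)) \<cdot> Mul G (?X, ?Y)"
      by simp
    also have "\<dots> = AMap G (Mul F (y, x)) \<cdot> AMap G (Brd B ?X ?Y) \<cdot> Mul G (?X, ?Y)"
      unfolding F.Mul_Brd[OF 12] by simp
    finally show ?case by (simp add: G.Mul_Brd)
  next
    case (14 x)
    then have "AMap G (AMap F (Lun A x)) \<cdot> AMap G (Mul F (Unt A, x)) \<cdot> Mul G (Unt B, OMap F x) =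
      AMap G (AMap F (Lun A x) \<cdot>\<^bsub>B\<^esub> Mul F (Unt A, x)) \<cdot> Mul G (Unt B, OMap F x)"
      by simp
    also have "\<dots> = Lun C (OMap G (OMap F x))"
      unfolding F.Mul_Lun[OF 14] using 14 by (simp add: G.Mul_Lun)
    finally show ?case using 14 by simp
  next
    case (15 x)
    then have "AMap G (AMap F (Run A x)) \<cdot> AMap G (Mul F (x, Unt A)) \<cdot> Mul G (OMap F x, Unt B) =
      AMap G (AMap F (Run A x) \<cdot>\<^bsub>B\<^esub> Mul F (x, Unt A)) \<cdot> Mul G (OMap F x, Unt B)"
      by simp
    also have "\<dots> = Run C (OMap G (OMap F x))"
      unfolding F.Mul_Run[OF 15] using 15 by (simp add: G.Mul_Run)
    finally show ?case using 15 by simp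
  next
    case 16
    show ?case by (simp add: comp_smfun_def)
  next
    case 17
    show ?case by (simp add: comp_smfun_def)
  next
    case 18
    show ?case by (simp add: comp_smfun_def)
  qed (auto simp: F.B.symmetric_monoidal_category_axioms G.C.symmetric_monoidal_category_axioms)
qed

lemma comp_smfun_assoc:
  assumes "smf A B F" "smf B C G" "smf C D H"
  shows "comp_smfun (comp_smfun H G) F = comp_smfun H (comp_smfun G F)"
proof -
  interpret F: smf A B F by fact
  interpret G: smf B C G by fact
  interpret H: smf C D H by fact
  show ?thesis
    by (rule smfun_eqI[of A D]) (use assms in \<open>auto intro: comp_smf\<close>)
qed

lemma comp_id_smfun:
  assumes "smf B C F"
  shows "comp_smfun F (id_smfun B) = F" "comp_smfun (id_smfun C) F = F"
proof -
  interpret F: smf B C F by fact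
  have id: "smf B B (id_smfun B)" "smf C C (id_smfun C)"
    using F.B.symmetric_monoidal_category_axioms F.C.symmetric_monoidal_category_axioms
    by (auto intro: id_smf)
  show "comp_smfun F (id_smfun B) = F" "comp_smfun (id_smfun C) F = F"
    by (rule smfun_eqI[of B C], use assms id in \<open>auto intro: comp_smf\<close>)+
qed

lemma id_smn:
  assumes "smf B C F"
  shows "smn B C F F (id_smnat F)"
proof -
  interpret F: smf B C F by fact
  show ?thesis
    by (rule smnI) (use assms in \<open>simp_all\<close>, simp_all add: id_smnat_def)
qed

lemma vcomp_smn:
  fixes C (structure)
  assumes "smn B C F G \<alpha>" "smn B C G H \<beta>"
  shows "smn B C F H (vcomp_smnat \<beta> \<alpha>)"
proof -
  interpret \<alpha>: smn B C F G \<alpha> by fact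
  interpret \<beta>: smn B C G H \<beta> by fact
  show ?thesis
  proof (rule smnI, goal_cases)
    case (6 f)
    then have "(AMap H f \<cdot> NMap \<beta> (Dom B f)) \<cdot> NMap \<alpha> (Dom B f) =
        NMap \<beta> (Cod B f) \<cdot> (AMap G f \<cdot> NMap \<alpha> (Dom B f))"
      by (subst \<beta>.NMap_nat) auto
    then show ?case using 6 \<alpha>.NMap_nat[of f] by simp
  next
    case (7 x y)
    then have "NMap \<beta> (x \<boxplus>\<^bsub>B\<^esub> y) \<cdot> NMap \<alpha> (x \<boxplus>\<^bsub>B\<^esub> y) \<cdot> Mul F (x, y) =
        (NMap \<beta> (x \<boxplus>\<^bsub>B\<^esub> y) \<cdot> Mul G (x, y)) \<cdot> (NMap \<alpha> x \<boxtimes> NMap \<alpha> y)"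
      by (subst \<alpha>.NMap_Sum) auto
    then show ?case using 7 \<beta>.NMap_Sum[of x y] by (simp add: \<alpha>.F.C.interchange)
  next
    case 9 show ?case by (simp add: vcomp_smnat_def)
  qed (use \<alpha>.smf_src \<beta>.smf_tgt in auto)
qed

lemma hcomp_smn:
  fixes C (structure)
  assumes "smn A B F F' \<alpha>" "smn B C G G' \<beta>"
  shows "smn A C (comp_smfun G F) (comp_smfun G' F') (hcomp_smnat \<beta> \<alpha>)"
proof -
  interpret \<alpha>: smn A B F F' \<alpha> by fact
  interpret \<beta>: smn B C G G' \<beta> by fact
  show ?thesis
  proof (rule smnI, goal_cases)
    case (6 f)
    have "AMap G' (AMap F' f) \<cdot> NMap \<beta> (OMap F' (Dom A f)) \<cdot> AMap G (NMap \<alpha> (Dom A f)) =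
        (AMap G' (AMap F' f) \<cdot> NMap \<beta> (OMap F' (Dom A f))) \<cdot> AMap G (NMap \<alpha> (Dom A f))"
      using 6 by simp
    also have "\<dots> = NMap \<beta> (OMap F' (Cod A f)) \<cdot> AMap G (AMap F' f \<cdot>\<^bsub>B\<^esub> NMap \<alpha> (Dom A f))"
      using 6 \<beta>.NMap_nat[of "AMap F' f"] by simp
    also have "\<dots> = NMap \<beta> (OMap F' (Cod A f)) \<cdot> AMap G (NMap \<alpha> (Cod A f) \<cdot>\<^bsub>B\<^esub> AMap F f)"
      using 6 \<alpha>.NMap_nat[of f] by simp
    finally show ?case using 6 by simp
  next
    case (7 x y)
    let ?X = "OMap F x" and ?Y = "OMap F y" and ?X' = "OMap F' x" and ?Y' = "OMap F' y"
    note [simp] = 7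
    have "(NMap \<beta> (OMap F' (x \<boxplus>\<^bsub>A\<^esub> y)) \<cdot> AMap G (NMap \<alpha> (x \<boxplus>\<^bsub>A\<^esub> y))) \<cdot> AMap G (Mul F (x, y)) \<cdot> Mul G (?X, ?Y) =
      NMap \<beta> (OMap F' (x \<boxplus>\<^bsub>A\<^esub> y)) \<cdot> AMap G (NMap \<alpha> (x \<boxplus>\<^bsub>A\<^esub> y) \<cdot>\<^bsub>B\<^esub> Mul F (x, y)) \<cdot> Mul G (?X, ?Y)"
      by simp
    also have "\<dots> = NMap \<beta> (OMap F' (x \<boxplus>\<^bsub>A\<^esub> y)) \<cdot> AMap G (Mul F' (x, y)) \<cdot>
        AMap G (NMap \<alpha> x \<boxtimes>\<^bsub>B\<^esub> NMap \<alpha> y) \<cdot> Mul G (?X, ?Y)"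
      unfolding \<alpha>.NMap_Sum[OF 7] by simp
    also have "\<dots> = (NMap \<beta> (OMap F' (x \<boxplus>\<^bsub>A\<^esub> y)) \<cdot> AMap G (Mul F' (x, y))) \<cdot>
        (AMap G (NMap \<alpha> x \<boxtimes>\<^bsub>B\<^esub> NMap \<alpha> y) \<cdot> Mul G (?X, ?Y))"
      by simp
    also have "\<dots> = (AMap G' (Mul F' (x, y)) \<cdot> NMap \<beta> (?X' \<boxplus>\<^bsub>B\<^esub> ?Y')) \<cdot>
        (Mul G (?X', ?Y') \<cdot> (AMap G (NMap \<alpha> x) \<boxtimes> AMap G (NMap \<alpha> y)))"
      using \<beta>.NMap_nat[of "Mul F' (x, y)"] \<beta>.F.Mul_nat[of "NMap \<alpha> x" "NMap \<alpha> y"] by simp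
    also have "\<dots> = AMap G' (Mul F' (x, y)) \<cdot> (NMap \<beta> (?X' \<boxplus>\<^bsub>B\<^esub> ?Y') \<cdot> Mul G (?X', ?Y')) \<cdot>
        (AMap G (NMap \<alpha> x) \<boxtimes> AMap G (NMap \<alpha> y))"
      by simp
    also have "\<dots> = AMap G' (Mul F' (x, y)) \<cdot> (Mul G' (?X', ?Y') \<cdot> (NMap \<beta> ?X' \<boxtimes> NMap \<beta> ?Y')) \<cdot>
        (AMap G (NMap \<alpha> x) \<boxtimes> AMap G (NMap \<alpha> y))"
      by (subst \<beta>.NMap_Sum) auto
    finally show ?case by (simp add: \<beta>.F.C.interchange)
  next
    case 9 show ?case by (simp add: hcomp_smnat_def)
  qed (use \<alpha>.smf_src \<beta>.smf_tgt \<alpha>.smf_tgt \<beta>.smf_src in \<open>auto intro: comp_smf\<close>)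
qed

lemma invertible_smn:
  fixes C (structure)
  assumes "smn B C F G \<alpha>"
  shows "\<exists>\<beta>. smn B C G F \<beta> \<and> vcomp_smnat \<beta> \<alpha> = id_smnat F \<and> vcomp_smnat \<alpha> \<beta> = id_smnat G"
proof -
  interpret \<alpha>: smn B C F G \<alpha> by fact
  define \<beta> where "\<beta> = \<lparr>NSrc = G, NTgt = F, NMap = (\<lambda>x \<in> Obj B. inv_arr C (NMap \<alpha> x))\<rparr>"
  have \<beta>_simps [simp]: "NSrc \<beta> = G" "NTgt \<beta> = F" "x \<in> Obj B \<Longrightarrow> NMap \<beta> x = inv_arr C (NMap \<alpha> x)" for x
    by (simp_all add: \<beta>_def)
  have \<beta>: "smn B C G F \<beta>"
  proof (rule smnI, goal_cases)
    case (6 f)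
    have "AMap F f \<cdot> inv_arr C (NMap \<alpha> (Dom B f)) =
        inv_arr C (NMap \<alpha> (Cod B f)) \<cdot> (NMap \<alpha> (Cod B f) \<cdot> AMap F f) \<cdot> inv_arr C (NMap \<alpha> (Dom B f))"
      using 6 by simp
    also have "\<dots> = inv_arr C (NMap \<alpha> (Cod B f)) \<cdot> AMap G f"
      using 6 by (subst \<alpha>.NMap_nat[symmetric]) auto
    finally show ?case using 6 by simp
  next
    case (7 x y)
    let ?i = "inv_arr C (NMap \<alpha> x) \<boxtimes> inv_arr C (NMap \<alpha> y)"
    have "inv_arr C (NMap \<alpha> (x \<boxplus>\<^bsub>B\<^esub> y)) \<cdot> Mul G (x, y) =
        inv_arr C (NMap \<alpha> (x \<boxplus>\<^bsub>B\<^esub> y)) \<cdot> (Mul G (x, y) \<cdot> (NMap \<alpha> x \<boxtimes> NMap \<alpha> y)) \<cdot> ?i"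
      using 7 by (simp add: \<alpha>.F.C.interchange)
    also have "\<dots> = Mul F (x, y) \<cdot> ?i"
      using 7 by (subst \<alpha>.NMap_Sum[symmetric]) auto
    finally show ?case using 7 by simp
  next
    case 9 show ?case by (simp add: \<beta>_def)
  qed (use \<alpha>.smf_src \<alpha>.smf_tgt in auto)
  have "vcomp_smnat \<beta> \<alpha> = id_smnat F"
    by (rule smnat_eqI[OF vcomp_smn[OF assms \<beta>] id_smn[OF \<alpha>.smf_src]]) simp
  moreover have "vcomp_smnat \<alpha> \<beta> = id_smnat G"
    by (rule smnat_eqI[OF vcomp_smn[OF \<beta> assms] id_smn[OF \<alpha>.smf_tgt]]) simp
  ultimately show ?thesis using \<beta> by blast
qed

section \<open>Evaluation and lifting along it\<close>

definition evaluation :: "('u::infinite, 'u) smc \<Rightarrow> ('u, 'u) smfun" where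
  "evaluation C = \<lparr>OMap = (\<lambda>a \<in> vobjs C. val C a), AMap = (\<lambda>t \<in> Arr (strictify C). amap t),
     Src = strictify C, Tgt = C, Mul = (\<lambda>(a, b) \<in> vobjs C \<times> vobjs C. collect C a b)\<rparr>"

text \<open>
  The functor over \<open>H\<close> that acts on objects by \<open>m\<close>, where \<open>m x\<close> is an object with value \<open>H x\<close>. Since
  \<open>vsum (m x) (m y)\<close> and \<open>m (x \<boxplus> y)\<close> have isomorphic values, the structure maps absorb any failure
  of \<open>m\<close> to preserve sums.
\<close>

definition lift :: "('u::infinite, 'u) smfun \<Rightarrow> ('u \<Rightarrow> 'u) \<Rightarrow> ('u, 'u) smfun" where
  "lift H m = \<lparr>OMap = (\<lambda>x \<in> Obj (Src H). m x),
     AMap = (\<lambda>f \<in> Arr (Src H). arr (m (Dom (Src H) f)) (AMap H f) (m (Cod (Src H) f))),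
     Src = Src H, Tgt = strictify (Tgt H),
     Mul = (\<lambda>(x, y) \<in> Obj (Src H) \<times> Obj (Src H).
       arr (vsum (Tgt H) (m x) (m y))
         (Mul H (x, y) \<cdot>\<^bsub>Tgt H\<^esub> inv_arr (Tgt H) (collect (Tgt H) (m x) (m y)))
         (m (x \<boxplus>\<^bsub>Src H\<^esub> y)))\<rparr>"

lemma evaluation_simps [simp]:
  "Src (evaluation C) = strictify C" "Tgt (evaluation C) = C"
  "a \<in> vobjs C \<Longrightarrow> OMap (evaluation C) a = val C a"
  "t \<in> Arr (strictify C) \<Longrightarrow> AMap (evaluation C) t = amap t"
  "a \<in> vobjs C \<Longrightarrow> b \<in> vobjs C \<Longrightarrow> Mul (evaluation C) (a, b) = collect C a b"
  by (simp_all add: evaluation_def)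

lemma lift_simps [simp]:
  "Src (lift H m) = Src H" "Tgt (lift H m) = strictify (Tgt H)"
  "x \<in> Obj (Src H) \<Longrightarrow> OMap (lift H m) x = m x"
  "f \<in> Arr (Src H) \<Longrightarrow> AMap (lift H m) f = arr (m (Dom (Src H) f)) (AMap H f) (m (Cod (Src H) f))"
  "x \<in> Obj (Src H) \<Longrightarrow> y \<in> Obj (Src H) \<Longrightarrow> Mul (lift H m) (x, y) =
     arr (vsum (Tgt H) (m x) (m y))
       (Mul H (x, y) \<cdot>\<^bsub>Tgt H\<^esub> inv_arr (Tgt H) (collect (Tgt H) (m x) (m y)))
       (m (x \<boxplus>\<^bsub>Src H\<^esub> y))"
  by (simp_all add: lift_def)

context small_symmetric_monoidal_category
begin

lemma symmetric_monoidal_strictify: "symmetric_monoidal_category (strictify C)"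
  using permutative_strictify by (rule permutative_category.axioms)

lemma invertible_arr:
  assumes "a \<in> vobjs C" "b \<in> vobjs C" "f \<in> Arr C" "Dom C f = val C a" "Cod C f = val C b" "invertible C f"
  shows "invertible (strictify C) (arr a f b)"
  using arr_in_Iso_strictify[OF assms] by (simp add: Iso_iff)

lemma smf_evaluation: "smf (strictify C) C (evaluation C)"
proof (rule smfI, goal_cases)
  case (6 t)
  then show ?case by (auto elim!: strictify_ArrE)
next
  case (8 s t)
  then show ?case by (auto elim!: strictify_ArrE)
next
  case (10 s t)
  then show ?case by (auto elim!: strictify_ArrE)
next
  case (11 x y z)
  then show ?case using collect_assoc[of x y z] by (simp add: vsum_assoc)
next
  case 16 show ?case by (simp add: evaluation_def)
next
  case 17 show ?case by (simp add: evaluation_def)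
next
  case 18 show ?case by (simp add: evaluation_def)
qed (auto simp: symmetric_monoidal_strictify symmetric_monoidal_category_axioms)

lemma smf_lift:
  assumes H: "smf B C H" and m: "\<And>x. x \<in> Obj B \<Longrightarrow> m x \<in> vobjs C \<and> val C (m x) = OMap H x" "m (Unt B) = vunit"
  shows "smf B (strictify C) (lift H m)"
proof -
  interpret H: smf B C H by fact
  note [simp] = m
  show ?thesis
  proof (rule smfI, goal_cases)
    case (9 x y)
    then show ?case by (auto intro!: invertible_arr)
  next
    case (10 f g)
    then show ?case
      using H.Mul_nat_Cmp[of f g "inv_arr C (collect C (m (Dom B f)) (m (Dom B g)))"] by simp
  next
    case (11 x y z)
    let ?X = "OMap H x" and ?Y = "OMap H y" and ?Z = "OMap H z"
    let ?i = "\<lambda>a b. inv_arr C (collect C a b)"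
    note [simp] = 11 vsum_assoc
    have "AMap H (Asc B x y z) \<cdot> Mul H (x \<boxplus>\<^bsub>B\<^esub> y, z) \<cdot>
        (((Mul H (x, y) \<cdot> ?i (m x) (m y)) \<boxtimes> (Idt C ?Z \<cdot> Idt C ?Z)) \<cdot> ?i (vsum C (m x) (m y)) (m z)) =
      (AMap H (Asc B x y z) \<cdot> Mul H (x \<boxplus>\<^bsub>B\<^esub> y, z) \<cdot> (Mul H (x, y) \<boxtimes> Idt C ?Z)) \<cdot>
        (?i (m x) (m y) \<boxtimes> Idt C ?Z) \<cdot> ?i (vsum C (m x) (m y)) (m z)"
      by (subst interchange[symmetric]) auto
    also have "\<dots> = Mul H (x, y \<boxplus>\<^bsub>B\<^esub> z) \<cdot> (Idt C ?X \<boxtimes> Mul H (y, z)) \<cdot>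
        (Asc C ?X ?Y ?Z \<cdot> (?i (m x) (m y) \<boxtimes> Idt C ?Z) \<cdot> ?i (vsum C (m x) (m y)) (m z))"
      unfolding H.Mul_Asc[OF 11] by simp
    also have "\<dots> = Mul H (x, y \<boxplus>\<^bsub>B\<^esub> z) \<cdot> (Idt C ?X \<boxtimes> Mul H (y, z)) \<cdot>
        (Idt C ?X \<boxtimes> ?i (m y) (m z)) \<cdot> ?i (m x) (vsum C (m y) (m z))"
      using collect_assoc_inv[of "m x" "m y" "m z"] by simp
    also have "\<dots> = Mul H (x, y \<boxplus>\<^bsub>B\<^esub> z) \<cdot> (Idt C ?X \<boxtimes> (Mul H (y, z) \<cdot> ?i (m y) (m z))) \<cdot>
        ?i (m x) (vsum C (m y) (m z))"
      by (simp add: interchange_left)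
    finally show ?case by simp
  next
    case (12 x y)
    then have "(AMap H (Brd B x y) \<cdot> Mul H (x, y)) \<cdot> inv_arr C (collect C (m x) (m y)) =
        Mul H (y, x) \<cdot> Brd C (OMap H x) (OMap H y) \<cdot> inv_arr C (collect C (m x) (m y))"
      unfolding H.Mul_Brd[OF 12] by simp
    then show ?case using 12 by simp
  next
    case (14 x)
    then have "(AMap H (Lun B x) \<cdot> Mul H (Unt B, x)) \<cdot> inv_arr C (Lun C (OMap H x)) = Idt C (OMap H x)"
      unfolding H.Mul_Lun[OF 14] by simp
    then show ?case using 14 by simp
  next
    case (15 x)
    then have "(AMap H (Run B x) \<cdot> Mul H (x, Unt B)) \<cdot> inv_arr C (Run C (OMap H x)) = Idt C (OMap H x)"
      unfolding H.Mul_Run[OF 15] by simp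
    then show ?case using 15 by simp
  next
    case 16 show ?case by (simp add: lift_def)
  next
    case 17 show ?case by (simp add: lift_def)
  next
    case 18 show ?case by (simp add: lift_def)
  qed (auto simp: symmetric_monoidal_strictify H.B.symmetric_monoidal_category_axioms)
qed

lemma evaluation_lift:
  assumes H: "smf B C H" and m: "\<And>x. x \<in> Obj B \<Longrightarrow> m x \<in> vobjs C \<and> val C (m x) = OMap H x" "m (Unt B) = vunit"
  shows "comp_smfun (evaluation C) (lift H m) = H"
proof -
  interpret H: smf B C H by fact
  show ?thesis
    by (rule smfun_eqI[OF comp_smf[OF smf_lift[OF assms] smf_evaluation] H]) (simp_all add: m)
qed

text \<open>
  Evaluation is faithful on arrows with given ends, and its structure maps \<open>collect\<close> are invertible.
\<close>

lemma lift_unique: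
  assumes L: "smf B (strictify C) L" and L': "smf B (strictify C) L'"
    and O: "\<And>x. x \<in> Obj B \<Longrightarrow> OMap L x = OMap L' x"
    and eq: "comp_smfun (evaluation C) L = comp_smfun (evaluation C) L'"
  shows "L = L'"
proof (rule smfun_eqI[OF L L' O])
  interpret L: smf B "strictify C" L by fact
  interpret L': smf B "strictify C" L' by fact
  have arr_eqI: "s = t" if "s \<in> Arr (strictify C)" "t \<in> Arr (strictify C)" "asrc s = asrc t" "atgt s = atgt t"
    "amap s = amap t" for s t
    using that by (auto elim!: strictify_ArrE)
  show "AMap L f = AMap L' f" if "f \<in> Arr B" for f
  proof (rule arr_eqI)
    show "amap (AMap L f) = amap (AMap L' f)"
      using arg_cong[OF eq, of "\<lambda>F. AMap F f"] that by simp
  qed (use that L.AMap_arrow[of f] L'.AMap_arrow[of f] in \<open>simp_all add: O\<close>)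
  show "Mul L (x, y) = Mul L' (x, y)" if xy: "x \<in> Obj B" "y \<in> Obj B" for x y
  proof (rule arr_eqI)
    have v: "OMap L' x \<in> vobjs C" "OMap L' y \<in> vobjs C"
      using xy L'.OMap_in[of x] L'.OMap_in[of y] by simp_all
    have M: "Mul L (x, y) \<in> Arr (strictify C)" "Mul L' (x, y) \<in> Arr (strictify C)"
      using xy by simp_all
    note M' = L.Mul_arrow[OF xy] L'.Mul_arrow[OF xy]
    have "amap (Mul L (x, y)) \<cdot> collect C (OMap L' x) (OMap L' y) =
        amap (Mul L' (x, y)) \<cdot> collect C (OMap L' x) (OMap L' y)"
      using arg_cong[OF eq, of "\<lambda>F. Mul F (x, y)"] xy v M by (simp add: O)
    then show "amap (Mul L (x, y)) = amap (Mul L' (x, y))"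
      using M M' v xy by (elim cancel_right strictify_ArrE) (auto simp: O)
  qed (use xy L.Mul_arrow[OF xy] L'.Mul_arrow[OF xy] in \<open>simp_all add: O\<close>)
qed

text \<open>
  Evaluation is fully faithful, so the components of \<open>\<beta>\<close> are those of \<open>\<alpha>\<close> with other ends. They are
  monoidal because the structure maps of \<open>ev \<circ> L\<close> and \<open>ev \<circ> L'\<close> differ from those of \<open>L\<close> and \<open>L'\<close>
  by comparisons, which cancel.
\<close>

lemma lift_smn:
  assumes L: "smf B (strictify C) L" and L': "smf B (strictify C) L'"
    and \<alpha>: "smn B C (comp_smfun (evaluation C) L) (comp_smfun (evaluation C) L') \<alpha>"
  shows "\<exists>!\<beta>. smn B (strictify C) L L' \<beta> \<and> hcomp_smnat (id_smnat (evaluation C)) \<beta> = \<alpha>"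
proof -
  interpret L: smf B "strictify C" L by fact
  interpret L': smf B "strictify C" L' by fact
  interpret \<alpha>: smn B C "comp_smfun (evaluation C) L" "comp_smfun (evaluation C) L'" \<alpha> by fact
  have v [simp]: "OMap L x \<in> vobjs C" "OMap L' x \<in> vobjs C" if "x \<in> Obj B" for x
    using that L.OMap_in[of x] L'.OMap_in[of x] by simp_all
  define \<beta> where "\<beta> = \<lparr>NSrc = L, NTgt = L', NMap = (\<lambda>x \<in> Obj B. arr (OMap L x) (NMap \<alpha> x) (OMap L' x))\<rparr>"
  have [simp]: "NSrc \<beta> = L" "NTgt \<beta> = L'" "x \<in> Obj B \<Longrightarrow> NMap \<beta> x = arr (OMap L x) (NMap \<alpha> x) (OMap L' x)" for x
    by (simp_all add: \<beta>_def)
  have arrow: "\<exists>f. t = arr a f b \<and> f \<in> Arr C \<and> Dom C f = val C a \<and> Cod C f = val C b"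
    if "t \<in> Arr (strictify C) \<and> asrc t = a \<and> atgt t = b" for t a b
    using that by (auto elim!: strictify_ArrE)
  have LM: "\<exists>f. Mul K (x, y) = arr (vsum C (OMap K x) (OMap K y)) f (OMap K (x \<boxplus>\<^bsub>B\<^esub> y)) \<and> f \<in> Arr C \<and>
      Dom C f = val C (vsum C (OMap K x) (OMap K y)) \<and> Cod C f = val C (OMap K (x \<boxplus>\<^bsub>B\<^esub> y))"
    if "K = L \<or> K = L'" "x \<in> Obj B" "y \<in> Obj B" for K x y
    using that L.Mul_arrow[of x y] L'.Mul_arrow[of x y] by (intro arrow) auto
  have a [simp]: "Dom C (NMap \<alpha> x) = val C (OMap L x)" "Cod C (NMap \<alpha> x) = val C (OMap L' x)" if "x \<in> Obj B" for x
    using that \<alpha>.NMap_arrow[of x] by simp_all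
  have \<beta>: "smn B (strictify C) L L' \<beta>"
  proof (rule smnI, goal_cases)
    case (5 x)
    then show ?case by (auto intro!: invertible_arr)
  next
    case (6 f)
    have "\<exists>f'. AMap K f = arr (OMap K (Dom B f)) f' (OMap K (Cod B f)) \<and> f' \<in> Arr C \<and>
        Dom C f' = val C (OMap K (Dom B f)) \<and> Cod C f' = val C (OMap K (Cod B f))" if "K = L \<or> K = L'" for K
      using 6 that L.AMap_arrow[of f] L'.AMap_arrow[of f] by (intro arrow) auto
    from this[of L] this[of L'] show ?case using 6 \<alpha>.NMap_nat[of f] L.AMap_arrow[of f] L'.AMap_arrow[of f] by auto
  next
    case (7 x y)
    let ?c = "collect C (OMap L x) (OMap L y)" and ?c' = "collect C (OMap L' x) (OMap L' y)"
    obtain m where m: "Mul L (x, y) = arr (vsum C (OMap L x) (OMap L y)) m (OMap L (x \<boxplus>\<^bsub>B\<^esub> y))"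
      "m \<in> Arr C" "Dom C m = val C (vsum C (OMap L x) (OMap L y))" "Cod C m = val C (OMap L (x \<boxplus>\<^bsub>B\<^esub> y))"
      using LM[of L, OF _ 7] by blast
    obtain m' where m': "Mul L' (x, y) = arr (vsum C (OMap L' x) (OMap L' y)) m' (OMap L' (x \<boxplus>\<^bsub>B\<^esub> y))"
      "m' \<in> Arr C" "Dom C m' = val C (vsum C (OMap L' x) (OMap L' y))" "Cod C m' = val C (OMap L' (x \<boxplus>\<^bsub>B\<^esub> y))"
      using LM[of L', OF _ 7] by blast
    note [simp] = 7 m m'
    have "(NMap \<alpha> (x \<boxplus>\<^bsub>B\<^esub> y) \<cdot> m) \<cdot> ?c = (m' \<cdot> ?c' \<cdot> (NMap \<alpha> x \<boxtimes> NMap \<alpha> y) \<cdot> inv_arr C ?c) \<cdot> ?c"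
      using \<alpha>.NMap_Sum[of x y] by simp
    then have "NMap \<alpha> (x \<boxplus>\<^bsub>B\<^esub> y) \<cdot> m = m' \<cdot> ?c' \<cdot> (NMap \<alpha> x \<boxtimes> NMap \<alpha> y) \<cdot> inv_arr C ?c"
      by (rule cancel_right) auto
    then show ?case by simp
  next
    case 9 show ?case by (simp add: \<beta>_def)
  qed (use L L' in auto)
  have ev: "smn (strictify C) C (evaluation C) (evaluation C) (id_smnat (evaluation C))"
    by (rule id_smn[OF smf_evaluation])
  have h: "NMap (hcomp_smnat (id_smnat (evaluation C)) \<gamma>) x = amap (NMap \<gamma> x)"
    if \<gamma>: "smn B (strictify C) L L' \<gamma>" and x: "x \<in> Obj B" for \<gamma> x
  proof -
    interpret \<gamma>: smn B "strictify C" L L' \<gamma> by fact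
    obtain f where "NMap \<gamma> x = arr (OMap L x) f (OMap L' x)" "f \<in> Arr C" "Cod C f = val C (OMap L' x)"
      using \<gamma>.NMap_arrow[OF x] by (auto elim!: strictify_ArrE)
    then show ?thesis using x \<gamma>.NMap_arrow[OF x] by simp
  qed
  show ?thesis
  proof (rule ex1I[of _ \<beta>])
    show "smn B (strictify C) L L' \<beta> \<and> hcomp_smnat (id_smnat (evaluation C)) \<beta> = \<alpha>"
      by (auto intro!: \<beta> smnat_eqI[OF hcomp_smn[OF \<beta> ev] \<alpha>] simp: h)
  next
    fix \<gamma> assume "smn B (strictify C) L L' \<gamma> \<and> hcomp_smnat (id_smnat (evaluation C)) \<gamma> = \<alpha>"
    then have \<gamma>: "smn B (strictify C) L L' \<gamma>" and eq: "hcomp_smnat (id_smnat (evaluation C)) \<gamma> = \<alpha>" by auto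
    interpret \<gamma>: smn B "strictify C" L L' \<gamma> by fact
    show "\<gamma> = \<beta>"
    proof (rule smnat_eqI[OF \<gamma> \<beta>])
      fix x assume x: "x \<in> Obj B"
      obtain f where "NMap \<gamma> x = arr (OMap L x) f (OMap L' x)"
        using \<gamma>.NMap_arrow[OF x] by (auto elim!: strictify_ArrE)
      then show "NMap \<gamma> x = NMap \<beta> x"
        using x h[OF \<gamma> x] by (simp add: eq)
    qed
  qed
qed

end

section \<open>Strictification is a 2-functor with a strictly natural evaluation\<close>

text \<open>
  Only values are changed. This is functorial in \<open>F\<close> and commutes with evaluation strictly; mapping the
  letters of a label would not make the new label evaluate to \<open>F c\<close>.
\<close>

definition relabel :: "('u::infinite, 'u) smfun \<Rightarrow> 'u \<Rightarrow> 'u" where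
  "relabel F a = (case decode a of VUnit \<Rightarrow> vunit | VObj c xs x \<Rightarrow> code (VObj (OMap F c) xs x))"

definition strictify_functor :: "('u::infinite, 'u) smfun \<Rightarrow> ('u, 'u) smfun" where
  "strictify_functor F = lift (comp_smfun F (evaluation (Src F))) (relabel F)"

text \<open>
  The unit of \<open>C\<close> must go to the new unit, as functors are strictly unital. Every other object is
  sent to a pair that has it as its value.
\<close>

definition inclusion :: "('u::infinite, 'u) smc \<Rightarrow> ('u, 'u) smfun" where
  "inclusion C = lift (id_smfun C) (\<lambda>x. if x = Unt C then vunit else code (VObj x [] x))"

lemma relabel_simps [simp]:
  "relabel F vunit = vunit" "relabel F (code (VObj c xs x)) = code (VObj (OMap F c) xs x)"
  by (simp_all add: relabel_def vunit_def)

lemma relabel_in: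
  fixes B C :: "('u::infinite, 'u) smc"
  assumes "smf B C F" "a \<in> vobjs B"
  shows "relabel F a \<in> vobjs C" "val C (relabel F a) = OMap F (val B a)"
proof -
  interpret smf B C F by fact
  show "relabel F a \<in> vobjs C" "val C (relabel F a) = OMap F (val B a)"
    using assms(2) by (cases rule: vobjs_cases; simp)+
qed

context
  fixes B C :: "('u::infinite, 'u) smc" and F :: "('u, 'u) smfun"
  assumes F: "smf B C F"
begin

interpretation F: smf B C F by (fact F)
interpretation B: small_symmetric_monoidal_category B by unfold_locales
interpretation C: small_symmetric_monoidal_category C by unfold_locales

lemma relabel_lifts:
  shows "smf (strictify B) C (comp_smfun F (evaluation B))"
    and "a \<in> Obj (strictify B) \<Longrightarrow> relabel F a \<in> vobjs C \<and> val C (relabel F a) = OMap (comp_smfun F (evaluation B)) a"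
    and "relabel F (Unt (strictify B)) = vunit"
  using F B.smf_evaluation relabel_in[OF F] by (auto intro: comp_smf)

lemma smf_strictify_functor: "smf (strictify B) (strictify C) (strictify_functor F)"
  using C.smf_lift[OF relabel_lifts] by (simp add: strictify_functor_def)

lemma evaluation_natural: "comp_smfun (evaluation C) (strictify_functor F) = comp_smfun F (evaluation B)"
  using C.evaluation_lift[OF relabel_lifts] by (simp add: strictify_functor_def)

lemma OMap_strictify_functor: "a \<in> vobjs B \<Longrightarrow> OMap (strictify_functor F) a = relabel F a"
  by (simp add: strictify_functor_def)

end

lemma strictify_functor_id:
  assumes "symmetric_monoidal_category C"
  shows "strictify_functor (id_smfun C) = id_smfun (strictify C)"
proof -
  interpret C: symmetric_monoidal_category C by fact
  interpret C: small_symmetric_monoidal_category C by unfold_locales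
  have id: "smf C C (id_smfun C)" "smf (strictify C) (strictify C) (id_smfun (strictify C))"
    using assms C.symmetric_monoidal_strictify by (auto intro: id_smf)
  show ?thesis
  proof (rule C.lift_unique[OF smf_strictify_functor[OF id(1)] id(2)])
    show "OMap (strictify_functor (id_smfun C)) x = OMap (id_smfun (strictify C)) x" if "x \<in> Obj (strictify C)" for x
      using that OMap_strictify_functor[OF id(1), of x] by (auto elim: vobjs_cases)
    show "comp_smfun (evaluation C) (strictify_functor (id_smfun C)) =
        comp_smfun (evaluation C) (id_smfun (strictify C))"
      using comp_id_smfun[OF C.smf_evaluation] by (simp add: evaluation_natural[OF id(1)])
  qed
qed

lemma strictify_functor_comp:
  assumes F: "smf A B F" and G: "smf B C G"
  shows "strictify_functor (comp_smfun G F) = comp_smfun (strictify_functor G) (strictify_functor F)"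
proof -
  interpret F: smf A B F by fact
  interpret G: smf B C G by fact
  interpret A: small_symmetric_monoidal_category A by unfold_locales
  interpret B: small_symmetric_monoidal_category B by unfold_locales
  interpret C: small_symmetric_monoidal_category C by unfold_locales
  note GF = comp_smf[OF F G]
  note sF = smf_strictify_functor[OF F] and sG = smf_strictify_functor[OF G]
  show ?thesis
  proof (rule C.lift_unique[OF smf_strictify_functor[OF GF] comp_smf[OF sF sG]])
    fix a assume "a \<in> Obj (strictify A)"
    then have a: "a \<in> vobjs A" by simp
    interpret sF: smf "strictify A" "strictify B" "strictify_functor F" by (rule sF)
    have "relabel (comp_smfun G F) a = relabel G (relabel F a)"
      using a by (cases rule: vobjs_cases) simp_all
    then show "OMap (strictify_functor (comp_smfun G F)) a =
        OMap (comp_smfun (strictify_functor G) (strictify_functor F)) a"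
      using a relabel_in[OF F a] by (simp add: OMap_strictify_functor[OF GF] OMap_strictify_functor[OF F] OMap_strictify_functor[OF G])
  next
    have "comp_smfun (evaluation C) (comp_smfun (strictify_functor G) (strictify_functor F)) =
        comp_smfun (comp_smfun (evaluation C) (strictify_functor G)) (strictify_functor F)"
      by (rule comp_smfun_assoc[OF sF sG C.smf_evaluation, symmetric])
    also have "\<dots> = comp_smfun G (comp_smfun (evaluation B) (strictify_functor F))"
      unfolding evaluation_natural[OF G] by (rule comp_smfun_assoc[OF sF B.smf_evaluation G])
    also have "\<dots> = comp_smfun (comp_smfun G F) (evaluation A)"
      unfolding evaluation_natural[OF F] by (rule comp_smfun_assoc[OF A.smf_evaluation F G, symmetric])
    finally show "comp_smfun (evaluation C) (strictify_functor (comp_smfun G F)) =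
        comp_smfun (evaluation C) (comp_smfun (strictify_functor G) (strictify_functor F))"
      by (simp add: evaluation_natural[OF GF])
  qed
qed

context small_symmetric_monoidal_category
begin

lemma inclusion_lifts:
  shows "smf C C (id_smfun C)"
    and "x \<in> Obj C \<Longrightarrow> (if x = Unt C then vunit else code (VObj x [] x)) \<in> vobjs C \<and>
      val C (if x = Unt C then vunit else code (VObj x [] x)) = OMap (id_smfun C) x"
    and "(if Unt C = Unt C then vunit else code (VObj (Unt C) [] (Unt C))) = vunit"
  by (auto intro: id_smf symmetric_monoidal_category_axioms)

lemma smf_inclusion: "smf C (strictify C) (inclusion C)"
  unfolding inclusion_def by (rule smf_lift[OF inclusion_lifts])

lemma evaluation_inclusion: "comp_smfun (evaluation C) (inclusion C) = id_smfun C"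
  unfolding inclusion_def by (rule evaluation_lift[OF inclusion_lifts])

lemma categorical_equivalence_evaluation: "categorical_equivalence (strictify C) C (evaluation C)"
proof -
  interpret E: smf "strictify C" C "evaluation C" by (rule smf_evaluation)
  interpret I: smf C "strictify C" "inclusion C" by (rule smf_inclusion)
  have IE [simp]: "x \<in> Obj C \<Longrightarrow> val C (OMap (inclusion C) x) = x" for x
    by (simp add: inclusion_def)
  have I [simp]: "x \<in> Obj C \<Longrightarrow> OMap (inclusion C) x \<in> vobjs C" for x
    using I.OMap_in by simp
  have IA [simp]: "f \<in> Arr C \<Longrightarrow> AMap (inclusion C) f = arr (OMap (inclusion C) (Dom C f)) f (OMap (inclusion C) (Cod C f))" for f
    by (simp add: inclusion_def)
  let ?H = "\<lparr>OMap = OMap (inclusion C), AMap = AMap (inclusion C)\<rparr>"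
  have H: "cat_functor C (strictify C) ?H"
    by unfold_locales (auto simp: Hom_iff)
  have "natural_isomorphism (strictify C) (strictify C) (comp_functor ?H (evaluation C)) identity_functor
      (\<lambda>a. arr (OMap (inclusion C) (val C a)) (Idt C (val C a)) a)"
    by unfold_locales
      (auto simp: comp_functor_def identity_functor_def Hom_iff intro!: arr_in_Iso_strictify elim!: strictify_ArrE)
  moreover have "natural_isomorphism C C (comp_functor (evaluation C) ?H) identity_functor (Idt C)"
    by unfold_locales (auto simp: comp_functor_def identity_functor_def Hom_iff Iso_iff)
  ultimately show ?thesis
    unfolding categorical_equivalence_def using E.cat_functor_axioms H by blast
qed

end



section \<open>Pseudo-functors into strict (2,1)-categories\<close>

text \<open>
  As for categories, boundaries of cells are computed by rewriting. Identity 2-cells of composites are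
  rewritten as horizontal composites of identity 2-cells. Thus every pasting diagram becomes a vertical
  composite of horizontal ones, both nested to the right, once whiskering is distributed.
\<close>

locale two_dimensional_cells =
  fixes D :: "('o, 'f, 'a, 'z) twocat_scheme" (structure)
  assumes Src1_in [simp]: "f \<in> Cell1 D \<Longrightarrow> Src1 D f \<in> Cell0 D"
    and Tgt1_in [simp]: "f \<in> Cell1 D \<Longrightarrow> Tgt1 D f \<in> Cell0 D"
    and Src2_in [simp]: "\<alpha> \<in> Cell2 D \<Longrightarrow> Src2 D \<alpha> \<in> Cell1 D"
    and Tgt2_in [simp]: "\<alpha> \<in> Cell2 D \<Longrightarrow> Tgt2 D \<alpha> \<in> Cell1 D"
    and Src1_Tgt2 [simp]: "\<alpha> \<in> Cell2 D \<Longrightarrow> Src1 D (Tgt2 D \<alpha>) = Src1 D (Src2 D \<alpha>)"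
    and Tgt1_Tgt2 [simp]: "\<alpha> \<in> Cell2 D \<Longrightarrow> Tgt1 D (Tgt2 D \<alpha>) = Tgt1 D (Src2 D \<alpha>)"
    and Id1_cell [simp]: "x \<in> Cell0 D \<Longrightarrow> Id1 D x \<in> Cell1 D \<and> Src1 D (Id1 D x) = x \<and> Tgt1 D (Id1 D x) = x"
    and Comp1_cell [simp]: "f \<in> Cell1 D \<Longrightarrow> g \<in> Cell1 D \<Longrightarrow> Src1 D g = Tgt1 D f \<Longrightarrow>
      g \<star> f \<in> Cell1 D \<and> Src1 D (g \<star> f) = Src1 D f \<and> Tgt1 D (g \<star> f) = Tgt1 D g"
    and Id2_cell [simp]: "f \<in> Cell1 D \<Longrightarrow> Id2 D f \<in> Cell2 D \<and> Src2 D (Id2 D f) = f \<and> Tgt2 D (Id2 D f) = f"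
    and VComp_cell [simp]: "\<alpha> \<in> Cell2 D \<Longrightarrow> \<beta> \<in> Cell2 D \<Longrightarrow> Src2 D \<beta> = Tgt2 D \<alpha> \<Longrightarrow>
      \<beta> \<bullet> \<alpha> \<in> Cell2 D \<and> Src2 D (\<beta> \<bullet> \<alpha>) = Src2 D \<alpha> \<and> Tgt2 D (\<beta> \<bullet> \<alpha>) = Tgt2 D \<beta>"
    and HComp_cell [simp]: "\<alpha> \<in> Cell2 D \<Longrightarrow> \<beta> \<in> Cell2 D \<Longrightarrow> Src1 D (Src2 D \<beta>) = Tgt1 D (Src2 D \<alpha>) \<Longrightarrow>
      \<beta> \<diamondop> \<alpha> \<in> Cell2 D \<and> Src2 D (\<beta> \<diamondop> \<alpha>) = Src2 D \<beta> \<star> Src2 D \<alpha> \<and> Tgt2 D (\<beta> \<diamondop> \<alpha>) = Tgt2 D \<beta> \<star> Tgt2 D \<alpha>"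

locale strict_21_category = two_dimensional_cells D
  for D :: "('p, 'g, 'b, 'y) twocat_scheme" (structure) +
  assumes Comp1_assoc [simp]: "f \<in> Cell1 D \<Longrightarrow> g \<in> Cell1 D \<Longrightarrow> h \<in> Cell1 D \<Longrightarrow> Src1 D g = Tgt1 D f \<Longrightarrow>
      Src1 D h = Tgt1 D g \<Longrightarrow> (h \<star> g) \<star> f = h \<star> g \<star> f"
    and Comp1_Id1_left [simp]: "f \<in> Cell1 D \<Longrightarrow> Tgt1 D f = y \<Longrightarrow> Id1 D y \<star> f = f"
    and Comp1_Id1_right [simp]: "f \<in> Cell1 D \<Longrightarrow> Src1 D f = x \<Longrightarrow> f \<star> Id1 D x = f"
    and VComp_assoc [simp]: "\<alpha> \<in> Cell2 D \<Longrightarrow> \<beta> \<in> Cell2 D \<Longrightarrow> \<gamma> \<in> Cell2 D \<Longrightarrow> Src2 D \<beta> = Tgt2 D \<alpha> \<Longrightarrow>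
      Src2 D \<gamma> = Tgt2 D \<beta> \<Longrightarrow> (\<gamma> \<bullet> \<beta>) \<bullet> \<alpha> = \<gamma> \<bullet> \<beta> \<bullet> \<alpha>"
    and VComp_Id2_left: "\<alpha> \<in> Cell2 D \<Longrightarrow> Id2 D (Tgt2 D \<alpha>) \<bullet> \<alpha> = \<alpha>"
    and VComp_Id2_right: "\<alpha> \<in> Cell2 D \<Longrightarrow> \<alpha> \<bullet> Id2 D (Src2 D \<alpha>) = \<alpha>"
    and HComp_assoc [simp]: "\<alpha> \<in> Cell2 D \<Longrightarrow> \<beta> \<in> Cell2 D \<Longrightarrow> \<gamma> \<in> Cell2 D \<Longrightarrow>
      Src1 D (Src2 D \<beta>) = Tgt1 D (Src2 D \<alpha>) \<Longrightarrow> Src1 D (Src2 D \<gamma>) = Tgt1 D (Src2 D \<beta>) \<Longrightarrow>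
      (\<gamma> \<diamondop> \<beta>) \<diamondop> \<alpha> = \<gamma> \<diamondop> \<beta> \<diamondop> \<alpha>"
    and HComp_Id1_left [simp]: "\<alpha> \<in> Cell2 D \<Longrightarrow> Tgt1 D (Src2 D \<alpha>) = y \<Longrightarrow> Id2 D (Id1 D y) \<diamondop> \<alpha> = \<alpha>"
    and HComp_Id1_right [simp]: "\<alpha> \<in> Cell2 D \<Longrightarrow> Src1 D (Src2 D \<alpha>) = x \<Longrightarrow> \<alpha> \<diamondop> Id2 D (Id1 D x) = \<alpha>"
    and Id2_Comp1 [simp]: "f \<in> Cell1 D \<Longrightarrow> g \<in> Cell1 D \<Longrightarrow> Src1 D g = Tgt1 D f \<Longrightarrow>
      Id2 D (g \<star> f) = Id2 D g \<diamondop> Id2 D f"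
    and interchange: "\<alpha> \<in> Cell2 D \<Longrightarrow> \<alpha>' \<in> Cell2 D \<Longrightarrow> \<beta> \<in> Cell2 D \<Longrightarrow> \<beta>' \<in> Cell2 D \<Longrightarrow>
      Src2 D \<alpha>' = Tgt2 D \<alpha> \<Longrightarrow> Src2 D \<beta>' = Tgt2 D \<beta> \<Longrightarrow> Src1 D (Src2 D \<beta>) = Tgt1 D (Src2 D \<alpha>) \<Longrightarrow>
      (\<beta>' \<bullet> \<beta>) \<diamondop> (\<alpha>' \<bullet> \<alpha>) = (\<beta>' \<diamondop> \<alpha>') \<bullet> (\<beta> \<diamondop> \<alpha>)"
    and invertible_cell: "\<alpha> \<in> Cell2 D \<Longrightarrow> \<exists>\<beta>. \<beta> \<in> Cell2 D \<and> Src2 D \<beta> = Tgt2 D \<alpha> \<and> Tgt2 D \<beta> = Src2 D \<alpha> \<and>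
      \<beta> \<bullet> \<alpha> = Id2 D (Src2 D \<alpha>) \<and> \<alpha> \<bullet> \<beta> = Id2 D (Tgt2 D \<alpha>)"
begin

text \<open>
  In the normal form above an identity 2-cell is a horizontal composite of identities. This predicate
  recognises it syntactically, which keeps the unit and whiskering laws usable for rewriting.
\<close>

definition identity_cell :: "'b \<Rightarrow> bool" where
  "identity_cell \<alpha> \<longleftrightarrow> (\<exists>f \<in> Cell1 D. \<alpha> = Id2 D f)"

lemma identity_cell_Id2 [simp]: "f \<in> Cell1 D \<Longrightarrow> identity_cell (Id2 D f)"
  by (auto simp: identity_cell_def)

lemma identity_cell_HComp [simp]:
  assumes "identity_cell \<alpha>" "identity_cell \<beta>" "Src1 D (Src2 D \<beta>) = Tgt1 D (Src2 D \<alpha>)"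
  shows "identity_cell (\<beta> \<diamondop> \<alpha>)"
proof -
  obtain f g where fg: "f \<in> Cell1 D" "\<alpha> = Id2 D f" "g \<in> Cell1 D" "\<beta> = Id2 D g"
    using assms by (auto simp: identity_cell_def)
  then have "\<beta> \<diamondop> \<alpha> = Id2 D (g \<star> f)" using assms by simp
  moreover have "g \<star> f \<in> Cell1 D" using fg assms by simp
  ultimately show ?thesis unfolding identity_cell_def by blast
qed

lemma VComp_identity_left [simp]:
  "identity_cell \<beta> \<Longrightarrow> \<alpha> \<in> Cell2 D \<Longrightarrow> Src2 D \<beta> = Tgt2 D \<alpha> \<Longrightarrow> \<beta> \<bullet> \<alpha> = \<alpha>"
  using VComp_Id2_left[of \<alpha>] by (auto simp: identity_cell_def)

lemma VComp_identity_right [simp]: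
  "identity_cell \<beta> \<Longrightarrow> \<alpha> \<in> Cell2 D \<Longrightarrow> Src2 D \<alpha> = Tgt2 D \<beta> \<Longrightarrow> \<alpha> \<bullet> \<beta> = \<alpha>"
  using VComp_Id2_right[of \<alpha>] by (auto simp: identity_cell_def)

lemma whisker_left:
  assumes "identity_cell \<gamma>" "\<alpha> \<in> Cell2 D" "\<beta> \<in> Cell2 D" "Src2 D \<beta> = Tgt2 D \<alpha>"
    "Src1 D (Src2 D \<gamma>) = Tgt1 D (Src2 D \<alpha>)"
  shows "\<gamma> \<diamondop> (\<beta> \<bullet> \<alpha>) = (\<gamma> \<diamondop> \<beta>) \<bullet> (\<gamma> \<diamondop> \<alpha>)"
proof -
  obtain f where "f \<in> Cell1 D" "\<gamma> = Id2 D f" using assms(1) by (auto simp: identity_cell_def)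
  then show ?thesis using assms(2-) interchange[of \<alpha> \<beta> \<gamma> \<gamma>] by simp
qed

lemma whisker_right:
  assumes "identity_cell \<gamma>" "\<alpha> \<in> Cell2 D" "\<beta> \<in> Cell2 D" "Src2 D \<beta> = Tgt2 D \<alpha>"
    "Src1 D (Src2 D \<alpha>) = Tgt1 D (Src2 D \<gamma>)"
  shows "(\<beta> \<bullet> \<alpha>) \<diamondop> \<gamma> = (\<beta> \<diamondop> \<gamma>) \<bullet> (\<alpha> \<diamondop> \<gamma>)"
proof -
  obtain f where "f \<in> Cell1 D" "\<gamma> = Id2 D f" using assms(1) by (auto simp: identity_cell_def)
  then show ?thesis using assms(2-) interchange[of \<gamma> \<gamma> \<alpha> \<beta>] by simp
qed

lemmas whisker = whisker_left whisker_right

text \<open>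
  Both sides equal the horizontal composite of \<open>\<beta>\<close> and \<open>\<alpha>\<close>.
\<close>

lemma exchange:
  assumes "\<alpha> \<in> Cell2 D" "\<beta> \<in> Cell2 D" "Src1 D (Src2 D \<beta>) = Tgt1 D (Src2 D \<alpha>)"
  shows "(\<beta> \<diamondop> Id2 D (Tgt2 D \<alpha>)) \<bullet> (Id2 D (Src2 D \<beta>) \<diamondop> \<alpha>) =
    (Id2 D (Tgt2 D \<beta>) \<diamondop> \<alpha>) \<bullet> (\<beta> \<diamondop> Id2 D (Src2 D \<alpha>))"
  using assms interchange[of \<alpha> "Id2 D (Tgt2 D \<alpha>)" "Id2 D (Src2 D \<beta>)" \<beta>]
    interchange[of "Id2 D (Src2 D \<alpha>)" \<alpha> \<beta> "Id2 D (Tgt2 D \<beta>)"]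
  by simp

lemma Iso2_eq: "Iso2 D f g = Hom2 D f g"
  using invertible_cell by (fastforce simp: Iso2_def Hom2_def)

end

locale bicategory_cells = two_dimensional_cells A
  for A :: "('o, 'f, 'a, 'z) bicat_scheme" (structure) +
  assumes Assoc2_cell [simp]: "f \<in> Cell1 A \<Longrightarrow> g \<in> Cell1 A \<Longrightarrow> h \<in> Cell1 A \<Longrightarrow> Src1 A g = Tgt1 A f \<Longrightarrow>
      Src1 A h = Tgt1 A g \<Longrightarrow> Assoc2 A h g f \<in> Cell2 A \<and>
      Src2 A (Assoc2 A h g f) = (h \<star> g) \<star> f \<and> Tgt2 A (Assoc2 A h g f) = h \<star> g \<star> f"
    and LUnit2_cell [simp]: "f \<in> Cell1 A \<Longrightarrow> LUnit2 A f \<in> Cell2 A \<and>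
      Src2 A (LUnit2 A f) = Id1 A (Tgt1 A f) \<star> f \<and> Tgt2 A (LUnit2 A f) = f"
    and RUnit2_cell [simp]: "f \<in> Cell1 A \<Longrightarrow> RUnit2 A f \<in> Cell2 A \<and>
      Src2 A (RUnit2 A f) = f \<star> Id1 A (Src1 A f) \<and> Tgt2 A (RUnit2 A f) = f"
begin

lemma composable_iff [simp]: "(g, f) \<in> composable A \<longleftrightarrow> f \<in> Cell1 A \<and> g \<in> Cell1 A \<and> Src1 A g = Tgt1 A f"
  by (auto simp: composable_def)

end

locale pseudofunctor = A: bicategory_cells A + D: strict_21_category D
  for A :: "('o, 'f, 'a, 'z) bicat_scheme" and D :: "('p, 'g, 'b, 'y) twocat_scheme" (structure) +
  fixes X :: "('o, 'f, 'a, 'p, 'g, 'b) psfun"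
  assumes strictly_unital: "strictly_unital_pseudofunctor A D X"
begin

sublocale spf: strictly_unital_pseudofunctor A D X by (rule strictly_unital)

lemmas [simp] = spf.P0_in spf.P1_Id1 spf.P2_Id2

lemma P1_cell [simp]: "f \<in> Cell1 A \<Longrightarrow>
    P1 X f \<in> Cell1 D \<and> Src1 D (P1 X f) = P0 X (Src1 A f) \<and> Tgt1 D (P1 X f) = P0 X (Tgt1 A f)"
  using spf.P1_in[of f] by (auto simp: Hom1_def)

lemma P2_cell [simp]: "\<alpha> \<in> Cell2 A \<Longrightarrow>
    P2 X \<alpha> \<in> Cell2 D \<and> Src2 D (P2 X \<alpha>) = P1 X (Src2 A \<alpha>) \<and> Tgt2 D (P2 X \<alpha>) = P1 X (Tgt2 A \<alpha>)"
  using spf.P2_in[of \<alpha>] by (auto simp: Hom2_def)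

lemma PC_cell [simp]: "f \<in> Cell1 A \<Longrightarrow> g \<in> Cell1 A \<Longrightarrow> Src1 A g = Tgt1 A f \<Longrightarrow> PC X (g, f) \<in> Cell2 D \<and>
    Src2 D (PC X (g, f)) = P1 X g \<star> P1 X f \<and> Tgt2 D (PC X (g, f)) = P1 X (g \<star>\<^bsub>A\<^esub> f)"
  using spf.PC_iso[of g f] by (auto simp: D.Iso2_eq Hom2_def)

lemma P2_VComp: "\<alpha> \<in> Cell2 A \<Longrightarrow> \<beta> \<in> Cell2 A \<Longrightarrow> Src2 A \<beta> = Tgt2 A \<alpha> \<Longrightarrow>
    P2 X (\<beta> \<bullet>\<^bsub>A\<^esub> \<alpha>) = P2 X \<beta> \<bullet> P2 X \<alpha>"
  by (rule spf.P2_VComp) (auto simp: Hom2_def)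

lemma PC_nat: "\<alpha> \<in> Cell2 A \<Longrightarrow> \<beta> \<in> Cell2 A \<Longrightarrow> Src1 A (Src2 A \<beta>) = Tgt1 A (Src2 A \<alpha>) \<Longrightarrow>
    PC X (Tgt2 A \<beta>, Tgt2 A \<alpha>) \<bullet> (P2 X \<beta> \<diamondop> P2 X \<alpha>) =
    P2 X (\<beta> \<diamondop>\<^bsub>A\<^esub> \<alpha>) \<bullet> PC X (Src2 A \<beta>, Src2 A \<alpha>)"
  by (rule spf.PC_natural) (auto simp: Hom2_def)

end

locale pseudonatural = X: pseudofunctor A D X + Y: pseudofunctor A D Y
  for A :: "('o, 'f, 'a, 'z) bicat_scheme" and D :: "('p, 'g, 'b, 'y) twocat_scheme" (structure) and X Y +
  fixes \<theta> :: "('o, 'f, 'a, 'p, 'g, 'b) pstrans"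
  assumes pseudonatural_transformation: "pseudonatural_transformation A D \<theta>"
    and TSrc_eq [simp]: "TSrc \<theta> = X" and TTgt_eq [simp]: "TTgt \<theta> = Y"
begin

sublocale pst: pseudonatural_transformation A D \<theta>
  by (rule pseudonatural_transformation)

lemma T0_cell [simp]: "s \<in> Cell0 A \<Longrightarrow>
    T0 \<theta> s \<in> Cell1 D \<and> Src1 D (T0 \<theta> s) = P0 X s \<and> Tgt1 D (T0 \<theta> s) = P0 Y s"
  using pst.T0_in[of s] by (auto simp: Hom1_def)

lemma T1_cell [simp]: "f \<in> Cell1 A \<Longrightarrow> T1 \<theta> f \<in> Cell2 D \<and>
    Src2 D (T1 \<theta> f) = P1 Y f \<star> T0 \<theta> (Src1 A f) \<and> Tgt2 D (T1 \<theta> f) = T0 \<theta> (Tgt1 A f) \<star> P1 X f"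
  using pst.T1_iso[of f "Src1 A f" "Tgt1 A f"] by (auto simp: X.D.Iso2_eq Hom1_def Hom2_def)

lemma T1_nat: "\<alpha> \<in> Cell2 A \<Longrightarrow>
    T1 \<theta> (Tgt2 A \<alpha>) \<bullet> (P2 Y \<alpha> \<diamondop> Id2 D (T0 \<theta> (Src1 A (Src2 A \<alpha>)))) =
    (Id2 D (T0 \<theta> (Tgt1 A (Src2 A \<alpha>))) \<diamondop> P2 X \<alpha>) \<bullet> T1 \<theta> (Src2 A \<alpha>)"
  using pst.T1_natural[of "Src2 A \<alpha>" "Src1 A (Src2 A \<alpha>)" "Tgt1 A (Src2 A \<alpha>)" "Tgt2 A \<alpha>" \<alpha>]
  by (simp add: Hom1_def Hom2_def)

lemmas [simp] = pst.T1_Id1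

lemma T1_Comp1: "f \<in> Cell1 A \<Longrightarrow> g \<in> Cell1 A \<Longrightarrow> Src1 A g = Tgt1 A f \<Longrightarrow>
      T1 \<theta> (g \<star>\<^bsub>A\<^esub> f) \<bullet> (PC Y (g, f) \<diamondop> Id2 D (T0 \<theta> (Src1 A f))) =
      (Id2 D (T0 \<theta> (Tgt1 A g)) \<diamondop> PC X (g, f)) \<bullet>
        (T1 \<theta> g \<diamondop> Id2 D (P1 X f)) \<bullet> (Id2 D (P1 Y g) \<diamondop> T1 \<theta> f)"
  using pst.T1_Comp1[of f "Src1 A f" "Tgt1 A f" g "Tgt1 A g"] by (simp add: Hom1_def)

end

lemma pseudonaturalI:
  fixes D (structure)
  assumes "pseudofunctor A D X" "pseudofunctor A D Y" "TSrc \<theta> = X" "TTgt \<theta> = Y"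
    and "\<And>s. s \<in> Cell0 A \<Longrightarrow> T0 \<theta> s \<in> Cell1 D \<and> Src1 D (T0 \<theta> s) = P0 X s \<and> Tgt1 D (T0 \<theta> s) = P0 Y s"
    and "\<And>f. f \<in> Cell1 A \<Longrightarrow> T1 \<theta> f \<in> Cell2 D \<and> Src2 D (T1 \<theta> f) = P1 Y f \<star> T0 \<theta> (Src1 A f) \<and>
      Tgt2 D (T1 \<theta> f) = T0 \<theta> (Tgt1 A f) \<star> P1 X f"
    and "\<And>\<alpha>. \<alpha> \<in> Cell2 A \<Longrightarrow>
      T1 \<theta> (Tgt2 A \<alpha>) \<bullet> (P2 Y \<alpha> \<diamondop> Id2 D (T0 \<theta> (Src1 A (Src2 A \<alpha>)))) =
      (Id2 D (T0 \<theta> (Tgt1 A (Src2 A \<alpha>))) \<diamondop> P2 X \<alpha>) \<bullet> T1 \<theta> (Src2 A \<alpha>)"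
    and "\<And>s. s \<in> Cell0 A \<Longrightarrow> T1 \<theta> (Id1 A s) = Id2 D (T0 \<theta> s)"
    and "\<And>f g. f \<in> Cell1 A \<Longrightarrow> g \<in> Cell1 A \<Longrightarrow> Src1 A g = Tgt1 A f \<Longrightarrow>
      T1 \<theta> (g \<star>\<^bsub>A\<^esub> f) \<bullet> (PC Y (g, f) \<diamondop> Id2 D (T0 \<theta> (Src1 A f))) =
      (Id2 D (T0 \<theta> (Tgt1 A g)) \<diamondop> PC X (g, f)) \<bullet>
        (T1 \<theta> g \<diamondop> Id2 D (P1 X f)) \<bullet> (Id2 D (P1 Y g) \<diamondop> T1 \<theta> f)"
    and "T0 \<theta> \<in> extensional (Cell0 A)" "T1 \<theta> \<in> extensional (Cell1 A)"
  shows "pseudonatural A D X Y \<theta>"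
proof -
  interpret X: pseudofunctor A D X by fact
  interpret Y: pseudofunctor A D Y by fact
  have "pseudonatural_transformation A D \<theta>"
  proof ((intro pseudonatural_transformation.intro pseudonatural_transformation_axioms.intro;
      (unfold assms(3,4))?), goal_cases)
    case 1 show ?case by (rule X.strictly_unital)
  next
    case 2 show ?case by (rule Y.strictly_unital)
  next
    case (3 s) then show ?case using assms(5)[of s] by (simp add: Hom1_def)
  next
    case (4 f s t) then show ?case using assms(6)[of f] by (auto simp: Hom1_def Hom2_def X.D.Iso2_eq)
  next
    case (5 f s t f' \<alpha>) then show ?case using assms(7)[of \<alpha>] by (auto simp: Hom1_def Hom2_def)
  next
    case (6 s) then show ?case by (rule assms(8))
  next
    case (7 f s t g r) then show ?case using assms(9)[of f g] by (auto simp: Hom1_def)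
  next
    case 8 show ?case by (rule assms(10))
  next
    case 9 show ?case by (rule assms(11))
  qed
  then show ?thesis
    using assms(1-4) by (intro pseudonatural.intro pseudonatural_axioms.intro)
qed

lemma pseudonatural_eqI:
  assumes "pseudonatural A D X Y \<theta>" "pseudonatural A D X Y \<phi>"
    and "\<And>s. s \<in> Cell0 A \<Longrightarrow> T0 \<theta> s = T0 \<phi> s" "\<And>f. f \<in> Cell1 A \<Longrightarrow> T1 \<theta> f = T1 \<phi> f"
  shows "\<theta> = \<phi>"
proof -
  interpret \<theta>: pseudonatural A D X Y \<theta> by fact
  interpret \<phi>: pseudonatural A D X Y \<phi> by fact
  have "T0 \<theta> = T0 \<phi>" using assms(3) \<theta>.pst.T0_ext \<phi>.pst.T0_ext by (metis extensionalityI)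
  moreover have "T1 \<theta> = T1 \<phi>" using assms(4) \<theta>.pst.T1_ext \<phi>.pst.T1_ext by (metis extensionalityI)
  ultimately show ?thesis using \<theta>.TSrc_eq \<theta>.TTgt_eq \<phi>.TSrc_eq \<phi>.TTgt_eq by simp
qed

lemma id_pstrans_simps [simp]:
  "TSrc (id_pstrans A D X) = X" "TTgt (id_pstrans A D X) = X"
  "s \<in> Cell0 A \<Longrightarrow> T0 (id_pstrans A D X) s = Id1 D (P0 X s)"
  "f \<in> Cell1 A \<Longrightarrow> T1 (id_pstrans A D X) f = Id2 D (P1 X f)"
  by (simp_all add: id_pstrans_def)

lemma comp_pstrans_simps [simp]:
  fixes D (structure)
  shows "TSrc (comp_pstrans A D \<phi> \<theta>) = TSrc \<theta>" "TTgt (comp_pstrans A D \<phi> \<theta>) = TTgt \<phi>"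
  "s \<in> Cell0 A \<Longrightarrow> T0 (comp_pstrans A D \<phi> \<theta>) s = T0 \<phi> s \<star> T0 \<theta> s"
  "f \<in> Cell1 A \<Longrightarrow> T1 (comp_pstrans A D \<phi> \<theta>) f = (Id2 D (T0 \<phi> (Tgt1 A f)) \<diamondop> T1 \<theta> f) \<bullet>
      (T1 \<phi> f \<diamondop> Id2 D (T0 \<theta> (Src1 A f)))"
  by (simp_all add: comp_pstrans_def)

lemma (in pseudofunctor) pseudonatural_id: "pseudonatural A D X X (id_pstrans A D X)"
  by (rule pseudonaturalI) (unfold_locales, simp_all, simp_all add: id_pstrans_def)

text \<open>
  The squares of \<open>\<phi>\<close> and \<open>\<theta>\<close> are pasted side by side. For a composite \<open>g \<star> f\<close>, the law of \<open>\<phi>\<close> whiskered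
  by \<open>\<theta>\<close> and the law of \<open>\<theta>\<close> whiskered by \<open>\<phi>\<close> leave the square of \<open>\<phi>\<close> at \<open>g\<close> and that of \<open>\<theta>\<close> at \<open>f\<close>
  in the wrong order, and \<open>exchange\<close> swaps them.
\<close>

lemma pseudonatural_comp:
  fixes D (structure)
  assumes "pseudonatural A D X Y \<theta>" "pseudonatural A D Y Z \<phi>"
  shows "pseudonatural A D X Z (comp_pstrans A D \<phi> \<theta>)"
proof -
  interpret \<theta>: pseudonatural A D X Y \<theta> by fact
  interpret \<phi>: pseudonatural A D Y Z \<phi> by fact
  note whisker = \<theta>.X.D.whisker
  let ?\<theta> = "\<lambda>s. Id2 D (T0 \<theta> s)" and ?\<phi> = "\<lambda>s. Id2 D (T0 \<phi> s)"
  show ?thesis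
  proof (rule pseudonaturalI, goal_cases)
    case 1 show ?case by unfold_locales
  next
    case 2 show ?case by unfold_locales
  next
    case (7 \<alpha>)
    let ?s = "Src1 A (Src2 A \<alpha>)" and ?t = "Tgt1 A (Src2 A \<alpha>)" and ?f = "Src2 A \<alpha>" and ?f' = "Tgt2 A \<alpha>"
    note [simp] = 7
    have 1: "(T1 \<phi> ?f' \<diamondop> ?\<theta> ?s) \<bullet> (P2 Z \<alpha> \<diamondop> ?\<phi> ?s \<diamondop> ?\<theta> ?s) =
        (?\<phi> ?t \<diamondop> P2 Y \<alpha> \<diamondop> ?\<theta> ?s) \<bullet> (T1 \<phi> ?f \<diamondop> ?\<theta> ?s)"
      using arg_cong[OF \<phi>.T1_nat[OF 7], of "\<lambda>\<xi>. \<xi> \<diamondop> ?\<theta> ?s"] by (simp add: whisker)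
    have 2: "(?\<phi> ?t \<diamondop> T1 \<theta> ?f') \<bullet> (?\<phi> ?t \<diamondop> P2 Y \<alpha> \<diamondop> ?\<theta> ?s) =
        (?\<phi> ?t \<diamondop> ?\<theta> ?t \<diamondop> P2 X \<alpha>) \<bullet> (?\<phi> ?t \<diamondop> T1 \<theta> ?f)"
      using arg_cong[OF \<theta>.T1_nat[OF 7], of "\<lambda>\<xi>. ?\<phi> ?t \<diamondop> \<xi>"] by (simp add: whisker)
    have "(?\<phi> ?t \<diamondop> T1 \<theta> ?f') \<bullet> (T1 \<phi> ?f' \<diamondop> ?\<theta> ?s) \<bullet> (P2 Z \<alpha> \<diamondop> ?\<phi> ?s \<diamondop> ?\<theta> ?s) =
        ((?\<phi> ?t \<diamondop> T1 \<theta> ?f') \<bullet> (?\<phi> ?t \<diamondop> P2 Y \<alpha> \<diamondop> ?\<theta> ?s)) \<bullet> (T1 \<phi> ?f \<diamondop> ?\<theta> ?s)"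
      unfolding 1 by simp
    then show ?case unfolding 2 by simp
  next
    case (9 f g)
    let ?s = "Src1 A f" and ?t = "Tgt1 A f" and ?r = "Tgt1 A g"
    let ?Xf = "Id2 D (P1 X f)" and ?Yf = "Id2 D (P1 Y f)" and ?Yg = "Id2 D (P1 Y g)" and ?Zg = "Id2 D (P1 Z g)"
    note [simp] = 9
    have 1: "(T1 \<phi> (g \<star>\<^bsub>A\<^esub> f) \<diamondop> ?\<theta> ?s) \<bullet> (PC Z (g, f) \<diamondop> ?\<phi> ?s \<diamondop> ?\<theta> ?s) =
        (?\<phi> ?r \<diamondop> PC Y (g, f) \<diamondop> ?\<theta> ?s) \<bullet> (T1 \<phi> g \<diamondop> ?Yf \<diamondop> ?\<theta> ?s) \<bullet> (?Zg \<diamondop> T1 \<phi> f \<diamondop> ?\<theta> ?s)"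
      using arg_cong[OF \<phi>.T1_Comp1[OF 9], of "\<lambda>\<xi>. \<xi> \<diamondop> ?\<theta> ?s"] by (simp add: whisker)
    have 2: "(?\<phi> ?r \<diamondop> T1 \<theta> (g \<star>\<^bsub>A\<^esub> f)) \<bullet> (?\<phi> ?r \<diamondop> PC Y (g, f) \<diamondop> ?\<theta> ?s) =
        (?\<phi> ?r \<diamondop> ?\<theta> ?r \<diamondop> PC X (g, f)) \<bullet> (?\<phi> ?r \<diamondop> T1 \<theta> g \<diamondop> ?Xf) \<bullet> (?\<phi> ?r \<diamondop> ?Yg \<diamondop> T1 \<theta> f)"
      using arg_cong[OF \<theta>.T1_Comp1[OF 9], of "\<lambda>\<xi>. ?\<phi> ?r \<diamondop> \<xi>"] by (simp add: whisker)
    \<comment> \<open>Both sides are the horizontal composite of the components at \<open>g\<close> and \<open>f\<close>.\<close>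
    have 3: "(?\<phi> ?r \<diamondop> ?Yg \<diamondop> T1 \<theta> f) \<bullet> (T1 \<phi> g \<diamondop> ?Yf \<diamondop> ?\<theta> ?s) =
        (T1 \<phi> g \<diamondop> ?\<theta> ?t \<diamondop> ?Xf) \<bullet> (?Zg \<diamondop> ?\<phi> ?t \<diamondop> T1 \<theta> f)"
      using \<theta>.X.D.exchange[of "T1 \<theta> f" "T1 \<phi> g"] by simp
    have "(?\<phi> ?r \<diamondop> T1 \<theta> (g \<star>\<^bsub>A\<^esub> f)) \<bullet> (T1 \<phi> (g \<star>\<^bsub>A\<^esub> f) \<diamondop> ?\<theta> ?s) \<bullet> (PC Z (g, f) \<diamondop> ?\<phi> ?s \<diamondop> ?\<theta> ?s) =
      ((?\<phi> ?r \<diamondop> T1 \<theta> (g \<star>\<^bsub>A\<^esub> f)) \<bullet> (?\<phi> ?r \<diamondop> PC Y (g, f) \<diamondop> ?\<theta> ?s)) \<bullet>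
        (T1 \<phi> g \<diamondop> ?Yf \<diamondop> ?\<theta> ?s) \<bullet> (?Zg \<diamondop> T1 \<phi> f \<diamondop> ?\<theta> ?s)"
      unfolding 1 by simp
    also have "\<dots> = (?\<phi> ?r \<diamondop> ?\<theta> ?r \<diamondop> PC X (g, f)) \<bullet> (?\<phi> ?r \<diamondop> T1 \<theta> g \<diamondop> ?Xf) \<bullet>
        ((?\<phi> ?r \<diamondop> ?Yg \<diamondop> T1 \<theta> f) \<bullet> (T1 \<phi> g \<diamondop> ?Yf \<diamondop> ?\<theta> ?s)) \<bullet> (?Zg \<diamondop> T1 \<phi> f \<diamondop> ?\<theta> ?s)"
      unfolding 2 by simp
    finally show ?case
      unfolding 3 by (simp add: whisker)
  next
    case 10 show ?case by (simp add: comp_pstrans_def)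
  next
    case 11 show ?case by (simp add: comp_pstrans_def)
  qed simp_all
qed



section \<open>The category of Mackey functors\<close>

lemma pseudofunctor_iff:
  assumes "bicategory_cells A" "strict_21_category D"
  shows "pseudofunctor A D X \<longleftrightarrow> strictly_unital_pseudofunctor A D X"
  using assms by (simp add: pseudofunctor_def pseudofunctor_axioms_def)

lemma Mack_simps [simp]:
  "Dom (Mack A D) = TSrc" "Cod (Mack A D) = TTgt"
  "Idt (Mack A D) = id_pstrans A D" "Cmp (Mack A D) = comp_pstrans A D"
  by (simp_all add: Mack_def Let_def)

lemma Obj_Mack:
  assumes "bicategory_cells A" "strict_21_category D"
  shows "X \<in> Obj (Mack A D) \<longleftrightarrow> pseudofunctor A D X \<and> additive A D X"
  using assms by (simp add: Mack_def Let_def pseudofunctor_iff)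

lemma Arr_Mack:
  assumes "bicategory_cells A" "strict_21_category D"
  shows "\<theta> \<in> Arr (Mack A D) \<longleftrightarrow> TSrc \<theta> \<in> Obj (Mack A D) \<and> TTgt \<theta> \<in> Obj (Mack A D) \<and>
    pseudonatural A D (TSrc \<theta>) (TTgt \<theta>) \<theta>"
  using assms by (auto simp: Mack_def Let_def pseudofunctor_iff pseudonatural_def pseudonatural_axioms_def)

lemma comp_pstrans_assoc:
  assumes "pseudonatural A D W X \<theta>" "pseudonatural A D X Y \<phi>" "pseudonatural A D Y Z \<chi>"
  shows "comp_pstrans A D (comp_pstrans A D \<chi> \<phi>) \<theta> = comp_pstrans A D \<chi> (comp_pstrans A D \<phi> \<theta>)"
proof -
  interpret \<theta>: pseudonatural A D W X \<theta> by fact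
  interpret \<phi>: pseudonatural A D X Y \<phi> by fact
  interpret \<chi>: pseudonatural A D Y Z \<chi> by fact
  show ?thesis
    by (rule pseudonatural_eqI[of A D W Z])
      (use assms in \<open>auto intro: pseudonatural_comp simp: \<theta>.X.D.whisker\<close>)
qed

lemma comp_id_pstrans:
  assumes "pseudonatural A D X Y \<theta>"
  shows "comp_pstrans A D (id_pstrans A D Y) \<theta> = \<theta>" "comp_pstrans A D \<theta> (id_pstrans A D X) = \<theta>"
proof -
  interpret \<theta>: pseudonatural A D X Y \<theta> by fact
  show "comp_pstrans A D (id_pstrans A D Y) \<theta> = \<theta>" "comp_pstrans A D \<theta> (id_pstrans A D X) = \<theta>"
    by (rule pseudonatural_eqI[of A D X Y];
      use assms \<theta>.X.pseudonatural_id \<theta>.Y.pseudonatural_id in \<open>auto intro: pseudonatural_comp\<close>)+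
qed

lemma category_Mack:
  assumes A: "bicategory_cells A" and D: "strict_21_category D"
  shows "category (Mack A D)"
proof (rule categoryI, goal_cases)
  case (2 X)
  then show ?case using pseudofunctor.pseudonatural_id by (auto simp: Obj_Mack[OF A D] Arr_Mack[OF A D])
next
  case (3 \<theta> \<phi>)
  then show ?case by (auto simp: Arr_Mack[OF A D] intro: pseudonatural_comp)
next
  case (4 \<theta>)
  then show ?case using comp_id_pstrans[of A D "TSrc \<theta>" "TTgt \<theta>" \<theta>] by (auto simp: Arr_Mack[OF A D])
next
  case (5 \<theta> \<phi> \<chi>)
  then show ?case
    using comp_pstrans_assoc[of A D "TSrc \<theta>" "TTgt \<theta>" \<theta> "TTgt \<phi>" \<phi> "TTgt \<chi>" \<chi>] by (auto simp: Arr_Mack[OF A D])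
qed (auto simp: Arr_Mack[OF A D])


section \<open>Full sub-2-categories\<close>

lemma full_sub_twocat_simps [simp]:
  "Cell0 (full_sub_twocat D S) = Cell0 D \<inter> S"
  "Cell1 (full_sub_twocat D S) = {f \<in> Cell1 D. Src1 D f \<in> S \<and> Tgt1 D f \<in> S}"
  "Cell2 (full_sub_twocat D S) = {\<alpha> \<in> Cell2 D. Src1 D (Src2 D \<alpha>) \<in> S \<and> Tgt1 D (Src2 D \<alpha>) \<in> S}"
  "Src1 (full_sub_twocat D S) = Src1 D" "Tgt1 (full_sub_twocat D S) = Tgt1 D"
  "Src2 (full_sub_twocat D S) = Src2 D" "Tgt2 (full_sub_twocat D S) = Tgt2 D"
  "Id1 (full_sub_twocat D S) = Id1 D" "Id2 (full_sub_twocat D S) = Id2 D"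
  "Comp1 (full_sub_twocat D S) = Comp1 D" "VComp (full_sub_twocat D S) = VComp D"
  "HComp (full_sub_twocat D S) = HComp D"
  by (simp_all add: full_sub_twocat_def)

lemma strict_21_full_sub:
  assumes "strict_21_category D"
  shows "strict_21_category (full_sub_twocat D S)"
proof -
  interpret D: strict_21_category D by fact
  show ?thesis
  proof (unfold_locales, goal_cases)
    case (22 \<alpha> \<alpha>' \<beta> \<beta>')
    then show ?case by (simp add: D.interchange)
  next
    case (23 \<alpha>)
    then show ?case using D.invertible_cell[of \<alpha>] by auto
  qed (auto simp: D.VComp_Id2_left D.VComp_Id2_right)
qed

lemma pstrans_full_sub [simp]:
  "id_pstrans A (full_sub_twocat D S) = id_pstrans A D"
  "comp_pstrans A (full_sub_twocat D S) = comp_pstrans A D"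
  by (intro ext, simp add: id_pstrans_def comp_pstrans_def)+

lemma pseudofunctor_full_sub:
  assumes A: "bicategory_cells A" and D: "strict_21_category D"
  shows "pseudofunctor A (full_sub_twocat D S) X \<longleftrightarrow> pseudofunctor A D X \<and> (\<forall>s \<in> Cell0 A. P0 X s \<in> S)"
    (is "?l \<longleftrightarrow> ?r")
proof -
  interpret A: bicategory_cells A by fact
  interpret D: strict_21_category D by fact
  note P = strict_21_full_sub[OF D, of S]
  interpret P: strict_21_category "full_sub_twocat D S" by (rule P)
  show ?thesis
  proof
    assume ?l
    then interpret X: pseudofunctor A "full_sub_twocat D S" X .
    have "strictly_unital_pseudofunctor A D X"
      by unfold_locales
        (use X.spf.P0_in X.spf.P1_Id1 X.spf.P2_Id2 X.spf.P2_VComp X.spf.PC_natural X.spf.PC_assoc X.spf.PC_lunit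
            X.spf.PC_runit X.spf.P0_ext X.spf.P1_ext X.spf.P2_ext X.spf.PC_ext X.P1_cell X.P2_cell X.PC_cell
          in \<open>force simp: Hom1_def Hom2_def D.Iso2_eq\<close>)+
    then show ?r using A D X.spf.P0_in by (simp add: pseudofunctor_iff)
  next
    assume r: ?r
    then interpret X: pseudofunctor A D X by blast
    have "strictly_unital_pseudofunctor A (full_sub_twocat D S) X"
      by unfold_locales
        (use r X.spf.P1_Id1 X.spf.P2_Id2 X.spf.P2_VComp X.spf.PC_natural X.spf.PC_assoc X.spf.PC_lunit
            X.spf.PC_runit X.spf.P0_ext X.spf.P1_ext X.spf.P2_ext X.spf.PC_ext X.spf.P0_in X.P1_cell X.P2_cell X.PC_cell
          in \<open>force simp: Hom1_def Hom2_def P.Iso2_eq\<close>)+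
    then show ?l using A P by (simp add: pseudofunctor_iff)
  qed
qed

lemma pseudonatural_full_sub:
  assumes A: "bicategory_cells A" and D: "strict_21_category D"
  shows "pseudonatural A (full_sub_twocat D S) X Y \<theta> \<longleftrightarrow>
    pseudonatural A D X Y \<theta> \<and> (\<forall>s \<in> Cell0 A. P0 X s \<in> S \<and> P0 Y s \<in> S)"
    (is "?l \<longleftrightarrow> ?r")
proof
  assume ?l
  then interpret \<theta>: pseudonatural A "full_sub_twocat D S" X Y \<theta> .
  have XY: "pseudofunctor A D X" "pseudofunctor A D Y" "\<forall>s \<in> Cell0 A. P0 X s \<in> S \<and> P0 Y s \<in> S"
    using \<theta>.X.pseudofunctor_axioms \<theta>.Y.pseudofunctor_axioms by (simp_all add: pseudofunctor_full_sub[OF A D])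
  have "pseudonatural A D X Y \<theta>"
  proof (rule pseudonaturalI, goal_cases)
    case (5 s) then show ?case using \<theta>.T0_cell[of s] by simp
  next
    case (6 f) then show ?case using \<theta>.T1_cell[of f] by simp
  next
    case (7 \<alpha>) then show ?case using \<theta>.T1_nat[of \<alpha>] by simp
  next
    case (9 f g) then show ?case using \<theta>.T1_Comp1[of f g] by simp
  qed (use XY \<theta>.pst.T1_Id1 \<theta>.pst.T0_ext \<theta>.pst.T1_ext in simp_all)
  then show ?r using XY by blast
next
  assume r: ?r
  then interpret \<theta>: pseudonatural A D X Y \<theta> by blast
  show ?l
  proof (rule pseudonaturalI, goal_cases)
    case 1
    show ?case using \<theta>.X.pseudofunctor_axioms r by (simp add: pseudofunctor_full_sub[OF A D])
  next
    case 2
    show ?case using \<theta>.Y.pseudofunctor_axioms r by (simp add: pseudofunctor_full_sub[OF A D])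
  next
    case (7 \<alpha>) then show ?case using \<theta>.T1_nat[of \<alpha>] by simp
  next
    case (9 f g) then show ?case using \<theta>.T1_Comp1[of f g] by simp
  qed (use r \<theta>.pst.T0_ext \<theta>.pst.T1_ext in simp_all)
qed


section \<open>Product cones\<close>

context strict_21_category
begin

lemma product_coneI:
  assumes "Q \<in> Cell0 D" "\<And>i. i \<in> I \<Longrightarrow> q i \<in> Cell1 D \<and> Src1 D (q i) = Q"
    and "\<And>W f. W \<in> Cell0 D \<Longrightarrow>
      (\<And>i. i \<in> I \<Longrightarrow> f i \<in> Cell1 D \<and> Src1 D (f i) = W \<and> Tgt1 D (f i) = Tgt1 D (q i)) \<Longrightarrow>
      \<exists>h. h \<in> Cell1 D \<and> Src1 D h = W \<and> Tgt1 D h = Q \<and>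
        (\<forall>i \<in> I. \<exists>\<alpha>. \<alpha> \<in> Cell2 D \<and> Src2 D \<alpha> = q i \<star> h \<and> Tgt2 D \<alpha> = f i)"
    and "\<And>h h' \<alpha>. h \<in> Cell1 D \<Longrightarrow> h' \<in> Cell1 D \<Longrightarrow> Src1 D h' = Src1 D h \<Longrightarrow> Tgt1 D h = Q \<Longrightarrow> Tgt1 D h' = Q \<Longrightarrow>
      (\<And>i. i \<in> I \<Longrightarrow> \<alpha> i \<in> Cell2 D \<and> Src2 D (\<alpha> i) = q i \<star> h \<and> Tgt2 D (\<alpha> i) = q i \<star> h') \<Longrightarrow>
      \<exists>\<beta>. \<beta> \<in> Cell2 D \<and> Src2 D \<beta> = h \<and> Tgt2 D \<beta> = h' \<and> (\<forall>i \<in> I. Id2 D (q i) \<diamondop> \<beta> = \<alpha> i)"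
    and "\<And>\<beta> \<beta>'. \<beta> \<in> Cell2 D \<Longrightarrow> \<beta>' \<in> Cell2 D \<Longrightarrow> Src2 D \<beta>' = Src2 D \<beta> \<Longrightarrow> Tgt2 D \<beta>' = Tgt2 D \<beta> \<Longrightarrow>
      Tgt1 D (Src2 D \<beta>) = Q \<Longrightarrow> (\<And>i. i \<in> I \<Longrightarrow> Id2 D (q i) \<diamondop> \<beta>' = Id2 D (q i) \<diamondop> \<beta>) \<Longrightarrow> \<beta>' = \<beta>"
  shows "product_cone D I Q q"
  unfolding product_cone_def
proof (intro conjI ballI allI impI)
  show "Q \<in> Cell0 D" "\<And>i. i \<in> I \<Longrightarrow> q i \<in> Cell1 D" "\<And>i. i \<in> I \<Longrightarrow> Src1 D (q i) = Q" using assms(1,2) by auto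
  fix W f assume "W \<in> Cell0 D" "\<forall>i\<in>I. f i \<in> Hom1 D W (Tgt1 D (q i))"
  then obtain h where "h \<in> Cell1 D" "Src1 D h = W" "Tgt1 D h = Q"
    "\<forall>i \<in> I. \<exists>\<alpha>. \<alpha> \<in> Cell2 D \<and> Src2 D \<alpha> = q i \<star> h \<and> Tgt2 D \<alpha> = f i"
    using assms(3)[of W f] unfolding Hom1_def by blast
  then show "\<exists>h\<in>Hom1 D W Q. \<forall>i\<in>I. \<exists>\<alpha>. \<alpha> \<in> Iso2 D (q i \<star> h) (f i)"
    unfolding Iso2_eq Hom1_def Hom2_def by blast
next
  fix W h h' \<alpha>
  assume h: "h \<in> Hom1 D W Q" "h' \<in> Hom1 D W Q" and \<alpha>: "\<forall>i\<in>I. \<alpha> i \<in> Hom2 D (q i \<star> h) (q i \<star> h')"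
  obtain \<beta> where \<beta>: "\<beta> \<in> Cell2 D" "Src2 D \<beta> = h" "Tgt2 D \<beta> = h'" "\<forall>i \<in> I. Id2 D (q i) \<diamondop> \<beta> = \<alpha> i"
    using assms(4)[of h h' \<alpha>] h \<alpha> unfolding Hom1_def Hom2_def by blast
  show "\<exists>!\<beta>. \<beta> \<in> Hom2 D h h' \<and> (\<forall>i\<in>I. Id2 D (q i) \<diamondop> \<beta> = \<alpha> i)"
  proof (rule ex1I[of _ \<beta>])
    show "\<beta> \<in> Hom2 D h h' \<and> (\<forall>i\<in>I. Id2 D (q i) \<diamondop> \<beta> = \<alpha> i)" using \<beta> by (simp add: Hom2_def)
    show "\<beta>' = \<beta>" if "\<beta>' \<in> Hom2 D h h' \<and> (\<forall>i\<in>I. Id2 D (q i) \<diamondop> \<beta>' = \<alpha> i)" for \<beta>'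
      by (rule assms(5)) (use that \<beta> h in \<open>auto simp: Hom1_def Hom2_def\<close>)
  qed
qed

lemma product_coneD:
  assumes "product_cone D I Q q"
  shows "Q \<in> Cell0 D" "i \<in> I \<Longrightarrow> q i \<in> Cell1 D" "i \<in> I \<Longrightarrow> Src1 D (q i) = Q"
  using assms by (auto simp: product_cone_def)

lemma product_cone_fill1:
  assumes "product_cone D I Q q" "W \<in> Cell0 D"
    "\<And>i. i \<in> I \<Longrightarrow> f i \<in> Cell1 D \<and> Src1 D (f i) = W \<and> Tgt1 D (f i) = Tgt1 D (q i)"
  obtains h where "h \<in> Cell1 D" "Src1 D h = W" "Tgt1 D h = Q"
    "\<forall>i \<in> I. \<exists>\<alpha>. \<alpha> \<in> Cell2 D \<and> Src2 D \<alpha> = q i \<star> h \<and> Tgt2 D \<alpha> = f i"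
proof -
  have "\<forall>i\<in>I. f i \<in> Hom1 D W (Tgt1 D (q i))" using assms(3) by (simp add: Hom1_def)
  then have "\<exists>h\<in>Hom1 D W Q. \<forall>i\<in>I. \<exists>\<alpha>. \<alpha> \<in> Iso2 D (q i \<star> h) (f i)"
    using assms(1,2) by (simp add: product_cone_def)
  then show ?thesis using that by (auto simp: Iso2_eq Hom1_def Hom2_def)
qed

lemma product_cone_unique2:
  assumes "product_cone D I Q q" "h \<in> Cell1 D" "h' \<in> Cell1 D" "Src1 D h' = Src1 D h" "Tgt1 D h = Q" "Tgt1 D h' = Q"
    "\<And>i. i \<in> I \<Longrightarrow> \<alpha> i \<in> Cell2 D \<and> Src2 D (\<alpha> i) = q i \<star> h \<and> Tgt2 D (\<alpha> i) = q i \<star> h'"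
  shows "\<exists>!\<beta>. \<beta> \<in> Hom2 D h h' \<and> (\<forall>i \<in> I. Id2 D (q i) \<diamondop> \<beta> = \<alpha> i)"
proof -
  have "h \<in> Hom1 D (Src1 D h) Q" "h' \<in> Hom1 D (Src1 D h) Q" "\<forall>i\<in>I. \<alpha> i \<in> Hom2 D (q i \<star> h) (q i \<star> h')"
    using assms(2-) by (auto simp: Hom1_def Hom2_def)
  then show ?thesis using assms(1,2) Src1_in[of h] unfolding product_cone_def by blast
qed

lemma product_cone_fill2:
  assumes "product_cone D I Q q" "h \<in> Cell1 D" "h' \<in> Cell1 D" "Src1 D h' = Src1 D h" "Tgt1 D h = Q" "Tgt1 D h' = Q"
    "\<And>i. i \<in> I \<Longrightarrow> \<alpha> i \<in> Cell2 D \<and> Src2 D (\<alpha> i) = q i \<star> h \<and> Tgt2 D (\<alpha> i) = q i \<star> h'"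
  obtains \<beta> where "\<beta> \<in> Cell2 D" "Src2 D \<beta> = h" "Tgt2 D \<beta> = h'" "\<forall>i \<in> I. Id2 D (q i) \<diamondop> \<beta> = \<alpha> i"
  using product_cone_unique2[OF assms] that by (auto simp: Hom2_def)

lemma product_cone_cancel:
  assumes cone: "product_cone D I Q q" and \<beta>: "\<beta> \<in> Cell2 D" "\<beta>' \<in> Cell2 D" "Src2 D \<beta>' = Src2 D \<beta>" "Tgt2 D \<beta>' = Tgt2 D \<beta>"
      "Tgt1 D (Src2 D \<beta>) = Q"
    and eq: "\<And>i. i \<in> I \<Longrightarrow> Id2 D (q i) \<diamondop> \<beta>' = Id2 D (q i) \<diamondop> \<beta>"
  shows "\<beta>' = \<beta>"
proof -
  note [simp] = product_coneD[OF cone]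
  have "\<exists>!\<gamma>. \<gamma> \<in> Hom2 D (Src2 D \<beta>) (Tgt2 D \<beta>) \<and> (\<forall>i \<in> I. Id2 D (q i) \<diamondop> \<gamma> = Id2 D (q i) \<diamondop> \<beta>)"
    by (rule product_cone_unique2[OF cone]) (use \<beta> in auto)
  moreover have "\<beta> \<in> Hom2 D (Src2 D \<beta>) (Tgt2 D \<beta>)" "\<beta>' \<in> Hom2 D (Src2 D \<beta>) (Tgt2 D \<beta>)"
    using \<beta> by (simp_all add: Hom2_def)
  ultimately show ?thesis using eq by metis
qed

end


section \<open>Strictification of Mackey functors\<close>

text \<open>
  \<open>Q0\<close> and \<open>Q1\<close> form a functor on the underlying 1-category with values in the full sub-2-category on
  \<open>S\<close>. The 1-cells \<open>ev\<close> are strictly natural, have sections \<open>sec\<close>, and postcomposition with them is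
  fully faithful on 2-cells. This determines the action of \<open>Q\<close> on 2-cells.
\<close>

locale strictification_2functor = strict_21_category D
  for D :: "('p, 'g, 'b) twocat" (structure) +
  fixes S :: "'p set" and Q0 :: "'p \<Rightarrow> 'p" and Q1 :: "'g \<Rightarrow> 'g" and ev sec :: "'p \<Rightarrow> 'g"
  assumes Q0_in [simp]: "C \<in> Cell0 D \<Longrightarrow> Q0 C \<in> Cell0 D \<and> Q0 C \<in> S"
    and Q1_in [simp]: "F \<in> Cell1 D \<Longrightarrow> Q1 F \<in> Cell1 D \<and> Src1 D (Q1 F) = Q0 (Src1 D F) \<and> Tgt1 D (Q1 F) = Q0 (Tgt1 D F)"
    and Q1_Id1 [simp]: "C \<in> Cell0 D \<Longrightarrow> Q1 (Id1 D C) = Id1 D (Q0 C)"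
    and Q1_Comp1 [simp]: "F \<in> Cell1 D \<Longrightarrow> K \<in> Cell1 D \<Longrightarrow> Src1 D K = Tgt1 D F \<Longrightarrow> Q1 (K \<star> F) = Q1 K \<star> Q1 F"
    and ev_in [simp]: "C \<in> Cell0 D \<Longrightarrow> ev C \<in> Cell1 D \<and> Src1 D (ev C) = Q0 C \<and> Tgt1 D (ev C) = C"
    and sec_in [simp]: "C \<in> Cell0 D \<Longrightarrow> sec C \<in> Cell1 D \<and> Src1 D (sec C) = C \<and> Tgt1 D (sec C) = Q0 C"
    and ev_sec [simp]: "C \<in> Cell0 D \<Longrightarrow> ev C \<star> sec C = Id1 D C"
    and ev_Q1 [simp]: "F \<in> Cell1 D \<Longrightarrow> Tgt1 D F = C \<Longrightarrow> ev C \<star> Q1 F = F \<star> ev (Src1 D F)"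
    and ev_lift: "C \<in> Cell0 D \<Longrightarrow> L \<in> Cell1 D \<Longrightarrow> L' \<in> Cell1 D \<Longrightarrow> Src1 D L' = Src1 D L \<Longrightarrow>
      Tgt1 D L = Q0 C \<Longrightarrow> Tgt1 D L' = Q0 C \<Longrightarrow> \<alpha> \<in> Hom2 D (ev C \<star> L) (ev C \<star> L') \<Longrightarrow>
      \<exists>!\<beta>. \<beta> \<in> Hom2 D L L' \<and> Id2 D (ev C) \<diamondop> \<beta> = \<alpha>"
begin

abbreviation P :: "('p, 'g, 'b) twocat" where "P \<equiv> full_sub_twocat D S"

sublocale P: strict_21_category P
  by (rule strict_21_full_sub) unfold_locales

lemma ev_sec_Comp1 [simp]:
  assumes "f \<in> Cell1 D" "Tgt1 D f = C"
  shows "ev C \<star> sec C \<star> f = f"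
proof -
  have "ev C \<star> sec C \<star> f = (ev C \<star> sec C) \<star> f"
    by (rule Comp1_assoc[symmetric]) (use assms in auto)
  also have "\<dots> = f" using assms by auto
  finally show ?thesis .
qed

lemma ev_sec_Id2 [simp]: "C \<in> Cell0 D \<Longrightarrow> Id2 D (ev C) \<diamondop> Id2 D (sec C) = Id2 D (Id1 D C)"
  by (subst Id2_Comp1[symmetric]) auto

text \<open>
  The naturality equations are used from left to right, which moves all 1-cells \<open>ev\<close> towards the source
  and removes \<open>Q1\<close>. Each equation is also needed in front of a further composite, because composites are
  nested to the right.
\<close>

lemma ev_Q1_Comp1 [simp]:
  "F \<in> Cell1 D \<Longrightarrow> Tgt1 D F = C \<Longrightarrow> h \<in> Cell1 D \<Longrightarrow> Tgt1 D h = Q0 (Src1 D F) \<Longrightarrow>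
    ev C \<star> Q1 F \<star> h = F \<star> ev (Src1 D F) \<star> h"
  using Comp1_assoc[of h "Q1 F" "ev C"] by auto

lemma ev_Q1_Id2 [simp]:
  "F \<in> Cell1 D \<Longrightarrow> Tgt1 D F = C \<Longrightarrow> Id2 D (ev C) \<diamondop> Id2 D (Q1 F) = Id2 D F \<diamondop> Id2 D (ev (Src1 D F))"
  using Id2_Comp1[of "Q1 F" "ev C"] by auto

lemma ev_Q1_HComp [simp]:
  "F \<in> Cell1 D \<Longrightarrow> Tgt1 D F = C \<Longrightarrow> \<alpha> \<in> Cell2 D \<Longrightarrow> Tgt1 D (Src2 D \<alpha>) = Q0 (Src1 D F) \<Longrightarrow>
    Id2 D (ev C) \<diamondop> Id2 D (Q1 F) \<diamondop> \<alpha> = Id2 D F \<diamondop> Id2 D (ev (Src1 D F)) \<diamondop> \<alpha>"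
  using HComp_assoc[of \<alpha> "Id2 D (Q1 F)" "Id2 D (ev C)"] by auto

lemma ev_fill:
  assumes "C \<in> Cell0 D" "L \<in> Cell1 D" "L' \<in> Cell1 D" "Src1 D L' = Src1 D L" "Tgt1 D L = Q0 C" "Tgt1 D L' = Q0 C"
    "\<alpha> \<in> Cell2 D" "Src2 D \<alpha> = ev C \<star> L" "Tgt2 D \<alpha> = ev C \<star> L'"
  obtains \<beta> where "\<beta> \<in> Cell2 D" "Src2 D \<beta> = L" "Tgt2 D \<beta> = L'" "Id2 D (ev C) \<diamondop> \<beta> = \<alpha>"
  using ev_lift[of C L L' \<alpha>] assms that by (auto simp: Hom2_def)

lemma ev_cancel:
  assumes "Id2 D (ev C) \<diamondop> \<beta>' = Id2 D (ev C) \<diamondop> \<beta>" "C \<in> Cell0 D" "\<beta> \<in> Cell2 D" "\<beta>' \<in> Cell2 D"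
    "Src2 D \<beta>' = Src2 D \<beta>" "Tgt2 D \<beta>' = Tgt2 D \<beta>" "Tgt1 D (Src2 D \<beta>) = Q0 C"
  shows "\<beta>' = \<beta>"
proof -
  have "\<exists>!\<gamma>. \<gamma> \<in> Hom2 D (Src2 D \<beta>) (Tgt2 D \<beta>) \<and> Id2 D (ev C) \<diamondop> \<gamma> = Id2 D (ev C) \<diamondop> \<beta>"
    by (rule ev_lift) (use assms in \<open>simp_all add: Hom2_def\<close>)
  moreover have "\<beta> \<in> Hom2 D (Src2 D \<beta>) (Tgt2 D \<beta>)" "\<beta>' \<in> Hom2 D (Src2 D \<beta>) (Tgt2 D \<beta>)"
    using assms by (simp_all add: Hom2_def)
  ultimately show ?thesis using assms(1) by metis
qed

text \<open>
  The unique 2-cell that makes \<open>ev\<close> natural with respect to \<open>\<alpha>\<close>. Functoriality of \<open>Q2\<close> follows from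
  uniqueness, by \<open>ev_cancel\<close>.
\<close>

definition Q2 :: "'b \<Rightarrow> 'b" where
  "Q2 \<alpha> = (THE \<beta>. \<beta> \<in> Hom2 D (Q1 (Src2 D \<alpha>)) (Q1 (Tgt2 D \<alpha>)) \<and>
     Id2 D (ev (Tgt1 D (Src2 D \<alpha>))) \<diamondop> \<beta> = \<alpha> \<diamondop> Id2 D (ev (Src1 D (Src2 D \<alpha>))))"

lemma Q2_spec:
  assumes "\<alpha> \<in> Cell2 D"
  shows "Q2 \<alpha> \<in> Hom2 D (Q1 (Src2 D \<alpha>)) (Q1 (Tgt2 D \<alpha>)) \<and>
     Id2 D (ev (Tgt1 D (Src2 D \<alpha>))) \<diamondop> Q2 \<alpha> = \<alpha> \<diamondop> Id2 D (ev (Src1 D (Src2 D \<alpha>)))"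
  unfolding Q2_def
  by (rule theI', rule ev_lift) (use assms in \<open>simp_all add: Hom2_def\<close>)

lemma Q2_simps [simp]:
  "\<alpha> \<in> Cell2 D \<Longrightarrow> Q2 \<alpha> \<in> Cell2 D" "\<alpha> \<in> Cell2 D \<Longrightarrow> Src2 D (Q2 \<alpha>) = Q1 (Src2 D \<alpha>)"
  "\<alpha> \<in> Cell2 D \<Longrightarrow> Tgt2 D (Q2 \<alpha>) = Q1 (Tgt2 D \<alpha>)"
  "\<alpha> \<in> Cell2 D \<Longrightarrow> Tgt1 D (Src2 D \<alpha>) = C \<Longrightarrow>
    Id2 D (ev C) \<diamondop> Q2 \<alpha> = \<alpha> \<diamondop> Id2 D (ev (Src1 D (Src2 D \<alpha>)))"
  using Q2_spec[of \<alpha>] by (auto simp: Hom2_def)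

lemma ev_Q2_HComp [simp]:
  "\<alpha> \<in> Cell2 D \<Longrightarrow> Tgt1 D (Src2 D \<alpha>) = C \<Longrightarrow> \<beta> \<in> Cell2 D \<Longrightarrow> Tgt1 D (Src2 D \<beta>) = Q0 (Src1 D (Src2 D \<alpha>)) \<Longrightarrow>
    Id2 D (ev C) \<diamondop> Q2 \<alpha> \<diamondop> \<beta> = \<alpha> \<diamondop> Id2 D (ev (Src1 D (Src2 D \<alpha>))) \<diamondop> \<beta>"
  using HComp_assoc[of \<beta> "Q2 \<alpha>" "Id2 D (ev C)"] by auto

lemma Q2_Id2 [simp]: "F \<in> Cell1 D \<Longrightarrow> Q2 (Id2 D F) = Id2 D (Q1 F)"
  by (rule ev_cancel[of "Tgt1 D F"]) simp_all

lemma Q2_VComp [simp]: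
  "\<alpha> \<in> Cell2 D \<Longrightarrow> \<beta> \<in> Cell2 D \<Longrightarrow> Src2 D \<beta> = Tgt2 D \<alpha> \<Longrightarrow> Q2 (\<beta> \<bullet> \<alpha>) = Q2 \<beta> \<bullet> Q2 \<alpha>"
  by (rule ev_cancel[of "Tgt1 D (Src2 D \<alpha>)"]) (simp_all add: whisker)

lemma Q2_HComp [simp]:
  "\<alpha> \<in> Cell2 D \<Longrightarrow> \<beta> \<in> Cell2 D \<Longrightarrow> Src1 D (Src2 D \<beta>) = Tgt1 D (Src2 D \<alpha>) \<Longrightarrow> Q2 (\<beta> \<diamondop> \<alpha>) = Q2 \<beta> \<diamondop> Q2 \<alpha>"
  by (rule ev_cancel[of "Tgt1 D (Src2 D \<beta>)"]) simp_all

text \<open>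
  A cone or a 2-cell over an arbitrary test object \<open>W\<close> becomes one over \<open>Q0 W\<close>, which lies in \<open>S\<close>, by
  precomposition with \<open>ev W\<close>. It is filled there, and precomposition with \<open>sec W\<close> brings the filler back
  because \<open>ev W \<star> sec W\<close> is the identity.
\<close>

lemma product_cone_from_P:
  assumes cone: "product_cone P I Q q"
  shows "product_cone D I Q q"
proof -
  have Q [simp]: "Q \<in> Cell0 D" "Q \<in> S"
    using P.product_coneD(1)[OF cone] by simp_all
  have q [simp]: "q i \<in> Cell1 D" "Src1 D (q i) = Q" "Tgt1 D (q i) \<in> S" if "i \<in> I" for i
    using P.product_coneD(2,3)[OF cone that] by simp_all
  show ?thesis
  proof (rule product_coneI)
    fix W f
    assume W [simp]: "W \<in> Cell0 D"
      and f: "\<And>i. i \<in> I \<Longrightarrow> f i \<in> Cell1 D \<and> Src1 D (f i) = W \<and> Tgt1 D (f i) = Tgt1 D (q i)"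
    obtain h where h: "h \<in> Cell1 P" "Src1 P h = Q0 W" "Tgt1 P h = Q"
      "\<forall>i \<in> I. \<exists>\<alpha>. \<alpha> \<in> Cell2 P \<and> Src2 P \<alpha> = q i \<star>\<^bsub>P\<^esub> h \<and> Tgt2 P \<alpha> = f i \<star> ev W"
      by (rule P.product_cone_fill1[OF cone, of "Q0 W" "\<lambda>i. f i \<star> ev W"]) (use f in auto)
    have "\<exists>\<alpha>. \<alpha> \<in> Cell2 D \<and> Src2 D \<alpha> = q i \<star> h \<star> sec W \<and> Tgt2 D \<alpha> = f i" if i: "i \<in> I" for i
    proof -
      obtain \<alpha> where "\<alpha> \<in> Cell2 D" "Src2 D \<alpha> = q i \<star> h" "Tgt2 D \<alpha> = f i \<star> ev W"
        using h(4) i by auto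
      then show ?thesis using f[OF i] h i by (intro exI[of _ "\<alpha> \<diamondop> Id2 D (sec W)"]) simp
    qed
    then show "\<exists>h. h \<in> Cell1 D \<and> Src1 D h = W \<and> Tgt1 D h = Q \<and>
        (\<forall>i \<in> I. \<exists>\<alpha>. \<alpha> \<in> Cell2 D \<and> Src2 D \<alpha> = q i \<star> h \<and> Tgt2 D \<alpha> = f i)"
      using h by (intro exI[of _ "h \<star> sec W"]) simp
  next
    fix h h' \<alpha>
    assume [simp]: "h \<in> Cell1 D" "h' \<in> Cell1 D" "Src1 D h' = Src1 D h" "Tgt1 D h = Q" "Tgt1 D h' = Q"
      and \<alpha>: "\<And>i. i \<in> I \<Longrightarrow> \<alpha> i \<in> Cell2 D \<and> Src2 D (\<alpha> i) = q i \<star> h \<and> Tgt2 D (\<alpha> i) = q i \<star> h'"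
    let ?W = "Src1 D h"
    obtain \<beta> where \<beta>: "\<beta> \<in> Cell2 P" "Src2 P \<beta> = h \<star> ev ?W" "Tgt2 P \<beta> = h' \<star> ev ?W"
      "\<forall>i \<in> I. Id2 P (q i) \<diamondop>\<^bsub>P\<^esub> \<beta> = \<alpha> i \<diamondop> Id2 D (ev ?W)"
      by (rule P.product_cone_fill2[OF cone, of "h \<star> ev ?W" "h' \<star> ev ?W" "\<lambda>i. \<alpha> i \<diamondop> Id2 D (ev ?W)"])
        (use \<alpha> in auto)
    have "Id2 D (q i) \<diamondop> \<beta> \<diamondop> Id2 D (sec ?W) = \<alpha> i" if i: "i \<in> I" for i
    proof -
      have "Id2 D (q i) \<diamondop> \<beta> \<diamondop> Id2 D (sec ?W) = (Id2 D (q i) \<diamondop> \<beta>) \<diamondop> Id2 D (sec ?W)"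
        using \<beta>(1-3) i by simp
      also have "Id2 D (q i) \<diamondop> \<beta> = \<alpha> i \<diamondop> Id2 D (ev ?W)" using \<beta>(4) i by simp
      also have "(\<alpha> i \<diamondop> Id2 D (ev ?W)) \<diamondop> Id2 D (sec ?W) = \<alpha> i" using \<alpha>[OF i] i by simp
      finally show ?thesis .
    qed
    then show "\<exists>\<beta>. \<beta> \<in> Cell2 D \<and> Src2 D \<beta> = h \<and> Tgt2 D \<beta> = h' \<and> (\<forall>i \<in> I. Id2 D (q i) \<diamondop> \<beta> = \<alpha> i)"
      using \<beta> by (intro exI[of _ "\<beta> \<diamondop> Id2 D (sec ?W)"]) simp
  next
    fix \<beta> \<beta>'
    assume \<beta> [simp]: "\<beta> \<in> Cell2 D" "\<beta>' \<in> Cell2 D" "Src2 D \<beta>' = Src2 D \<beta>" "Tgt2 D \<beta>' = Tgt2 D \<beta>"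
        "Tgt1 D (Src2 D \<beta>) = Q"
      and eq: "\<And>i. i \<in> I \<Longrightarrow> Id2 D (q i) \<diamondop> \<beta>' = Id2 D (q i) \<diamondop> \<beta>"
    let ?W = "Src1 D (Src2 D \<beta>)"
    have "\<beta>' \<diamondop> Id2 D (ev ?W) = \<beta> \<diamondop> Id2 D (ev ?W)"
    proof (rule P.product_cone_cancel[OF cone])
      fix i assume i: "i \<in> I"
      have "(Id2 D (q i) \<diamondop> \<beta>') \<diamondop> Id2 D (ev ?W) = (Id2 D (q i) \<diamondop> \<beta>) \<diamondop> Id2 D (ev ?W)"
        using eq[OF i] by simp
      then show "Id2 P (q i) \<diamondop>\<^bsub>P\<^esub> \<beta>' \<diamondop> Id2 D (ev ?W) = Id2 P (q i) \<diamondop>\<^bsub>P\<^esub> \<beta> \<diamondop> Id2 D (ev ?W)"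
        using i by simp
    qed simp_all
    then have "(\<beta>' \<diamondop> Id2 D (ev ?W)) \<diamondop> Id2 D (sec ?W) = (\<beta> \<diamondop> Id2 D (ev ?W)) \<diamondop> Id2 D (sec ?W)"
      by simp
    then show "\<beta>' = \<beta>" by simp
  qed simp_all
qed

text \<open>
  Postcomposition with \<open>ev\<close> turns the problem into one for the cone \<open>q\<close>, as \<open>ev\<close> is natural. A 1-cell
  into the vertex that solves it is brought back by \<open>sec\<close>, and 2-cells are lifted along \<open>ev\<close>.
\<close>

lemma product_cone_Q:
  assumes cone: "product_cone D I Q q"
  shows "product_cone P I (Q0 Q) (\<lambda>i. Q1 (q i))"
proof -
  note [simp] = product_coneD[OF cone]
  show ?thesis
  proof (rule P.product_coneI)
    fix W f
    assume "W \<in> Cell0 P"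
      and f': "\<And>i. i \<in> I \<Longrightarrow> f i \<in> Cell1 P \<and> Src1 P (f i) = W \<and> Tgt1 P (f i) = Tgt1 P (Q1 (q i))"
    then have W [simp]: "W \<in> Cell0 D" "W \<in> S" by simp_all
    have f [simp]: "f i \<in> Cell1 D" "Src1 D (f i) = W" "Tgt1 D (f i) = Q0 (Tgt1 D (q i))" if "i \<in> I" for i
      using f'[OF that] that by simp_all
    obtain h where h [simp]: "h \<in> Cell1 D" "Src1 D h = W" "Tgt1 D h = Q"
      and fill: "\<forall>i \<in> I. \<exists>\<alpha>. \<alpha> \<in> Cell2 D \<and> Src2 D \<alpha> = q i \<star> h \<and> Tgt2 D \<alpha> = ev (Tgt1 D (q i)) \<star> f i"
      by (rule product_cone_fill1[OF cone, of W "\<lambda>i. ev (Tgt1 D (q i)) \<star> f i"]) auto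
    have "\<exists>\<beta>. \<beta> \<in> Cell2 P \<and> Src2 P \<beta> = Q1 (q i) \<star>\<^bsub>P\<^esub> sec Q \<star> h \<and> Tgt2 P \<beta> = f i" if i: "i \<in> I" for i
    proof -
      obtain \<alpha> where \<alpha>: "\<alpha> \<in> Cell2 D" "Src2 D \<alpha> = q i \<star> h" "Tgt2 D \<alpha> = ev (Tgt1 D (q i)) \<star> f i"
        using fill i by auto
      obtain \<beta> where "\<beta> \<in> Cell2 D" "Src2 D \<beta> = Q1 (q i) \<star> sec Q \<star> h" "Tgt2 D \<beta> = f i"
        by (rule ev_fill[of "Tgt1 D (q i)" "Q1 (q i) \<star> sec Q \<star> h" "f i" \<alpha>]) (use \<alpha> i in simp_all)
      then show ?thesis using i by (intro exI[of _ \<beta>]) simp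
    qed
    then show "\<exists>h. h \<in> Cell1 P \<and> Src1 P h = W \<and> Tgt1 P h = Q0 Q \<and>
        (\<forall>i \<in> I. \<exists>\<beta>. \<beta> \<in> Cell2 P \<and> Src2 P \<beta> = Q1 (q i) \<star>\<^bsub>P\<^esub> h \<and> Tgt2 P \<beta> = f i)"
      using product_coneD(1)[OF cone] by (intro exI[of _ "sec Q \<star> h"]) simp
  next
    fix h h' \<alpha>
    assume "h \<in> Cell1 P" "h' \<in> Cell1 P" "Src1 P h' = Src1 P h" "Tgt1 P h = Q0 Q" "Tgt1 P h' = Q0 Q"
      and \<alpha>': "\<And>i. i \<in> I \<Longrightarrow> \<alpha> i \<in> Cell2 P \<and> Src2 P (\<alpha> i) = Q1 (q i) \<star>\<^bsub>P\<^esub> h \<and> Tgt2 P (\<alpha> i) = Q1 (q i) \<star>\<^bsub>P\<^esub> h'"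
    then have h [simp]: "h \<in> Cell1 D" "h' \<in> Cell1 D" "Src1 D h' = Src1 D h" "Src1 D h \<in> S"
      "Tgt1 D h = Q0 Q" "Tgt1 D h' = Q0 Q" by simp_all
    have \<alpha> [simp]: "\<alpha> i \<in> Cell2 D" "Src2 D (\<alpha> i) = Q1 (q i) \<star> h" "Tgt2 D (\<alpha> i) = Q1 (q i) \<star> h'" if "i \<in> I" for i
      using \<alpha>'[OF that] by simp_all
    obtain \<gamma> where \<gamma>: "\<gamma> \<in> Cell2 D" "Src2 D \<gamma> = ev Q \<star> h" "Tgt2 D \<gamma> = ev Q \<star> h'"
      "\<forall>i \<in> I. Id2 D (q i) \<diamondop> \<gamma> = Id2 D (ev (Tgt1 D (q i))) \<diamondop> \<alpha> i"
      by (rule product_cone_fill2[OF cone, of "ev Q \<star> h" "ev Q \<star> h'" "\<lambda>i. Id2 D (ev (Tgt1 D (q i))) \<diamondop> \<alpha> i"])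
        (use product_coneD(1)[OF cone] in auto)
    obtain \<beta> where \<beta>: "\<beta> \<in> Cell2 D" "Src2 D \<beta> = h" "Tgt2 D \<beta> = h'" "Id2 D (ev Q) \<diamondop> \<beta> = \<gamma>"
      by (rule ev_fill[of Q h h' \<gamma>]) (use \<gamma> product_coneD(1)[OF cone] in simp_all)
    have "Id2 D (Q1 (q i)) \<diamondop> \<beta> = \<alpha> i" if i: "i \<in> I" for i
      by (rule ev_cancel[of "Tgt1 D (q i)"]) (use i \<beta> \<gamma>(4) in simp_all)
    then show "\<exists>\<beta>. \<beta> \<in> Cell2 P \<and> Src2 P \<beta> = h \<and> Tgt2 P \<beta> = h' \<and> (\<forall>i \<in> I. Id2 P (Q1 (q i)) \<diamondop>\<^bsub>P\<^esub> \<beta> = \<alpha> i)"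
      using \<beta> product_coneD(1)[OF cone] by (intro exI[of _ \<beta>]) simp
  next
    fix \<beta> \<beta>'
    assume "\<beta> \<in> Cell2 P" "\<beta>' \<in> Cell2 P" "Src2 P \<beta>' = Src2 P \<beta>" "Tgt2 P \<beta>' = Tgt2 P \<beta>"
        "Tgt1 P (Src2 P \<beta>) = Q0 Q"
      and eq: "\<And>i. i \<in> I \<Longrightarrow> Id2 P (Q1 (q i)) \<diamondop>\<^bsub>P\<^esub> \<beta>' = Id2 P (Q1 (q i)) \<diamondop>\<^bsub>P\<^esub> \<beta>"
    then have \<beta> [simp]: "\<beta> \<in> Cell2 D" "\<beta>' \<in> Cell2 D" "Src2 D \<beta>' = Src2 D \<beta>" "Tgt2 D \<beta>' = Tgt2 D \<beta>"
        "Tgt1 D (Src2 D \<beta>) = Q0 Q" by simp_all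
    show "\<beta>' = \<beta>"
    proof (rule ev_cancel[of Q], rule product_cone_cancel[OF cone])
      fix i assume i: "i \<in> I"
      have "Id2 D (ev (Tgt1 D (q i))) \<diamondop> Id2 D (Q1 (q i)) \<diamondop> \<beta>' =
          Id2 D (ev (Tgt1 D (q i))) \<diamondop> Id2 D (Q1 (q i)) \<diamondop> \<beta>"
        using eq[OF i] by simp
      then show "Id2 D (q i) \<diamondop> Id2 D (ev Q) \<diamondop> \<beta>' = Id2 D (q i) \<diamondop> Id2 D (ev Q) \<diamondop> \<beta>"
        using i by simp
    qed (use product_coneD(1)[OF cone] in simp_all)
  qed (use product_coneD(1)[OF cone] in simp_all)
qed

end

locale mackey_strictification = A: bicategory_cells A + strictification_2functor D S Q0 Q1 ev sec
  for A :: "('o, 'f, 'a, 'z) bicat_scheme" and D :: "('p, 'g, 'b) twocat" (structure) and S Q0 Q1 ev sec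
begin

definition strictify_psfun :: "('o, 'f, 'a, 'p, 'g, 'b) psfun \<Rightarrow> ('o, 'f, 'a, 'p, 'g, 'b) psfun" where
  "strictify_psfun X = \<lparr>P0 = (\<lambda>s \<in> Cell0 A. Q0 (P0 X s)), P1 = (\<lambda>f \<in> Cell1 A. Q1 (P1 X f)),
     P2 = (\<lambda>\<alpha> \<in> Cell2 A. Q2 (P2 X \<alpha>)), PC = (\<lambda>p \<in> composable A. Q2 (PC X p))\<rparr>"

definition strictify_pstrans :: "('o, 'f, 'a, 'p, 'g, 'b) pstrans \<Rightarrow> ('o, 'f, 'a, 'p, 'g, 'b) pstrans" where
  "strictify_pstrans \<theta> = \<lparr>TSrc = strictify_psfun (TSrc \<theta>), TTgt = strictify_psfun (TTgt \<theta>),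
     T0 = (\<lambda>s \<in> Cell0 A. Q1 (T0 \<theta> s)), T1 = (\<lambda>f \<in> Cell1 A. Q2 (T1 \<theta> f))\<rparr>"

text \<open>
  The identity 2-cells are squares for \<open>ev\<close> because \<open>ev\<close> is strictly natural.
\<close>

definition counit :: "('o, 'f, 'a, 'p, 'g, 'b) psfun \<Rightarrow> ('o, 'f, 'a, 'p, 'g, 'b) pstrans" where
  "counit X = \<lparr>TSrc = strictify_psfun X, TTgt = X, T0 = (\<lambda>s \<in> Cell0 A. ev (P0 X s)),
     T1 = (\<lambda>f \<in> Cell1 A. Id2 D (P1 X f \<star> ev (P0 X (Src1 A f))))\<rparr>"

lemma strictify_psfun_simps [simp]:
  "s \<in> Cell0 A \<Longrightarrow> P0 (strictify_psfun X) s = Q0 (P0 X s)"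
  "f \<in> Cell1 A \<Longrightarrow> P1 (strictify_psfun X) f = Q1 (P1 X f)"
  "\<alpha> \<in> Cell2 A \<Longrightarrow> P2 (strictify_psfun X) \<alpha> = Q2 (P2 X \<alpha>)"
  "f \<in> Cell1 A \<Longrightarrow> g \<in> Cell1 A \<Longrightarrow> Src1 A g = Tgt1 A f \<Longrightarrow> PC (strictify_psfun X) (g, f) = Q2 (PC X (g, f))"
  by (simp_all add: strictify_psfun_def)

lemma strictify_pstrans_simps [simp]:
  "TSrc (strictify_pstrans \<theta>) = strictify_psfun (TSrc \<theta>)"
  "TTgt (strictify_pstrans \<theta>) = strictify_psfun (TTgt \<theta>)"
  "s \<in> Cell0 A \<Longrightarrow> T0 (strictify_pstrans \<theta>) s = Q1 (T0 \<theta> s)"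
  "f \<in> Cell1 A \<Longrightarrow> T1 (strictify_pstrans \<theta>) f = Q2 (T1 \<theta> f)"
  by (simp_all add: strictify_pstrans_def)

lemma counit_simps [simp]:
  "TSrc (counit X) = strictify_psfun X" "TTgt (counit X) = X"
  "s \<in> Cell0 A \<Longrightarrow> T0 (counit X) s = ev (P0 X s)"
  "f \<in> Cell1 A \<Longrightarrow> T1 (counit X) f = Id2 D (P1 X f \<star> ev (P0 X (Src1 A f)))"
  by (simp_all add: counit_def)

lemma pseudofunctor_strictify:
  assumes "pseudofunctor A D X"
  shows "pseudofunctor A D (strictify_psfun X)"
proof -
  interpret X: pseudofunctor A D X by fact
  have "strictly_unital_pseudofunctor A D (strictify_psfun X)"
  proof (unfold_locales, goal_cases)
    case (5 \<alpha> f g \<beta> h)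
    then show ?case using arg_cong[OF X.P2_VComp[of \<alpha> \<beta>], of Q2] by (auto simp: Hom2_def)
  next
    case (8 g f \<alpha> f' \<beta> g')
    then show ?case using arg_cong[OF X.PC_nat[of \<alpha> \<beta>], of Q2] by (auto simp: Hom2_def)
  next
    case (9 g f h)
    then show ?case using arg_cong[OF X.spf.PC_assoc[of g f h], of Q2] by simp
  next
    case (10 f s t)
    then show ?case using arg_cong[OF X.spf.PC_lunit[of f s t], of Q2] by (auto simp: Hom1_def)
  next
    case (11 f s t)
    then show ?case using arg_cong[OF X.spf.PC_runit[of f s t], of Q2] by (auto simp: Hom1_def)
  qed (auto simp: Hom1_def Hom2_def Iso2_eq, simp_all add: strictify_psfun_def)
  then show ?thesis by (simp add: pseudofunctor_iff A.bicategory_cells_axioms strict_21_category_axioms)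
qed

lemma pseudonatural_strictify:
  assumes "pseudonatural A D X Y \<theta>"
  shows "pseudonatural A D (strictify_psfun X) (strictify_psfun Y) (strictify_pstrans \<theta>)"
proof -
  interpret \<theta>: pseudonatural A D X Y \<theta> by fact
  show ?thesis
  proof (rule pseudonaturalI, goal_cases)
    case 1 show ?case by (rule pseudofunctor_strictify) unfold_locales
  next
    case 2 show ?case by (rule pseudofunctor_strictify) unfold_locales
  next
    case (7 \<alpha>)
    then show ?case using arg_cong[OF \<theta>.T1_nat[of \<alpha>], of Q2] by simp
  next
    case (9 f g)
    then show ?case using arg_cong[OF \<theta>.T1_Comp1[of f g], of Q2] by simp
  qed (simp_all, simp_all add: strictify_pstrans_def)
qed

lemma pseudonatural_counit:
  assumes "pseudofunctor A D X"
  shows "pseudonatural A D (strictify_psfun X) X (counit X)"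
proof -
  interpret X: pseudofunctor A D X by fact
  show ?thesis
    by (rule pseudonaturalI)
      (simp_all add: assms pseudofunctor_strictify, simp_all add: counit_def)
qed

lemma strictify_pstrans_id:
  assumes "pseudofunctor A D X"
  shows "strictify_pstrans (id_pstrans A D X) = id_pstrans A D (strictify_psfun X)"
proof -
  interpret X: pseudofunctor A D X by fact
  note i = pseudonatural_strictify[OF X.pseudonatural_id] pseudofunctor.pseudonatural_id[OF pseudofunctor_strictify[OF assms]]
  show ?thesis by (rule pseudonatural_eqI[OF i]) simp_all
qed

lemma strictify_pstrans_comp:
  assumes "pseudonatural A D X Y \<theta>" "pseudonatural A D Y Z \<phi>"
  shows "strictify_pstrans (comp_pstrans A D \<phi> \<theta>) = comp_pstrans A D (strictify_pstrans \<phi>) (strictify_pstrans \<theta>)"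
proof -
  interpret \<theta>: pseudonatural A D X Y \<theta> by fact
  interpret \<phi>: pseudonatural A D Y Z \<phi> by fact
  note i = pseudonatural_strictify[OF pseudonatural_comp[OF assms]]
    pseudonatural_comp[OF pseudonatural_strictify[OF assms(1)] pseudonatural_strictify[OF assms(2)]]
  show ?thesis by (rule pseudonatural_eqI[OF i]) simp_all
qed

lemma counit_natural:
  assumes "pseudonatural A D X Y \<theta>"
  shows "comp_pstrans A D \<theta> (counit X) = comp_pstrans A D (counit Y) (strictify_pstrans \<theta>)"
proof -
  interpret \<theta>: pseudonatural A D X Y \<theta> by fact
  have XY: "pseudofunctor A D X" "pseudofunctor A D Y" by unfold_locales
  note i = pseudonatural_comp[OF pseudonatural_counit[OF XY(1)] assms]
    pseudonatural_comp[OF pseudonatural_strictify[OF assms] pseudonatural_counit[OF XY(2)]]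
  show ?thesis by (rule pseudonatural_eqI[OF i]) simp_all
qed

lemma strict_counit:
  assumes "pseudofunctor A D X"
  shows "strict_natural_transformation A D (counit X)"
proof -
  interpret c: pseudonatural A D "strictify_psfun X" X "counit X" by (rule pseudonatural_counit) fact
  show ?thesis
    by unfold_locales (auto simp: Hom1_def)
qed

lemma additive_from_P: "additive A P X \<Longrightarrow> additive A D X"
  unfolding additive_def by (intro allI impI product_cone_from_P) blast

lemma additive_strictify:
  assumes "pseudofunctor A D X" "additive A D X"
  shows "additive A P (strictify_psfun X)"
  unfolding additive_def
proof (intro allI impI)
  interpret X: pseudofunctor A D X by fact
  fix I :: "nat set" and R p
  assume I: "finite I" and R: "product_cone A I R p"
  have "product_cone D I (P0 X R) (\<lambda>i. P1 X (p i))"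
    using assms(2) I R by (simp add: additive_def)
  then have "product_cone P I (Q0 (P0 X R)) (\<lambda>i. Q1 (P1 X (p i)))"
    by (rule product_cone_Q)
  moreover have "R \<in> Cell0 A" "i \<in> I \<Longrightarrow> p i \<in> Cell1 A" for i
    using R by (auto simp: product_cone_def)
  ultimately show "product_cone P I (P0 (strictify_psfun X) R) (\<lambda>i. P1 (strictify_psfun X) (p i))"
    by (simp add: product_cone_def)
qed

lemma A_cells: "bicategory_cells A" and D_21: "strict_21_category D" and P_21: "strict_21_category P"
  by unfold_locales

lemmas Obj_Mack_D = Obj_Mack[OF A_cells D_21] and Obj_Mack_P = Obj_Mack[OF A_cells P_21]
  and Arr_Mack_D = Arr_Mack[OF A_cells D_21] and Arr_Mack_P = Arr_Mack[OF A_cells P_21]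
  and pseudofunctor_P = pseudofunctor_full_sub[OF A_cells D_21]
  and pseudonatural_P = pseudonatural_full_sub[OF A_cells D_21]

sublocale MP: category "Mack A P" by (rule category_Mack[OF A_cells P_21])
sublocale MD: category "Mack A D" by (rule category_Mack[OF A_cells D_21])

lemma inclusion_Obj: "X \<in> Obj (Mack A P) \<Longrightarrow> X \<in> Obj (Mack A D)"
  by (auto simp: Obj_Mack_P Obj_Mack_D pseudofunctor_P additive_from_P)

lemma inclusion_Arr: "\<theta> \<in> Arr (Mack A P) \<Longrightarrow> \<theta> \<in> Arr (Mack A D)"
  by (auto simp: Arr_Mack_P Arr_Mack_D pseudonatural_P inclusion_Obj)

lemma strictify_Obj: "X \<in> Obj (Mack A D) \<Longrightarrow> strictify_psfun X \<in> Obj (Mack A P)"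
  using pseudofunctor_strictify[of X] additive_strictify[of X]
  by (auto simp: Obj_Mack_P Obj_Mack_D pseudofunctor_P dest: strictly_unital_pseudofunctor.P0_in[OF pseudofunctor.strictly_unital])

lemma strictify_Arr:
  assumes "\<theta> \<in> Arr (Mack A D)"
  shows "strictify_pstrans \<theta> \<in> Arr (Mack A P)"
proof -
  have \<theta>: "TSrc \<theta> \<in> Obj (Mack A D)" "TTgt \<theta> \<in> Obj (Mack A D)" "pseudonatural A D (TSrc \<theta>) (TTgt \<theta>) \<theta>"
    using assms by (auto simp: Arr_Mack_D)
  then show ?thesis
    using strictify_Obj[OF \<theta>(1)] strictify_Obj[OF \<theta>(2)] pseudonatural_strictify[OF \<theta>(3)]
    by (simp add: Arr_Mack_P Obj_Mack_P pseudonatural_P pseudofunctor_P)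
qed

lemma counit_Arr:
  assumes "X \<in> Obj (Mack A D)"
  shows "counit X \<in> Hom (Mack A D) (strictify_psfun X) X"
  using assms pseudonatural_counit[of X] inclusion_Obj[OF strictify_Obj[OF assms]]
  by (simp add: Hom_iff Arr_Mack_D Obj_Mack_D)

lemma counit_Arr_P:
  assumes "X \<in> Obj (Mack A P)"
  shows "counit X \<in> Hom (Mack A P) (strictify_psfun X) X"
  using assms counit_Arr[OF inclusion_Obj[OF assms]] strictify_Obj[OF inclusion_Obj[OF assms]]
  by (auto simp: Hom_iff Arr_Mack_D Arr_Mack_P Obj_Mack_P pseudonatural_P pseudofunctor_P)

text \<open>
  The full sub-2-category has the same operations and laws, so strictness is inherited from \<open>D\<close>.
\<close>

lemma strict_counit_P:
  assumes "X \<in> Obj (Mack A P)"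
  shows "strict_natural_transformation A P (counit X)"
proof -
  interpret c: pseudonatural A P "strictify_psfun X" X "counit X"
    using counit_Arr_P[OF assms] by (simp add: Hom_iff Arr_Mack_P)
  interpret s: strict_natural_transformation A D "counit X"
    using inclusion_Obj[OF assms] by (intro strict_counit) (simp add: Obj_Mack_D)
  show ?thesis
    by unfold_locales (use s.T1_strict in simp)
qed

lemma inclusion_functor: "cat_functor (Mack A P) (Mack A D) identity_functor"
  by unfold_locales (auto simp: Hom_iff identity_functor_def inclusion_Obj inclusion_Arr)

definition strictify_Mack where
  "strictify_Mack = \<lparr>OMap = strictify_psfun, AMap = strictify_pstrans\<rparr>"

lemma strictification_functor: "cat_functor (Mack A D) (Mack A P) strictify_Mack"
proof (unfold_locales, goal_cases)
  case (2 \<theta> X Y)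
  then show ?case by (auto simp: Hom_iff strictify_Mack_def strictify_Arr)
next
  case (4 \<theta> X Y \<phi> Z)
  then show ?case
    using strictify_pstrans_comp[of X Y \<theta> Z \<phi>] by (auto simp: Hom_iff strictify_Mack_def Arr_Mack_D)
qed (auto simp: strictify_Mack_def strictify_Obj Obj_Mack_D strictify_pstrans_id)

lemma counit_natural_D:
  "natural_transformation (Mack A D) (Mack A D) (comp_functor identity_functor strictify_Mack) identity_functor counit"
proof (rule natural_transformationI)
  show "cat_functor (Mack A D) (Mack A D) (comp_functor identity_functor strictify_Mack)"
    by (rule cat_functor_comp[OF strictification_functor inclusion_functor])
  show "cat_functor (Mack A D) (Mack A D) identity_functor"
    by (rule cat_functor_identity) unfold_locales
  fix \<theta> assume "\<theta> \<in> Arr (Mack A D)"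
  then show "AMap identity_functor \<theta> \<cdot>\<^bsub>Mack A D\<^esub> counit (Dom (Mack A D) \<theta>) =
      counit (Cod (Mack A D) \<theta>) \<cdot>\<^bsub>Mack A D\<^esub> AMap (comp_functor identity_functor strictify_Mack) \<theta>"
    using counit_natural[of "TSrc \<theta>" "TTgt \<theta>" \<theta>]
    by (simp add: comp_functor_def identity_functor_def strictify_Mack_def Arr_Mack_D)
qed (use counit_Arr in \<open>simp add: comp_functor_def identity_functor_def strictify_Mack_def\<close>)

lemma counit_natural_P:
  "natural_transformation (Mack A P) (Mack A P) (comp_functor strictify_Mack identity_functor) identity_functor counit"
proof (rule natural_transformationI)
  show "cat_functor (Mack A P) (Mack A P) (comp_functor strictify_Mack identity_functor)"
    by (rule cat_functor_comp[OF inclusion_functor strictification_functor])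
  show "cat_functor (Mack A P) (Mack A P) identity_functor"
    by (rule cat_functor_identity) unfold_locales
  fix \<theta> assume "\<theta> \<in> Arr (Mack A P)"
  then have "\<theta> \<in> Arr (Mack A D)" by (rule inclusion_Arr)
  then show "AMap identity_functor \<theta> \<cdot>\<^bsub>Mack A P\<^esub> counit (Dom (Mack A P) \<theta>) =
      counit (Cod (Mack A P) \<theta>) \<cdot>\<^bsub>Mack A P\<^esub> AMap (comp_functor strictify_Mack identity_functor) \<theta>"
    using counit_natural[of "TSrc \<theta>" "TTgt \<theta>" \<theta>]
    by (simp add: comp_functor_def identity_functor_def strictify_Mack_def Arr_Mack_D)
qed (use counit_Arr_P in \<open>simp add: comp_functor_def identity_functor_def strictify_Mack_def\<close>)

end



section \<open>Symmetric monoidal categories form a strict (2,1)-category\<close>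

lemma strong_iff_smf: "strong_monoidal_functor F \<longleftrightarrow> smf (Src F) (Tgt F) F"
  by (simp add: smf_def)

lemma SymMonCat_simps [simp]:
  "Cell0 SymMonCat = {C. symmetric_monoidal_category C}"
  "Cell1 SymMonCat = {F. strong_monoidal_functor F}"
  "Cell2 SymMonCat = {\<alpha>. monoidal_natural_isomorphism \<alpha>}"
  "Src1 SymMonCat = Src" "Tgt1 SymMonCat = Tgt" "Src2 SymMonCat = NSrc" "Tgt2 SymMonCat = NTgt"
  "Id1 SymMonCat = id_smfun" "Id2 SymMonCat = id_smnat" "Comp1 SymMonCat = comp_smfun"
  "VComp SymMonCat = vcomp_smnat" "HComp SymMonCat = hcomp_smnat"
  by (simp_all add: SymMonCat_def)

lemma monoidal_natural_isomorphismD: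
  assumes "monoidal_natural_isomorphism \<alpha>"
  shows "Src (NTgt \<alpha>) = Src (NSrc \<alpha>)" "Tgt (NTgt \<alpha>) = Tgt (NSrc \<alpha>)"
    and "B = Src (NSrc \<alpha>) \<Longrightarrow> C = Tgt (NSrc \<alpha>) \<Longrightarrow> F = NSrc \<alpha> \<Longrightarrow> smn B C F (NTgt \<alpha>) \<alpha>"
proof -
  interpret \<alpha>: monoidal_natural_isomorphism \<alpha> by fact
  show "Src (NTgt \<alpha>) = Src (NSrc \<alpha>)" "Tgt (NTgt \<alpha>) = Tgt (NSrc \<alpha>)" by (fact \<alpha>.Src_eq, fact \<alpha>.Tgt_eq)
  then show "smn B C F (NTgt \<alpha>) \<alpha>" if "B = Src (NSrc \<alpha>)" "C = Tgt (NSrc \<alpha>)" "F = NSrc \<alpha>"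
    using \<alpha>.monoidal_natural_isomorphism_axioms \<alpha>.F.strong_monoidal_functor_axioms
      \<alpha>.G.strong_monoidal_functor_axioms that
    by (simp add: smn_def smf_def)
qed

lemma smfD: "smf B C F \<Longrightarrow> strong_monoidal_functor F \<and> Src F = B \<and> Tgt F = C"
  by (simp add: smf_def)

lemma smnD: "smn B C F G \<alpha> \<Longrightarrow> monoidal_natural_isomorphism \<alpha> \<and> NSrc \<alpha> = F \<and> NTgt \<alpha> = G"
  by (simp add: smn_def)

lemma vcomp_smnat_assoc:
  assumes "smn B C F G \<alpha>" "smn B C G H \<beta>" "smn B C H K \<gamma>"
  shows "vcomp_smnat (vcomp_smnat \<gamma> \<beta>) \<alpha> = vcomp_smnat \<gamma> (vcomp_smnat \<beta> \<alpha>)"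
proof -
  interpret \<alpha>: smn B C F G \<alpha> by fact
  interpret \<beta>: smn B C G H \<beta> by fact
  interpret \<gamma>: smn B C H K \<gamma> by fact
  show ?thesis
    by (rule smnat_eqI[of B C F K]) (use assms in \<open>auto intro: vcomp_smn\<close>)
qed

lemma vcomp_id_smnat:
  assumes "smn B C F G \<alpha>"
  shows "vcomp_smnat (id_smnat G) \<alpha> = \<alpha>" "vcomp_smnat \<alpha> (id_smnat F) = \<alpha>"
proof -
  interpret \<alpha>: smn B C F G \<alpha> by fact
  note id = id_smn[OF \<alpha>.smf_src] id_smn[OF \<alpha>.smf_tgt]
  show "vcomp_smnat (id_smnat G) \<alpha> = \<alpha>" "vcomp_smnat \<alpha> (id_smnat F) = \<alpha>"
    by (rule smnat_eqI[of B C F G], use assms id in \<open>auto intro: vcomp_smn\<close>)+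
qed

lemma hcomp_smnat_assoc:
  assumes "smn A B F F' \<alpha>" "smn B C G G' \<beta>" "smn C E H H' \<gamma>"
  shows "hcomp_smnat (hcomp_smnat \<gamma> \<beta>) \<alpha> = hcomp_smnat \<gamma> (hcomp_smnat \<beta> \<alpha>)"
proof -
  interpret \<alpha>: smn A B F F' \<alpha> by fact
  interpret \<beta>: smn B C G G' \<beta> by fact
  interpret \<gamma>: smn C E H H' \<gamma> by fact
  note l = hcomp_smn[OF assms(1) hcomp_smn[OF assms(2,3)]]
  note r = hcomp_smn[OF hcomp_smn[OF assms(1,2)] assms(3)]
  show ?thesis
    by (rule smnat_eqI[OF l r[folded comp_smfun_assoc[OF \<alpha>.smf_src \<beta>.smf_src \<gamma>.smf_src]
          comp_smfun_assoc[OF \<alpha>.smf_tgt \<beta>.smf_tgt \<gamma>.smf_tgt]]]) simp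
qed

lemma hcomp_id_smnat:
  assumes "smn B C F G \<alpha>"
  shows "hcomp_smnat (id_smnat (id_smfun C)) \<alpha> = \<alpha>" "hcomp_smnat \<alpha> (id_smnat (id_smfun B)) = \<alpha>"
proof -
  interpret \<alpha>: smn B C F G \<alpha> by fact
  have id: "smn C C (id_smfun C) (id_smfun C) (id_smnat (id_smfun C))"
    "smn B B (id_smfun B) (id_smfun B) (id_smnat (id_smfun B))"
    by (intro id_smn id_smf \<alpha>.F.C.symmetric_monoidal_category_axioms \<alpha>.F.B.symmetric_monoidal_category_axioms)+
  note l = hcomp_smn[OF assms id(1)] and r = hcomp_smn[OF id(2) assms]
  show "hcomp_smnat (id_smnat (id_smfun C)) \<alpha> = \<alpha>"
    by (rule smnat_eqI[OF l[unfolded comp_id_smfun[OF \<alpha>.smf_src] comp_id_smfun[OF \<alpha>.smf_tgt]] assms]) simp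
  show "hcomp_smnat \<alpha> (id_smnat (id_smfun B)) = \<alpha>"
    by (rule smnat_eqI[OF r[unfolded comp_id_smfun[OF \<alpha>.smf_src] comp_id_smfun[OF \<alpha>.smf_tgt]] assms]) simp
qed

lemma id_smnat_comp:
  assumes "smf A B F" "smf B C G"
  shows "id_smnat (comp_smfun G F) = hcomp_smnat (id_smnat G) (id_smnat F)"
proof -
  interpret F: smf A B F by fact
  interpret G: smf B C G by fact
  show ?thesis
    by (rule smnat_eqI[OF id_smn[OF comp_smf[OF assms]] hcomp_smn[OF id_smn[OF assms(1)] id_smn[OF assms(2)]]]) simp
qed

lemma interchange_smnat:
  fixes C (structure)
  assumes \<alpha>: "smn A B F F' \<alpha>" "smn A B F' F'' \<alpha>'" and \<beta>: "smn B C G G' \<beta>" "smn B C G' G'' \<beta>'"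
  shows "hcomp_smnat (vcomp_smnat \<beta>' \<beta>) (vcomp_smnat \<alpha>' \<alpha>) =
    vcomp_smnat (hcomp_smnat \<beta>' \<alpha>') (hcomp_smnat \<beta> \<alpha>)"
proof -
  interpret \<alpha>: smn A B F F' \<alpha> by fact
  interpret \<alpha>': smn A B F' F'' \<alpha>' by fact
  interpret \<beta>: smn B C G G' \<beta> by fact
  interpret \<beta>': smn B C G' G'' \<beta>' by fact
  note l = hcomp_smn[OF vcomp_smn[OF \<alpha>] vcomp_smn[OF \<beta>]]
    and r = vcomp_smn[OF hcomp_smn[OF \<alpha>(1) \<beta>(1)] hcomp_smn[OF \<alpha>(2) \<beta>(2)]]
  show ?thesis
  proof (rule smnat_eqI[OF l r])
    fix x assume x: "x \<in> Obj A"
    have "NMap \<beta> (OMap F'' x) \<cdot> AMap G (NMap \<alpha>' x) \<cdot> AMap G (NMap \<alpha> x) =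
        (NMap \<beta> (OMap F'' x) \<cdot> AMap G (NMap \<alpha>' x)) \<cdot> AMap G (NMap \<alpha> x)"
      using x by simp
    also have "\<dots> = (AMap G' (NMap \<alpha>' x) \<cdot> NMap \<beta> (OMap F' x)) \<cdot> AMap G (NMap \<alpha> x)"
      using x \<beta>.NMap_nat[of "NMap \<alpha>' x"] by simp
    finally show "NMap (hcomp_smnat (vcomp_smnat \<beta>' \<beta>) (vcomp_smnat \<alpha>' \<alpha>)) x =
        NMap (vcomp_smnat (hcomp_smnat \<beta>' \<alpha>') (hcomp_smnat \<beta> \<alpha>)) x"
      using x by simp
  qed
qed

lemma strict_21_SymMonCat: "strict_21_category SymMonCat"
proof -
  note smn = monoidal_natural_isomorphismD(3) and bd = monoidal_natural_isomorphismD(1,2)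
  have smf: "strong_monoidal_functor F \<Longrightarrow> B = Src F \<Longrightarrow> C = Tgt F \<Longrightarrow> smf B C F" for B C F
    by (simp add: strong_iff_smf)
  show ?thesis
  proof (unfold_locales, goal_cases)
    case (1 F) then show ?case by (simp add: strong_monoidal_functor_def)
  next
    case (2 F) then show ?case by (simp add: strong_monoidal_functor_def)
  next
    case (3 \<alpha>) then show ?case by (simp add: monoidal_natural_isomorphism_def)
  next
    case (4 \<alpha>) then show ?case by (simp add: monoidal_natural_isomorphism_def)
  next
    case (5 \<alpha>) then show ?case by (simp add: bd)
  next
    case (6 \<alpha>) then show ?case by (simp add: bd)
  next
    case (7 C) then show ?case using smfD[OF id_smf] by simp
  next
    case (8 F G) then show ?case using smfD[OF comp_smf[of "Src F" "Tgt F" F "Tgt G" G]] by (simp add: smf)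
  next
    case (9 F) then show ?case using smnD[OF id_smn[of "Src F" "Tgt F" F]] by (simp add: smf)
  next
    case (10 \<alpha> \<beta>)
    then have "smn (Src (NSrc \<alpha>)) (Tgt (NSrc \<alpha>)) (NSrc \<alpha>) (NTgt \<alpha>) \<alpha>"
      "smn (Src (NSrc \<alpha>)) (Tgt (NSrc \<alpha>)) (NTgt \<alpha>) (NTgt \<beta>) \<beta>"
      by (simp_all add: smn bd)
    from smnD[OF vcomp_smn[OF this]] show ?case by simp
  next
    case (11 \<alpha> \<beta>)
    then have "smn (Src (NSrc \<alpha>)) (Tgt (NSrc \<alpha>)) (NSrc \<alpha>) (NTgt \<alpha>) \<alpha>"
      "smn (Tgt (NSrc \<alpha>)) (Tgt (NSrc \<beta>)) (NSrc \<beta>) (NTgt \<beta>) \<beta>"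
      by (simp_all add: smn)
    from smnD[OF hcomp_smn[OF this]] show ?case by simp
  next
    case (12 F G H)
    then show ?case using comp_smfun_assoc[of "Src F" "Tgt F" F "Tgt G" G "Tgt H" H] by (simp add: smf)
  next
    case (13 F C) then show ?case using comp_id_smfun(2)[of "Src F" C F] by (simp add: smf)
  next
    case (14 F C) then show ?case using comp_id_smfun(1)[of C "Tgt F" F] by (simp add: smf)
  next
    case (15 \<alpha> \<beta> \<gamma>)
    then show ?case
      using vcomp_smnat_assoc[of "Src (NSrc \<alpha>)" "Tgt (NSrc \<alpha>)" "NSrc \<alpha>" "NTgt \<alpha>" \<alpha> "NTgt \<beta>" \<beta> "NTgt \<gamma>" \<gamma>]
      by (simp add: smn bd)
  next
    case (16 \<alpha>)
    then show ?case
      using vcomp_id_smnat(1)[of "Src (NSrc \<alpha>)" "Tgt (NSrc \<alpha>)" "NSrc \<alpha>" "NTgt \<alpha>" \<alpha>] by (simp add: smn)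
  next
    case (17 \<alpha>)
    then show ?case
      using vcomp_id_smnat(2)[of "Src (NSrc \<alpha>)" "Tgt (NSrc \<alpha>)" "NSrc \<alpha>" "NTgt \<alpha>" \<alpha>] by (simp add: smn)
  next
    case (18 \<alpha> \<beta> \<gamma>)
    then show ?case
      using hcomp_smnat_assoc[of "Src (NSrc \<alpha>)" "Tgt (NSrc \<alpha>)" "NSrc \<alpha>" "NTgt \<alpha>" \<alpha>
          "Tgt (NSrc \<beta>)" "NSrc \<beta>" "NTgt \<beta>" \<beta> "Tgt (NSrc \<gamma>)" "NSrc \<gamma>" "NTgt \<gamma>" \<gamma>]
      by (simp add: smn)
  next
    case (19 \<alpha> C)
    then show ?case
      using hcomp_id_smnat(1)[of "Src (NSrc \<alpha>)" C "NSrc \<alpha>" "NTgt \<alpha>" \<alpha>] by (simp add: smn)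
  next
    case (20 \<alpha> C)
    then show ?case
      using hcomp_id_smnat(2)[of C "Tgt (NSrc \<alpha>)" "NSrc \<alpha>" "NTgt \<alpha>" \<alpha>] by (simp add: smn)
  next
    case (21 F G) then show ?case using id_smnat_comp[of "Src F" "Tgt F" F "Tgt G" G] by (simp add: smf)
  next
    case (22 \<alpha> \<alpha>' \<beta> \<beta>')
    then show ?case
      using interchange_smnat[of "Src (NSrc \<alpha>)" "Tgt (NSrc \<alpha>)" "NSrc \<alpha>" "NTgt \<alpha>" \<alpha> "NTgt \<alpha>'" \<alpha>'
          "Tgt (NSrc \<beta>)" "NSrc \<beta>" "NTgt \<beta>" \<beta> "NTgt \<beta>'" \<beta>']
      by (simp add: smn bd)
  next
    case (23 \<alpha>)
    then have "smn (Src (NSrc \<alpha>)) (Tgt (NSrc \<alpha>)) (NSrc \<alpha>) (NTgt \<alpha>) \<alpha>" by (simp add: smn)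
    from invertible_smn[OF this] show ?case by (auto dest: smnD)
  qed
qed

lemma strictification_SymMonCat:
  "strictification_2functor (SymMonCat :: 'u::infinite smc_twocat) {C. permutative_category C}
    strictify strictify_functor evaluation inclusion"
proof -
  interpret strict_21_category "SymMonCat :: 'u smc_twocat" by (rule strict_21_SymMonCat)
  have small: "small_symmetric_monoidal_category C" if "symmetric_monoidal_category C" for C :: "('u, 'u) smc"
    using that by (simp add: small_symmetric_monoidal_category_def)
  have smf: "strong_monoidal_functor F \<Longrightarrow> B = Src F \<Longrightarrow> C = Tgt F \<Longrightarrow> smf B C F" for B C and F :: "('u, 'u) smfun"
    by (simp add: strong_iff_smf)
  have smc: "strong_monoidal_functor F \<Longrightarrow> symmetric_monoidal_category (Src F) \<and> symmetric_monoidal_category (Tgt F)"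
    for F :: "('u, 'u) smfun" by (simp add: strong_monoidal_functor_def)
  show ?thesis
  proof (unfold_locales, goal_cases)
    case (1 C)
    then show ?case
      using small_symmetric_monoidal_category.permutative_strictify[OF small[of C]]
      by (simp add: permutative_category_def)
  next
    case (2 F)
    then show ?case using smfD[OF smf_strictify_functor[of "Src F" "Tgt F" F]] by (simp add: smf)
  next
    case (3 C)
    then show ?case using strictify_functor_id by simp
  next
    case (4 F G)
    then show ?case using strictify_functor_comp[of "Src F" "Tgt F" F "Tgt G" G] by (simp add: smf)
  next
    case (5 C)
    then show ?case using smfD[OF small_symmetric_monoidal_category.smf_evaluation[OF small[of C]]] by simp
  next
    case (6 C)
    then show ?case using smfD[OF small_symmetric_monoidal_category.smf_inclusion[OF small[of C]]] by simp
  next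
    case (7 C)
    then show ?case using small_symmetric_monoidal_category.evaluation_inclusion[OF small[of C]] by simp
  next
    case (8 F C)
    then show ?case using evaluation_natural[of "Src F" C F] by (simp add: smf)
  next
    case (9 C L L' \<alpha>)
    then have L: "smf (Src L) (strictify C) L" "smf (Src L) (strictify C) L'" and C: "small_symmetric_monoidal_category C"
      by (auto intro: smf small)
    note ev = small_symmetric_monoidal_category.smf_evaluation[OF C]
    have \<alpha>: "smn (Src L) C (comp_smfun (evaluation C) L) (comp_smfun (evaluation C) L') \<alpha>"
      using 9 by (simp add: Hom2_def) (metis monoidal_natural_isomorphismD(3) comp_smfun_simps(1,2) evaluation_simps(2))
    have "smn (Src L) (strictify C) L L' \<beta> \<longleftrightarrow> \<beta> \<in> Hom2 SymMonCat L L'" for \<beta>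
    proof
      assume "\<beta> \<in> Hom2 SymMonCat L L'"
      then show "smn (Src L) (strictify C) L L' \<beta>"
        using monoidal_natural_isomorphismD(3)[of \<beta>] 9 by (auto simp: Hom2_def)
    qed (auto simp: Hom2_def dest: smnD)
    then show ?case
      using small_symmetric_monoidal_category.lift_smn[OF C L \<alpha>] by simp
  qed
qed


section \<open>Spans of finite G-sets\<close>

lemma group_actionI:
  assumes G: "group G"
    and ext: "\<And>g. g \<in> carrier G \<Longrightarrow> \<phi> g \<in> extensional E"
    and mem: "\<And>g x. g \<in> carrier G \<Longrightarrow> x \<in> E \<Longrightarrow> \<phi> g x \<in> E"
    and one: "\<And>x. x \<in> E \<Longrightarrow> \<phi> \<one>\<^bsub>G\<^esub> x = x"
    and mult: "\<And>g h x. g \<in> carrier G \<Longrightarrow> h \<in> carrier G \<Longrightarrow> x \<in> E \<Longrightarrow> \<phi> (g \<otimes>\<^bsub>G\<^esub> h) x = \<phi> g (\<phi> h x)"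
  shows "group_action G E \<phi>"
proof -
  interpret group G by (rule G)
  have bij: "\<phi> g \<in> Bij E" if g: "g \<in> carrier G" for g
  proof -
    have "bij_betw (\<phi> g) E E"
      by (rule bij_betw_byWitness[where f' = "\<phi> (inv\<^bsub>G\<^esub> g)"])
        (use g mem one in \<open>auto simp flip: mult\<close>)
    then show ?thesis using ext[OF g] by (simp add: Bij_def)
  qed
  have "\<phi> \<in> hom G (BijGroup E)"
  proof (rule homI)
    show "\<phi> g \<in> carrier (BijGroup E)" if "g \<in> carrier G" for g using bij[OF that] by (simp add: BijGroup_def)
    fix g h assume gh: "g \<in> carrier G" "h \<in> carrier G"
    have "\<phi> (g \<otimes>\<^bsub>G\<^esub> h) = compose E (\<phi> g) (\<phi> h)"
    proof (rule extensionalityI)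
      show "\<phi> (g \<otimes>\<^bsub>G\<^esub> h) \<in> extensional E" using ext gh by simp
    qed (use gh mult in \<open>auto simp: compose_def\<close>)
    then show "\<phi> (g \<otimes>\<^bsub>G\<^esub> h) = \<phi> g \<otimes>\<^bsub>BijGroup E\<^esub> \<phi> h"
      using bij gh by (simp add: BijGroup_def)
  qed
  then show ?thesis
    using group_BijGroup G by (simp add: group_action_def group_hom_def group_hom_axioms_def)
qed

lemma finite_gset_pullback:
  assumes "group G" and U: "finite_gset G U" and V: "finite_gset G V"
    and r: "r \<in> equivariant_maps G U T" and l: "l \<in> equivariant_maps G V T"
  shows "finite_gset G (pullback_gset G U V r l)"
proof -
  interpret group G by fact
  interpret U: group_action G "Car U" "Act U" using U by (simp add: finite_gset_def)
  interpret V: group_action G "Car V" "Act V" using V by (simp add: finite_gset_def)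
  let ?P = "{Tup u v |u v. u \<in> Car U \<and> v \<in> Car V \<and> r u = l v}"
  have "?P \<subseteq> (\<lambda>(u, v). Tup u v) ` (Car U \<times> Car V)" by auto
  then have "finite ?P" using U V finite_subset by (fastforce simp: finite_gset_def)
  moreover have "group_action G ?P (\<lambda>g \<in> carrier G. \<lambda>z \<in> ?P. case z of Tup u v \<Rightarrow> Tup (Act U g u) (Act V g v))"
  proof (rule group_actionI)
    show "group G" by fact
    have mem: "Tup (Act U g u) (Act V g v) \<in> ?P" if "g \<in> carrier G" "u \<in> Car U" "v \<in> Car V" "r u = l v" for g u v
      using that r l U.element_image[of g u] V.element_image[of g v] by (auto simp: equivariant_maps_def)
    show "(\<lambda>g \<in> carrier G. \<lambda>z \<in> ?P. case z of Tup u v \<Rightarrow> Tup (Act U g u) (Act V g v)) g z \<in> ?P"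
      if "g \<in> carrier G" "z \<in> ?P" for g z
      using that mem by auto
    show "(\<lambda>g \<in> carrier G. \<lambda>z \<in> ?P. case z of Tup u v \<Rightarrow> Tup (Act U g u) (Act V g v)) \<one>\<^bsub>G\<^esub> z = z"
      if "z \<in> ?P" for z
      using that U.id_eq_one V.id_eq_one by (auto simp: fun_eq_iff) (metis restrict_apply')+
    show "(\<lambda>g \<in> carrier G. \<lambda>z \<in> ?P. case z of Tup u v \<Rightarrow> Tup (Act U g u) (Act V g v)) (g \<otimes>\<^bsub>G\<^esub> h) z =
        (\<lambda>g \<in> carrier G. \<lambda>z \<in> ?P. case z of Tup u v \<Rightarrow> Tup (Act U g u) (Act V g v)) g
        ((\<lambda>g \<in> carrier G. \<lambda>z \<in> ?P. case z of Tup u v \<Rightarrow> Tup (Act U g u) (Act V g v)) h z)"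
      if "g \<in> carrier G" "h \<in> carrier G" "z \<in> ?P" for g h z
      using that mem U.composition_rule V.composition_rule by auto
  qed simp
  ultimately show ?thesis by (simp add: finite_gset_def pullback_gset_def Let_def)
qed

lemma Act_in:
  assumes "finite_gset G S" "g \<in> carrier G" "x \<in> Car S"
  shows "Act S g x \<in> Car S"
proof -
  interpret group_action G "Car S" "Act S" using assms by (simp add: finite_gset_def)
  show ?thesis by (rule element_image[OF assms(2,3) refl])
qed

lemma comp_span_simps [simp]:
  "SSrc (comp_span G h f) = SSrc f" "STgt (comp_span G h f) = STgt h"
  "Tup u v \<in> Car (Apex (comp_span G h f)) \<longleftrightarrow>
    u \<in> Car (Apex f) \<and> v \<in> Car (Apex h) \<and> LegR f u = LegL h v"
  "Elt x \<notin> Car (Apex (comp_span G h f))"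
  "Tup u v \<in> Car (Apex (comp_span G h f)) \<Longrightarrow> LegL (comp_span G h f) (Tup u v) = LegL f u"
  "Tup u v \<in> Car (Apex (comp_span G h f)) \<Longrightarrow> LegR (comp_span G h f) (Tup u v) = LegR h v"
  "g \<in> carrier G \<Longrightarrow> Tup u v \<in> Car (Apex (comp_span G h f)) \<Longrightarrow>
    Act (Apex (comp_span G h f)) g (Tup u v) = Tup (Act (Apex f) g u) (Act (Apex h) g v)"
  by (auto simp: comp_span_def pullback_gset_def Let_def)

lemma comp_span_cases [consumes 1]:
  assumes "z \<in> Car (Apex (comp_span G h f))"
  obtains u v where "z = Tup u v" "u \<in> Car (Apex f)" "v \<in> Car (Apex h)" "LegR f u = LegL h v"
  using assms by (cases z) auto

lemma id_span_simps [simp]: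
  "SSrc (id_span S) = S" "STgt (id_span S) = S" "Apex (id_span S) = S"
  "x \<in> Car S \<Longrightarrow> LegL (id_span S) x = x" "x \<in> Car S \<Longrightarrow> LegR (id_span S) x = x"
  by (simp_all add: id_span_def)

lemma is_span_legs:
  assumes "is_span G f" "u \<in> Car (Apex f)"
  shows "LegL f u \<in> Car (SSrc f)" "LegR f u \<in> Car (STgt f)"
    and "g \<in> carrier G \<Longrightarrow> Act (Apex f) g u \<in> Car (Apex f)"
    and "g \<in> carrier G \<Longrightarrow> LegL f (Act (Apex f) g u) = Act (SSrc f) g (LegL f u)"
    and "g \<in> carrier G \<Longrightarrow> LegR f (Act (Apex f) g u) = Act (STgt f) g (LegR f u)"
  using assms Act_in[of G "Apex f"] by (auto simp: is_span_def equivariant_maps_def)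

lemma is_span_gsets: "is_span G f \<Longrightarrow> finite_gset G (SSrc f)" "is_span G f \<Longrightarrow> finite_gset G (STgt f)"
  by (simp_all add: is_span_def)

lemma is_span_id: "finite_gset G S \<Longrightarrow> is_span G (id_span S)"
  by (auto simp: is_span_def id_span_def equivariant_maps_def Act_in)

lemma is_span_comp:
  assumes G: "group G" and f: "is_span G f" and h: "is_span G h" and eq: "SSrc h = STgt f"
  shows "is_span G (comp_span G h f)"
proof -
  let ?c = "comp_span G h f"
  have "Apex ?c = pullback_gset G (Apex f) (Apex h) (LegR f) (LegL h)"
    by (simp add: comp_span_def Let_def)
  then have P: "finite_gset G (Apex ?c)"
    using finite_gset_pullback[OF G, of "Apex f" "Apex h" "LegR f" "STgt f" "LegL h"] f h eq
    by (simp add: is_span_def)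
  have "LegL ?c \<in> extensional (Car (Apex ?c))" "LegR ?c \<in> extensional (Car (Apex ?c))"
    by (simp_all add: comp_span_def Let_def)
  moreover have "LegL ?c z \<in> Car (SSrc f) \<and> LegR ?c z \<in> Car (STgt h)" if "z \<in> Car (Apex ?c)" for z
    using that is_span_legs[OF f] is_span_legs[OF h] by (auto elim!: comp_span_cases)
  moreover have "LegL ?c (Act (Apex ?c) g z) = Act (SSrc f) g (LegL ?c z) \<and>
      LegR ?c (Act (Apex ?c) g z) = Act (STgt h) g (LegR ?c z)" if "g \<in> carrier G" "z \<in> Car (Apex ?c)" for g z
    using that is_span_legs[OF f] is_span_legs[OF h] eq by (auto elim!: comp_span_cases)
  ultimately show ?thesis
    using P f h by (auto simp: is_span_def equivariant_maps_def PiE_iff)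
qed

text \<open>Here \<open>n\<close> is an inverse of the map of apexes.\<close>

lemma is_span_isoI:
  assumes "is_span G (MSrc \<alpha>)" "is_span G (MTgt \<alpha>)" "SSrc (MTgt \<alpha>) = SSrc (MSrc \<alpha>)" "STgt (MTgt \<alpha>) = STgt (MSrc \<alpha>)"
    and "MMap \<alpha> \<in> extensional (Car (Apex (MSrc \<alpha>)))"
    and "\<And>u. u \<in> Car (Apex (MSrc \<alpha>)) \<Longrightarrow> MMap \<alpha> u \<in> Car (Apex (MTgt \<alpha>)) \<and> n (MMap \<alpha> u) = u \<and>
      LegL (MTgt \<alpha>) (MMap \<alpha> u) = LegL (MSrc \<alpha>) u \<and> LegR (MTgt \<alpha>) (MMap \<alpha> u) = LegR (MSrc \<alpha>) u"
    and "\<And>g u. g \<in> carrier G \<Longrightarrow> u \<in> Car (Apex (MSrc \<alpha>)) \<Longrightarrow>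
      MMap \<alpha> (Act (Apex (MSrc \<alpha>)) g u) = Act (Apex (MTgt \<alpha>)) g (MMap \<alpha> u)"
    and "\<And>v. v \<in> Car (Apex (MTgt \<alpha>)) \<Longrightarrow> n v \<in> Car (Apex (MSrc \<alpha>)) \<and> MMap \<alpha> (n v) = v"
  shows "is_span_iso G \<alpha>"
proof -
  have "bij_betw (MMap \<alpha>) (Car (Apex (MSrc \<alpha>))) (Car (Apex (MTgt \<alpha>)))"
    by (rule bij_betw_byWitness[where f' = n]) (use assms(6,8) in auto)
  then show ?thesis
    using assms(1-7) by (auto simp: is_span_iso_def equivariant_maps_def PiE_iff)
qed

lemma is_span_isoD:
  assumes "is_span_iso G \<alpha>"
  shows "is_span G (MSrc \<alpha>)" "is_span G (MTgt \<alpha>)" "SSrc (MTgt \<alpha>) = SSrc (MSrc \<alpha>)" "STgt (MTgt \<alpha>) = STgt (MSrc \<alpha>)"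
    and "u \<in> Car (Apex (MSrc \<alpha>)) \<Longrightarrow> MMap \<alpha> u \<in> Car (Apex (MTgt \<alpha>))"
    and "u \<in> Car (Apex (MSrc \<alpha>)) \<Longrightarrow> LegL (MTgt \<alpha>) (MMap \<alpha> u) = LegL (MSrc \<alpha>) u"
    and "u \<in> Car (Apex (MSrc \<alpha>)) \<Longrightarrow> LegR (MTgt \<alpha>) (MMap \<alpha> u) = LegR (MSrc \<alpha>) u"
    and "g \<in> carrier G \<Longrightarrow> u \<in> Car (Apex (MSrc \<alpha>)) \<Longrightarrow>
      MMap \<alpha> (Act (Apex (MSrc \<alpha>)) g u) = Act (Apex (MTgt \<alpha>)) g (MMap \<alpha> u)"
    and "\<exists>n. (\<forall>u \<in> Car (Apex (MSrc \<alpha>)). n (MMap \<alpha> u) = u) \<and>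
      (\<forall>v \<in> Car (Apex (MTgt \<alpha>)). n v \<in> Car (Apex (MSrc \<alpha>)) \<and> MMap \<alpha> (n v) = v)"
proof -
  show "is_span G (MSrc \<alpha>)" "is_span G (MTgt \<alpha>)" "SSrc (MTgt \<alpha>) = SSrc (MSrc \<alpha>)" "STgt (MTgt \<alpha>) = STgt (MSrc \<alpha>)"
    "u \<in> Car (Apex (MSrc \<alpha>)) \<Longrightarrow> MMap \<alpha> u \<in> Car (Apex (MTgt \<alpha>))"
    "u \<in> Car (Apex (MSrc \<alpha>)) \<Longrightarrow> LegL (MTgt \<alpha>) (MMap \<alpha> u) = LegL (MSrc \<alpha>) u"
    "u \<in> Car (Apex (MSrc \<alpha>)) \<Longrightarrow> LegR (MTgt \<alpha>) (MMap \<alpha> u) = LegR (MSrc \<alpha>) u"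
    "g \<in> carrier G \<Longrightarrow> u \<in> Car (Apex (MSrc \<alpha>)) \<Longrightarrow>
      MMap \<alpha> (Act (Apex (MSrc \<alpha>)) g u) = Act (Apex (MTgt \<alpha>)) g (MMap \<alpha> u)"
    using assms by (auto simp: is_span_iso_def equivariant_maps_def)
  have "bij_betw (MMap \<alpha>) (Car (Apex (MSrc \<alpha>))) (Car (Apex (MTgt \<alpha>)))"
    using assms by (simp add: is_span_iso_def)
  then show "\<exists>n. (\<forall>u \<in> Car (Apex (MSrc \<alpha>)). n (MMap \<alpha> u) = u) \<and>
      (\<forall>v \<in> Car (Apex (MTgt \<alpha>)). n v \<in> Car (Apex (MSrc \<alpha>)) \<and> MMap \<alpha> (n v) = v)"
    by (intro exI[of _ "inv_into (Car (Apex (MSrc \<alpha>))) (MMap \<alpha>)"])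
      (auto simp: bij_betw_inv_into_left bij_betw_inv_into_right bij_betw_def inv_into_into)
qed

lemma span_iso_id: "is_span G f \<Longrightarrow> is_span_iso G (id_span_map f)"
  by (rule is_span_isoI[where n = "\<lambda>u. u"]) (auto simp: id_span_map_def is_span_legs)

lemma span_iso_vcomp:
  assumes \<alpha>: "is_span_iso G \<alpha>" and \<beta>: "is_span_iso G \<beta>" and eq: "MSrc \<beta> = MTgt \<alpha>"
  shows "is_span_iso G (vcomp_span_map \<beta> \<alpha>)"
proof -
  obtain m where m: "u \<in> Car (Apex (MSrc \<alpha>)) \<Longrightarrow> m (MMap \<alpha> u) = u"
      "v \<in> Car (Apex (MTgt \<alpha>)) \<Longrightarrow> m v \<in> Car (Apex (MSrc \<alpha>)) \<and> MMap \<alpha> (m v) = v" for u v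
    using is_span_isoD(9)[OF \<alpha>] by blast
  obtain n where n: "u \<in> Car (Apex (MTgt \<alpha>)) \<Longrightarrow> n (MMap \<beta> u) = u"
      "v \<in> Car (Apex (MTgt \<beta>)) \<Longrightarrow> n v \<in> Car (Apex (MTgt \<alpha>)) \<and> MMap \<beta> (n v) = v" for u v
    using is_span_isoD(9)[OF \<beta>] unfolding eq by blast
  note a = is_span_isoD[OF \<alpha>] and b = is_span_isoD[OF \<beta>, unfolded eq]
  show ?thesis
    by (rule is_span_isoI[where n = "\<lambda>u. m (n u)"])
      (use m n a(1-8) b(1-8) in \<open>auto simp: vcomp_span_map_def compose_def is_span_legs\<close>)
qed

lemma span_iso_hcomp:
  assumes G: "group G" and \<alpha>: "is_span_iso G \<alpha>" and \<beta>: "is_span_iso G \<beta>" and eq: "SSrc (MSrc \<beta>) = STgt (MSrc \<alpha>)"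
  shows "is_span_iso G (hcomp_span_map G \<beta> \<alpha>)"
proof -
  obtain m where m: "u \<in> Car (Apex (MSrc \<alpha>)) \<Longrightarrow> m (MMap \<alpha> u) = u"
      "v \<in> Car (Apex (MTgt \<alpha>)) \<Longrightarrow> m v \<in> Car (Apex (MSrc \<alpha>)) \<and> MMap \<alpha> (m v) = v" for u v
    using is_span_isoD(9)[OF \<alpha>] by blast
  obtain n where n: "u \<in> Car (Apex (MSrc \<beta>)) \<Longrightarrow> n (MMap \<beta> u) = u"
      "v \<in> Car (Apex (MTgt \<beta>)) \<Longrightarrow> n v \<in> Car (Apex (MSrc \<beta>)) \<and> MMap \<beta> (n v) = v" for u v
    using is_span_isoD(9)[OF \<beta>] by blast
  note a = is_span_isoD[OF \<alpha>] and b = is_span_isoD[OF \<beta>]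
  have legs: "LegR (MSrc \<alpha>) (m u) = LegR (MTgt \<alpha>) u" if "u \<in> Car (Apex (MTgt \<alpha>))" for u
    using a(7)[of "m u"] m(2)[OF that] by simp
  have legs': "LegL (MSrc \<beta>) (n v) = LegL (MTgt \<beta>) v" if "v \<in> Car (Apex (MTgt \<beta>))" for v
    using b(6)[of "n v"] n(2)[OF that] by simp
  show ?thesis
  proof (rule is_span_isoI[where n = "\<lambda>z. case z of Tup u v \<Rightarrow> Tup (m u) (n v)"], goal_cases)
    case 1 show ?case using is_span_comp[OF G a(1) b(1) eq] by (simp add: hcomp_span_map_def)
  next
    case 2 show ?case using is_span_comp[OF G a(2) b(2)] eq a(4) b(3) by (simp add: hcomp_span_map_def)
  next
    case (6 z)
    then show ?case using m n a b by (auto elim!: comp_span_cases simp: hcomp_span_map_def)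
  next
    case (7 g z)
    then show ?case
      using is_span_legs[OF a(1)] is_span_legs[OF b(1)] is_span_legs[OF a(2)] is_span_legs[OF b(2)] a(5-8) b(5-8) eq
      by (auto elim!: comp_span_cases simp: hcomp_span_map_def)
  next
    case (8 z)
    then show ?case using m n legs legs' by (auto elim!: comp_span_cases simp: hcomp_span_map_def)
  qed (use a(3,4) b(3,4) in \<open>auto simp: hcomp_span_map_def\<close>)
qed

lemma span_iso_assoc:
  assumes G: "group G" and f: "is_span G f" and h: "is_span G h" and k: "is_span G k"
    and eq: "SSrc h = STgt f" "SSrc k = STgt h"
  shows "is_span_iso G (assoc_span G k h f)"
proof (rule is_span_isoI[where n = "\<lambda>z. case z of Tup (Tup u v) w \<Rightarrow> Tup u (Tup v w)"], goal_cases)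
  case 1 show ?case using assms by (simp add: assoc_span_def is_span_comp)
next
  case 2 show ?case using assms by (simp add: assoc_span_def is_span_comp)
next
  case (6 z)
  then show ?case by (auto elim!: comp_span_cases simp: assoc_span_def)
next
  case (7 g z)
  then show ?case
    using is_span_legs[OF f] is_span_legs[OF h] is_span_legs[OF k] eq
    by (auto elim!: comp_span_cases simp: assoc_span_def)
next
  case (8 z)
  then show ?case by (auto elim!: comp_span_cases simp: assoc_span_def)
qed (auto simp: assoc_span_def)

lemma span_iso_lunit:
  assumes G: "group G" and f: "is_span G f"
  shows "is_span_iso G (lunit_span G f)"
proof -
  have T: "finite_gset G (STgt f)" using f by (simp add: is_span_def)
  show ?thesis
    by (rule is_span_isoI[where n = "\<lambda>u. Tup u (LegR f u)"])
      (use f is_span_comp[OF G f is_span_id[OF T]] is_span_legs[OF f] Act_in[OF T]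
        in \<open>auto elim!: comp_span_cases simp: lunit_span_def\<close>)
qed

lemma span_iso_runit:
  assumes G: "group G" and f: "is_span G f"
  shows "is_span_iso G (runit_span G f)"
proof -
  have S: "finite_gset G (SSrc f)" using f by (simp add: is_span_def)
  show ?thesis
    by (rule is_span_isoI[where n = "\<lambda>u. Tup (LegL f u) u"])
      (use f is_span_comp[OF G is_span_id[OF S] f] is_span_legs[OF f] Act_in[OF S]
        in \<open>auto elim!: comp_span_cases simp: runit_span_def\<close>)
qed

lemma span_map_simps:
  "MSrc (id_span_map f) = f" "MTgt (id_span_map f) = f"
  "MSrc (vcomp_span_map \<beta> \<alpha>) = MSrc \<alpha>" "MTgt (vcomp_span_map \<beta> \<alpha>) = MTgt \<beta>"
  "MSrc (hcomp_span_map G \<beta> \<alpha>) = comp_span G (MSrc \<beta>) (MSrc \<alpha>)"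
  "MTgt (hcomp_span_map G \<beta> \<alpha>) = comp_span G (MTgt \<beta>) (MTgt \<alpha>)"
  "MSrc (assoc_span G k h f) = comp_span G (comp_span G k h) f"
  "MTgt (assoc_span G k h f) = comp_span G k (comp_span G h f)"
  "MSrc (lunit_span G f) = comp_span G (id_span (STgt f)) f" "MTgt (lunit_span G f) = f"
  "MSrc (runit_span G f) = comp_span G f (id_span (SSrc f))" "MTgt (runit_span G f) = f"
  by (simp_all add: id_span_map_def vcomp_span_map_def hcomp_span_map_def assoc_span_def lunit_span_def
      runit_span_def)

lemma GSpan_simps [simp]:
  "Cell0 (GSpan G) = {S. finite_gset G S}" "Cell1 (GSpan G) = {f. is_span G f}"
  "Cell2 (GSpan G) = {\<alpha>. is_span_iso G \<alpha>}"
  "Src1 (GSpan G) = SSrc" "Tgt1 (GSpan G) = STgt" "Src2 (GSpan G) = MSrc" "Tgt2 (GSpan G) = MTgt"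
  "Id1 (GSpan G) = id_span" "Id2 (GSpan G) = id_span_map" "Comp1 (GSpan G) = comp_span G"
  "VComp (GSpan G) = vcomp_span_map" "HComp (GSpan G) = hcomp_span_map G"
  "Assoc2 (GSpan G) = assoc_span G" "LUnit2 (GSpan G) = lunit_span G" "RUnit2 (GSpan G) = runit_span G"
  by (simp_all add: GSpan_def)

lemma bicategory_cells_GSpan:
  assumes "group G"
  shows "bicategory_cells (GSpan G)"
  by unfold_locales (use assms in \<open>auto simp: is_span_id is_span_comp span_iso_id span_iso_vcomp span_iso_hcomp
    span_iso_assoc span_iso_lunit span_iso_runit is_span_isoD is_span_gsets span_map_simps\<close>)


section \<open>Permutative and symmetric monoidal Mackey functors\<close>

theorem lemma3p28:
  fixes G :: "('g, 'm) monoid_scheme"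
  assumes "group G" and "finite (carrier G)"
  shows "let A = (GSpan G :: ('g, 'x) span_bicat);
             MackPerm = Mack A (PermCat :: ('u :: infinite) smc_twocat);
             MackSym = Mack A (SymMonCat :: 'u smc_twocat);
             k = identity_functor
         in cat_functor MackPerm MackSym k \<and>
            (\<exists>l :: (_, _, _, _) functr. cat_functor MackSym MackPerm l \<and>
              (\<exists>\<mu>. natural_transformation MackSym MackSym (comp_functor k l) identity_functor \<mu> \<and>
                (\<forall>X \<in> Obj MackSym. pseudonatural_transformation A SymMonCat (\<mu> X) \<and>
                  (\<forall>S \<in> Cell0 A. categorical_equivalence
                    (Src (T0 (\<mu> X) S)) (Tgt (T0 (\<mu> X) S)) (T0 (\<mu> X) S)))) \<and>
              (\<exists>\<epsilon>. natural_transformation MackPerm MackPerm (comp_functor l k) identity_functor \<epsilon> \<and>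
                (\<forall>X \<in> Obj MackPerm. strict_natural_transformation A PermCat (\<epsilon> X) \<and>
                  (\<forall>S \<in> Cell0 A. categorical_equivalence
                    (Src (T0 (\<epsilon> X) S)) (Tgt (T0 (\<epsilon> X) S)) (T0 (\<epsilon> X) S)))))"
proof -
  interpret mackey_strictification "GSpan G :: ('g, 'x) span_bicat" "SymMonCat :: 'u smc_twocat"
    "{C. permutative_category C}" strictify strictify_functor evaluation inclusion
    using bicategory_cells_GSpan[OF assms(1)] strictification_SymMonCat
    by (rule mackey_strictification.intro)
  let ?A = "GSpan G :: ('g, 'x) span_bicat" and ?D = "SymMonCat :: 'u smc_twocat" and ?P = "PermCat :: 'u smc_twocat"
  have P: "full_sub_twocat ?D {C. permutative_category C} = ?P"
    by (simp add: PermCat_def)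
  have equivalence: "categorical_equivalence (Src (T0 (counit X) S)) (Tgt (T0 (counit X) S)) (T0 (counit X) S)"
    if "X \<in> Obj (Mack ?A ?D)" "S \<in> Cell0 ?A" for X S
  proof -
    have "pseudofunctor ?A ?D X" using that(1) by (simp add: Obj_Mack_D)
    then interpret X: pseudofunctor ?A ?D X .
    have "P0 X S \<in> Cell0 ?D" using that(2) by (rule X.spf.P0_in)
    then show ?thesis
      using that(2) small_symmetric_monoidal_category.categorical_equivalence_evaluation[of "P0 X S"]
      by (simp add: small_symmetric_monoidal_category_def)
  qed
  show ?thesis
    unfolding Let_def
  proof (intro conjI exI[of _ strictify_Mack] exI[of _ counit] ballI)
    show "cat_functor (Mack ?A ?P) (Mack ?A ?D) identity_functor"
      using inclusion_functor unfolding P .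
    show "cat_functor (Mack ?A ?D) (Mack ?A ?P) strictify_Mack"
      using strictification_functor unfolding P .
    show "natural_transformation (Mack ?A ?D) (Mack ?A ?D) (comp_functor identity_functor strictify_Mack)
        identity_functor counit"
      by (rule counit_natural_D)
    show "natural_transformation (Mack ?A ?P) (Mack ?A ?P) (comp_functor strictify_Mack identity_functor)
        identity_functor counit"
      using counit_natural_P unfolding P .
  next
    fix X assume X: "X \<in> Obj (Mack ?A ?D)"
    show "pseudonatural_transformation ?A ?D (counit X)"
      using counit_Arr[OF X] by (simp add: Hom_iff Arr_Mack_D pseudonatural_def pseudonatural_axioms_def)
    show "categorical_equivalence (Src (T0 (counit X) S)) (Tgt (T0 (counit X) S)) (T0 (counit X) S)"
      if "S \<in> Cell0 ?A" for S
      using X that by (rule equivalence)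
  next
    fix X assume X: "X \<in> Obj (Mack ?A ?P)"
    then have X': "X \<in> Obj (Mack ?A (full_sub_twocat ?D {C. permutative_category C}))" unfolding P .
    show "strict_natural_transformation ?A ?P (counit X)"
      using strict_counit_P[OF X'] unfolding P .
    show "categorical_equivalence (Src (T0 (counit X) S)) (Tgt (T0 (counit X) S)) (T0 (counit X) S)"
      if "S \<in> Cell0 ?A" for S
      using inclusion_Obj[OF X'] that by (rule equivalence)
  qed
qed

end
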